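(* Let $k\ge1$ be a real number, let $(N^n,g_N)$ be a closed Riemannian manifold with positive Ricci curvature, and let $\overline M^{n+1}=[a,\infty)\times N$ be equipped with the metric $\overline g=dr^2+\lambda^2(r)g_N$. Assume that $$C\ge\lambda'(r)>0,\qquad C\ge\lambda^{1+\alpha}(r)\,\lambda''(r)\ge0$$ for some positive constants $C$ and $\alpha$. Let $\Sigma$ be a smooth, closed, mean convex and star-shaped hypersurface in $\overline M^{n+1}$, and let $\Omega$ be the domain enclosed by $\Sigma$ and $\Gamma=\{a\}\times N$. Then $$\int_\Sigma\lambda^k\,d\mu\ \ge\ \frac{n}{n+k}\,|N|^{-\frac kn}\,|\Sigma|^{\frac{n+k}{n}}+k\int_\Omega\lambda^{k-1}\lambda'\,dv+\frac{k}{n+k}\,\lambda^k(a)\,|\Gamma| .$$ Equality holds if and only if $\Sigma$ is a slice.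
   Context: Here $a\ge0$ and $\lambda:[a,\infty)\to\mathbb{R}$ is smooth and positive on $(a,\infty)$; $\{a\}\times N$ is allowed to degenerate to a point. A slice is a hypersurface $\{r\}\times N$. $\Sigma$ is star-shaped if it is a graph $\{(u_0(x),x):x\in N\}$ of a smooth function $u_0:N\to(a,\infty)$. Mean convex means that the mean curvature $H$ of $\Sigma$ with respect to the unit normal $\nu$ pointing out of $\Omega$ (the side with $\langle\nu,\partial_r\rangle>0$) is positive, with the sign convention that slices have $H=n\lambda'/\lambda$. $d\mu$ and $dv$ are the area element of $\Sigma$ and the volume element of $\overline M$; $|\Sigma|,|\Gamma|$ are areas in $\overline g$, and $|N|$ is the volume of $(N,g_N)$. *)

theory Defs
  imports "HOL-Analysis.Analysis"
begin

section \<open>Smooth maps on open sets of Euclidean spaces\<close>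

primrec Ck_on :: "nat \<Rightarrow> 'a::euclidean_space set \<Rightarrow> ('a \<Rightarrow> 'b::real_normed_vector) \<Rightarrow> bool" where
  "Ck_on 0 S f \<longleftrightarrow> continuous_on S f"
| "Ck_on (Suc k) S f \<longleftrightarrow>
     f differentiable_on S \<and> (\<forall>v. Ck_on k S (\<lambda>x. frechet_derivative f (at x) v))"

text \<open>Only meant for open \<open>S\<close>: the derivatives are two-sided.\<close>

definition smooth_on :: "'a::euclidean_space set \<Rightarrow> ('a \<Rightarrow> 'b::real_normed_vector) \<Rightarrow> bool" where
  "smooth_on S f \<longleftrightarrow> (\<forall>k. Ck_on k S f)"

section \<open>Riemannian manifolds\<close>

text \<open>
  A manifold is given by an indexed atlas. The coordinate domains \<open>cdom\<close> are sets of points of the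
  type \<open>'m\<close>, the coordinates take values in the model space \<open>'e\<close>, and the dimension is \<open>DIM('e)\<close>.
  The value \<open>met N i y v w\<close> is the metric at the point with coordinates \<open>y\<close> in chart \<open>i\<close>, applied to
  the tangent vectors with components \<open>v\<close> and \<open>w\<close> in that chart; on \<open>v, w \<in> Basis\<close> these are
  the usual coefficients of the metric tensor.
\<close>

record ('i, 'm, 'e) riem =
  idx :: "'i set"
  cdom :: "'i \<Rightarrow> 'm set"
  chart :: "'i \<Rightarrow> 'm \<Rightarrow> 'e"
  met :: "'i \<Rightarrow> 'e \<Rightarrow> 'e \<Rightarrow> 'e \<Rightarrow> real"

definition points :: "('i, 'm, 'e) riem \<Rightarrow> 'm set" where
  "points N = (\<Union>i\<in>idx N. cdom N i)"

definition cimg :: "('i, 'm, 'e) riem \<Rightarrow> 'i \<Rightarrow> 'e set" where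
  "cimg N i = chart N i ` cdom N i"

definition cinv :: "('i, 'm, 'e) riem \<Rightarrow> 'i \<Rightarrow> 'e \<Rightarrow> 'm" where
  "cinv N i = inv_into (cdom N i) (chart N i)"

definition smooth_atlas :: "('i, 'm::topological_space, 'e::euclidean_space) riem \<Rightarrow> bool" where
  "smooth_atlas N \<longleftrightarrow>
     (\<forall>i\<in>idx N. open (cdom N i) \<and> open (cimg N i) \<and>
        homeomorphism (cdom N i) (cimg N i) (chart N i) (cinv N i)) \<and>
     (\<forall>i\<in>idx N. \<forall>j\<in>idx N.
        smooth_on (chart N i ` (cdom N i \<inter> cdom N j)) (chart N j \<circ> cinv N i))"

definition riemannian_metric :: "('i, 'm, 'e::euclidean_space) riem \<Rightarrow> bool" where
  "riemannian_metric N \<longleftrightarrow>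
     (\<forall>i\<in>idx N.
        (\<forall>v w. smooth_on (cimg N i) (\<lambda>y. met N i y v w)) \<and>
        (\<forall>y\<in>cimg N i. bilinear (met N i y) \<and>
           (\<forall>v w. met N i y v w = met N i y w v) \<and>
           (\<forall>v. v \<noteq> 0 \<longrightarrow> met N i y v v > 0))) \<and>
     (\<forall>i\<in>idx N. \<forall>j\<in>idx N. \<forall>p\<in>cdom N i \<inter> cdom N j. \<forall>v w.
        met N i (chart N i p) v w =
        (let T = frechet_derivative (chart N j \<circ> cinv N i) (at (chart N i p))
         in met N j (chart N j p) (T v) (T w)))"

text \<open>
  A compact Hausdorff manifold is automatically second countable, so that axiom is not listed.
\<close>

definition closed_riemannian_manifold ::
    "('i, 'm::t2_space, 'e::euclidean_space) riem \<Rightarrow> bool" where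
  "closed_riemannian_manifold N \<longleftrightarrow>
     smooth_atlas N \<and> riemannian_metric N \<and> points N = UNIV \<and> compact (UNIV :: 'm set)"

definition smooth_fun :: "('i, 'm, 'e::euclidean_space) riem \<Rightarrow> ('m \<Rightarrow> real) \<Rightarrow> bool" where
  "smooth_fun N u \<longleftrightarrow> (\<forall>i\<in>idx N. smooth_on (cimg N i) (u \<circ> cinv N i))"

section \<open>Riemannian measure\<close>

text \<open>
  The determinant of the matrix \<open>g b c\<close> with \<open>b, c \<in> Basis\<close>, by the Leibniz formula. The constant
  \<open>det\<close> of the library is only available for the model spaces \<open>real ^ 'n\<close>.
\<close>

definition gram_det :: "('e::euclidean_space \<Rightarrow> 'e \<Rightarrow> real) \<Rightarrow> real" where
  "gram_det g =
     (\<Sum>p | p permutes (Basis :: 'e set). of_int (sign p) * (\<Prod>b\<in>Basis. g b (p b)))"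

text \<open>The Borel measure which in every chart has the density \<open>sqrt (det g)\<close>.\<close>

definition riem_measure :: "('i, 'm::topological_space, 'e::euclidean_space) riem \<Rightarrow> 'm measure" where
  "riem_measure N =
     (THE M. space M = points N \<and> sets M = sets (restrict_space borel (points N)) \<and>
        (\<forall>i\<in>idx N. \<forall>E\<in>sets M. E \<subseteq> cdom N i \<longrightarrow>
           emeasure M E =
             (\<integral>\<^sup>+y\<in>chart N i ` E. ennreal (sqrt (gram_det (met N i y))) \<partial>lborel)))"

definition riem_vol :: "('i, 'm::topological_space, 'e::euclidean_space) riem \<Rightarrow> real" where
  "riem_vol N = measure (riem_measure N) (points N)"

section \<open>Levi-Civita connection and Ricci curvature in a chart\<close>

text \<open>The vector representing a linear form with respect to the inner product \<open>g\<close>.\<close>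

definition sharp :: "('e::euclidean_space \<Rightarrow> 'e \<Rightarrow> real) \<Rightarrow> ('e \<Rightarrow> real) \<Rightarrow> 'e" where
  "sharp g l = (THE x. \<forall>z. g x z = l z)"

text \<open>The trace \<open>g\<^sup>i\<^sup>j b\<^sub>i\<^sub>j\<close> of a bilinear form with respect to \<open>g\<close>.\<close>

definition metric_trace ::
    "('e::euclidean_space \<Rightarrow> 'e \<Rightarrow> real) \<Rightarrow> ('e \<Rightarrow> 'e \<Rightarrow> real) \<Rightarrow> real" where
  "metric_trace g b = (\<Sum>e\<in>Basis. sharp g (b e) \<bullet> e)"

text \<open>
  In the following, \<open>g y\<close> is the metric at \<open>y\<close> in one chart. The vector \<open>christoffel g y X Y\<close> has
  the components \<open>\<Gamma>\<^sup>k\<^sub>i\<^sub>j X\<^sup>i Y\<^sup>j\<close>; it is the covariant derivative along \<open>X\<close> of the vector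
  field with constant components \<open>Y\<close>.
\<close>

definition christoffel ::
    "('e::euclidean_space \<Rightarrow> 'e \<Rightarrow> 'e \<Rightarrow> real) \<Rightarrow> 'e \<Rightarrow> 'e \<Rightarrow> 'e \<Rightarrow> 'e" where
  "christoffel g y X Y = sharp (g y) (\<lambda>Z.
     (frechet_derivative (\<lambda>z. g z Y Z) (at y) X
      + frechet_derivative (\<lambda>z. g z X Z) (at y) Y
      - frechet_derivative (\<lambda>z. g z X Y) (at y) Z) / 2)"

definition curvature ::
    "('e::euclidean_space \<Rightarrow> 'e \<Rightarrow> 'e \<Rightarrow> real) \<Rightarrow> 'e \<Rightarrow> 'e \<Rightarrow> 'e \<Rightarrow> 'e \<Rightarrow> 'e" where
  "curvature g y X Y Z =
     frechet_derivative (\<lambda>z. christoffel g z Y Z) (at y) X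
     - frechet_derivative (\<lambda>z. christoffel g z X Z) (at y) Y
     + christoffel g y X (christoffel g y Y Z) - christoffel g y Y (christoffel g y X Z)"

definition ricci :: "('e::euclidean_space \<Rightarrow> 'e \<Rightarrow> 'e \<Rightarrow> real) \<Rightarrow> 'e \<Rightarrow> 'e \<Rightarrow> 'e \<Rightarrow> real" where
  "ricci g y Y Z = (\<Sum>e\<in>Basis. curvature g y e Y Z \<bullet> e)"

definition positive_ricci :: "('i, 'm, 'e::euclidean_space) riem \<Rightarrow> bool" where
  "positive_ricci N \<longleftrightarrow>
     (\<forall>i\<in>idx N. \<forall>y\<in>cimg N i. \<forall>v. v \<noteq> 0 \<longrightarrow> ricci (met N i) y v v > 0)"

section \<open>Parametrised hypersurfaces\<close>

text \<open>
  Here \<open>F\<close> maps \<open>N\<close> to \<open>M\<close>, where the atlases of \<open>N\<close> and \<open>M\<close> have the same index set and \<open>F\<close> maps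
  \<open>cdom N i\<close> into \<open>cdom M i\<close>, as is the case for graphs in a product.
\<close>

definition local_rep ::
    "('i, 'm, 'e) riem \<Rightarrow> ('i, 'p, 'f) riem \<Rightarrow> ('m \<Rightarrow> 'p) \<Rightarrow> 'i \<Rightarrow> 'e \<Rightarrow> 'f" where
  "local_rep N M F i = chart M i \<circ> F \<circ> cinv N i"

text \<open>
  The manifold \<open>N\<close> with the metric induced by \<open>F\<close>. Its Riemannian measure is the area element of
  the hypersurface, transported to \<open>N\<close>.
\<close>

definition induced ::
    "('i, 'm, 'e::euclidean_space) riem \<Rightarrow> ('i, 'p, 'f::euclidean_space) riem \<Rightarrow> ('m \<Rightarrow> 'p)
       \<Rightarrow> ('i, 'm, 'e) riem" where
  "induced N M F = N\<lparr>met := \<lambda>i y v w.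
     (let D = frechet_derivative (local_rep N M F i) (at y)
      in met M i (local_rep N M F i y) (D v) (D w))\<rparr>"

text \<open>
  The unit normal in chart \<open>i\<close>, on the side of the vector with components \<open>T\<close>.
\<close>

definition unit_normal ::
    "('i, 'm, 'e::euclidean_space) riem \<Rightarrow> ('i, 'p, 'f::euclidean_space) riem \<Rightarrow> ('m \<Rightarrow> 'p)
       \<Rightarrow> 'f \<Rightarrow> 'i \<Rightarrow> 'e \<Rightarrow> 'f" where
  "unit_normal N M F T i y =
     (let g = met M i (local_rep N M F i y); D = frechet_derivative (local_rep N M F i) (at y)
      in THE n. (\<forall>v. g n (D v) = 0) \<and> g n n = 1 \<and> g n T > 0)"

text \<open>
  The second fundamental form \<open>h v w = - \<langle>\<nabla>\<^sub>v (D w), n\<rangle> = \<langle>\<nabla>\<^sub>v n, D w\<rangle>\<close> with \<open>D\<close> the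
  differential of \<open>F\<close>. With this sign the outward normal of a round sphere in Euclidean space gives
  positive mean curvature.
\<close>

definition second_fundamental_form ::
    "('i, 'm, 'e::euclidean_space) riem \<Rightarrow> ('i, 'p, 'f::euclidean_space) riem \<Rightarrow> ('m \<Rightarrow> 'p)
       \<Rightarrow> 'f \<Rightarrow> 'i \<Rightarrow> 'e \<Rightarrow> 'e \<Rightarrow> 'e \<Rightarrow> real" where
  "second_fundamental_form N M F T i y v w =
     (let f = local_rep N M F i; D = frechet_derivative f (at y)
      in - met M i (f y)
             (frechet_derivative (\<lambda>z. frechet_derivative f (at z) w) (at y) v
              + christoffel (met M i) (f y) (D v) (D w))
             (unit_normal N M F T i y))"

definition mean_curvature ::
    "('i, 'm, 'e::euclidean_space) riem \<Rightarrow> ('i, 'p, 'f::euclidean_space) riem \<Rightarrow> ('m \<Rightarrow> 'p)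
       \<Rightarrow> 'f \<Rightarrow> 'i \<Rightarrow> 'e \<Rightarrow> real" where
  "mean_curvature N M F T i y =
     metric_trace (met (induced N M F) i y) (second_fundamental_form N M F T i y)"

section \<open>Warped products and graphs\<close>

text \<open>
  The space \<open>[a,\<infinity>) \<times> N\<close> with the metric \<open>dr\<^sup>2 + \<lambda>\<^sup>2 g\<close>, in the charts \<open>(r, x) \<mapsto> (r, chart N i x)\<close>. At \<open>r = a\<close>
  this is a boundary, or the metric degenerates if \<open>lam a = 0\<close>, so \<open>riemannian_metric\<close> and
  \<open>smooth_atlas\<close> are not claimed there; the slice \<open>r = a\<close> has measure zero.
\<close>

definition warped_product ::
    "real \<Rightarrow> (real \<Rightarrow> real) \<Rightarrow> ('i, 'm, 'e::euclidean_space) riem \<Rightarrow> ('i, real \<times> 'm, real \<times> 'e) riem"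
  where
  "warped_product a lam N =
     \<lparr>idx = idx N,
      cdom = (\<lambda>i. {a..} \<times> cdom N i),
      chart = (\<lambda>i (r, x). (r, chart N i x)),
      met = (\<lambda>i (r, y) (s, v) (t, w). s * t + (lam r)\<^sup>2 * met N i y v w)\<rparr>"

definition graph_map :: "('m \<Rightarrow> real) \<Rightarrow> 'm \<Rightarrow> real \<times> 'm" where
  "graph_map u x = (u x, x)"

definition slice :: "real \<Rightarrow> (real \<times> 'm) set" where
  "slice r = {r} \<times> UNIV"

definition star_shaped ::
    "real \<Rightarrow> ('i, 'm, 'e::euclidean_space) riem \<Rightarrow> ('m \<Rightarrow> real) \<Rightarrow> bool" where
  "star_shaped a N u \<longleftrightarrow> smooth_fun N u \<and> (\<forall>x. a < u x)"

text \<open>The normal \<open>n\<close> is chosen with \<open>\<langle>n, \<partial>\<^sub>r\<rangle> > 0\<close>; the field \<open>\<partial>\<^sub>r\<close> has components \<open>(1, 0)\<close> in every chart.\<close>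

definition mean_convex ::
    "real \<Rightarrow> (real \<Rightarrow> real) \<Rightarrow> ('i, 'm, 'e::euclidean_space) riem \<Rightarrow> ('m \<Rightarrow> real) \<Rightarrow> bool" where
  "mean_convex a lam N u \<longleftrightarrow>
     (\<forall>i\<in>idx N. \<forall>y\<in>cimg N i.
        mean_curvature N (warped_product a lam N) (graph_map u) (1, 0) i y > 0)"

definition enclosed :: "real \<Rightarrow> ('m \<Rightarrow> real) \<Rightarrow> (real \<times> 'm) set" where
  "enclosed a u = {(r, x). a < r \<and> r < u x}"

end

theory Submission
  imports Defs
begin

text \<open>
  Let \<open>n\<close> be the dimension of \<open>N\<close>, and write \<open>\<phi> = \<lambda> \<circ> u\<close> and \<open>V = \<surd>(1 + \<bar>\<nabla>u\<bar>\<^sup>2 / \<phi>\<^sup>2)\<close> for the graph \<open>\<Sigma>\<close> of \<open>u\<close>. The area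
  element of \<open>\<Sigma>\<close> is \<open>\<phi>\<^sup>n V\<close> times that of \<open>N\<close>, and the volume integral is elementary in the radial direction;
  its lower boundary term cancels the term with \<open>\<Gamma>\<close>. With \<open>s\<^sup>n = \<bar>\<Sigma>\<bar> / \<bar>N\<bar>\<close> the difference of the two sides
  becomes \<open>\<integral> (\<phi>\<^sup>k - s\<^sup>k) \<phi>\<^sup>n (V - 1) + P(\<phi>)\<close> over \<open>N\<close>, where
  \<open>P(t) = n / (n + k) t\<^sup>n\<^sup>+\<^sup>k - s\<^sup>k t\<^sup>n + k / (n + k) s\<^sup>n\<^sup>+\<^sup>k\<close> is nonnegative by Young's inequality and vanishes only
  at \<open>s\<close>. The integrand can be negative only where \<open>\<phi> < s\<close> and the graph is steep, and steepness is
  what mean convexity controls.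

  The mean curvature \<open>H\<close> satisfies \<open>\<phi> H = n \<lambda>' / V - div (\<nabla>u / (\<phi> V))\<close> (\<open>divergence_formula\<close> and
  \<open>mean_curvature_graph\<close>). Multiplication by a nonnegative test function \<open>\<eta>\<close> and the divergence theorem
  on \<open>N\<close> give \<open>\<integral> n \<lambda>' \<eta> / V + \<langle>\<nabla>\<eta>, \<nabla>u\<rangle> / (\<phi> V) \<ge> 0\<close> (\<open>weak_curvature_nonneg\<close>). For \<open>\<eta> = f(\<phi>) / \<lambda>'\<close> with
  \<open>f \<ge> 0\<close> and \<open>\<lambda>'' \<ge> 0\<close> this implies \<open>\<integral> n f(\<phi>) / V + f'(\<phi>) \<phi> (V - 1 / V) \<ge> 0\<close>. The choice \<open>f = P / n\<close> below \<open>s\<close>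
  and \<open>f = 0\<close> above \<open>s\<close> is admissible because \<open>P\<close> vanishes to second order at \<open>s\<close>, and it is the right one
  because \<open>t P'(t) / n = (t\<^sup>k - s\<^sup>k) t\<^sup>n\<close>: the integrand above then dominates the one just obtained at every
  point (\<open>pointwise_inequality\<close>). So the difference of the two sides is nonnegative. If it is zero, then
  \<open>f(\<phi>) = 0\<close> because \<open>H > 0\<close>, hence \<open>\<phi> \<ge> s\<close>, hence \<open>P(\<phi>) = 0\<close>, and \<open>\<phi> = s\<close> everywhere (\<open>gap_integral\<close>).

  The remaining work is geometric. The Riemannian measure of a closed manifold is shown to exist and to
  be given by the chart densities (\<open>riem_measure_exists\<close>, \<open>riem_measure_eqI\<close>), and those of \<open>\<Sigma>\<close>, \<open>\<Gamma>\<close> and the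
  warped product are expressed by that of \<open>N\<close>. The divergence theorem is reduced to compactly supported
  fields in one chart by means of bump functions (\<open>bump_cover\<close>) and the invariance of \<open>\<langle>\<nabla>\<eta>, \<nabla>u\<rangle>\<close> under
  changes of charts (\<open>gradprod_eq\<close>).
\<close>

section \<open>Inner products and metric traces\<close>

definition pd_form :: "('e::euclidean_space \<Rightarrow> 'e \<Rightarrow> real) \<Rightarrow> bool" where
  "pd_form g \<longleftrightarrow> bilinear g \<and> (\<forall>v w. g v w = g w v) \<and> (\<forall>v. v \<noteq> 0 \<longrightarrow> g v v > 0)"

lemma pd_formD:
  assumes "pd_form g"
  shows "bilinear g" "g v w = g w v" "v \<noteq> 0 \<Longrightarrow> g v v > 0" "g v v \<ge> 0"
    "linear (g v)" "linear (\<lambda>v. g v w)"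
proof -
  show b: "bilinear g" and "g v w = g w v" and p: "v \<noteq> 0 \<Longrightarrow> g v v > 0"
    using assms by (auto simp: pd_form_def)
  show "linear (g v)" "linear (\<lambda>v. g v w)" using b by (auto simp: bilinear_def)
  show "g v v \<ge> 0" using p bilinear_lzero[OF b] by (cases "v = 0") (auto intro: less_imp_le)
qed

lemma linear_functional_sum: "linear (l :: 'e::euclidean_space \<Rightarrow> real) \<Longrightarrow> l z = (\<Sum>b\<in>Basis. (z \<bullet> b) * l b)"
  by (subst (1) euclidean_representation[of z, symmetric])
     (simp add: linear_sum linear_cmul)

lemma pd_form_unique:
  assumes g: "pd_form g" and "\<And>z. g x z = g y z"
  shows "x = y"
proof (rule ccontr)
  assume "x \<noteq> y"
  then have "g (x - y) (x - y) > 0" using pd_formD(3)[OF g] by simp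
  then show False using assms(2)[of "x - y"] by (simp add: bilinear_lsub[OF pd_formD(1)[OF g]])
qed

lemma sharp_unique:
  assumes g: "pd_form g" and "\<And>z. g x z = l z"
  shows "sharp g l = x"
  unfolding sharp_def using assms pd_form_unique[OF g] by (intro the_equality) auto

lemma sharp_ex:
  assumes g: "pd_form g" and l: "linear l"
  shows "\<exists>x. \<forall>z. g x z = l z"
proof -
  define A where "A x = (\<Sum>b\<in>Basis. g x b *\<^sub>R b)" for x
  have lin: "linear A" unfolding A_def
    by (intro linearI) (simp_all add: bilinear_ladd[OF pd_formD(1)[OF g]] scaleR_left_distrib sum.distrib
        bilinear_lmul[OF pd_formD(1)[OF g]] scaleR_sum_right)
  have Ab: "A x \<bullet> b = g x b" if "b \<in> Basis" for x b
    using that by (simp add: A_def)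
  have key: "g x z = (\<Sum>b\<in>Basis. (z \<bullet> b) * (A x \<bullet> b))" for x z
    by (subst linear_functional_sum[OF pd_formD(5)[OF g]]) (simp add: Ab)
  have "inj A"
  proof (rule injI)
    fix x y assume "A x = A y"
    then show "x = y" using pd_form_unique[OF g, of x y] by (simp add: key)
  qed
  then have "surj A" using lin linear_injective_imp_surjective by blast
  then obtain x where x: "A x = (\<Sum>b\<in>Basis. l b *\<^sub>R b)" by (metis surjD)
  have "g x z = l z" for z
    unfolding key x by (subst linear_functional_sum[OF l]) simp
  then show ?thesis by blast
qed

lemma sharp_eq:
  assumes g: "pd_form g" and l: "linear l"
  shows "g (sharp g l) z = l z"
  using sharp_ex[OF g l] sharp_unique[OF g] by metis

lemma sharp_form: "pd_form g \<Longrightarrow> sharp g (g x) = x"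
  by (rule sharp_unique) auto

lemma metric_trace_self:
  assumes g: "pd_form (g :: 'e::euclidean_space \<Rightarrow> 'e \<Rightarrow> real)"
  shows "metric_trace g g = real DIM('e)"
  by (simp add: metric_trace_def sharp_form[OF g])

lemma metric_trace_add:
  assumes g: "pd_form g" and "bilinear b" "bilinear c"
  shows "metric_trace g (\<lambda>v w. b v w + c v w) = metric_trace g b + metric_trace g c"
proof -
  have *: "linear (b v)" "linear (c v)" for v using assms by (auto simp: bilinear_def)
  have "sharp g (\<lambda>w. b v w + c v w) = sharp g (b v) + sharp g (c v)" for v
    by (rule sharp_unique[OF g]) (simp add: bilinear_ladd[OF pd_formD(1)[OF g]] sharp_eq[OF g] *)
  then show ?thesis by (simp add: metric_trace_def inner_add_left sum.distrib)
qed

lemma metric_trace_scale: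
  assumes g: "pd_form g" and "bilinear b"
  shows "metric_trace g (\<lambda>v w. c * b v w) = c * metric_trace g b"
proof -
  have *: "linear (b v)" for v using assms by (auto simp: bilinear_def)
  have "sharp g (\<lambda>w. c * b v w) = c *\<^sub>R sharp g (b v)" for v
    by (rule sharp_unique[OF g]) (simp add: bilinear_lmul[OF pd_formD(1)[OF g]] sharp_eq[OF g] *)
  then show ?thesis by (simp add: metric_trace_def sum_distrib_left)
qed

lemma metric_trace_tensor:
  assumes g: "pd_form g" and "linear l" "linear m"
  shows "metric_trace g (\<lambda>v w. l v * m w) = l (sharp g m)"
proof -
  have "sharp g (\<lambda>w. l v * m w) = l v *\<^sub>R sharp g m" for v
    by (rule sharp_unique[OF g]) (simp add: bilinear_lmul[OF pd_formD(1)[OF g]] sharp_eq[OF g] assms)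
  then show ?thesis
    by (simp add: metric_trace_def linear_functional_sum[OF assms(2), of "sharp g m"] mult.commute)
qed

text \<open>
  The trace contracts \<open>b\<close> with the inverse matrix of \<open>g\<close>, which is symmetric. The rows of that inverse are
  the vectors \<open>E e\<close> in the proof.
\<close>

lemma metric_trace_transpose:
  fixes b :: "'e::euclidean_space \<Rightarrow> 'e \<Rightarrow> real"
  assumes g: "pd_form g" and b: "bilinear b"
  shows "metric_trace g (\<lambda>v w. b w v) = metric_trace g b"
proof -
  define E where "E e = sharp g (\<lambda>z. z \<bullet> e)" for e
  have lin: "linear (\<lambda>z. z \<bullet> e)" for e :: 'e by (rule linearI) (auto simp: inner_add_left)
  have E: "g (E e) z = z \<bullet> e" for e z by (simp add: E_def sharp_eq[OF g lin])
  have sym: "E e \<bullet> f = E f \<bullet> e" for e f by (metis E pd_formD(2)[OF g])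
  have *: "sharp g l \<bullet> e = (\<Sum>f\<in>Basis. (E e \<bullet> f) * l f)" if l: "linear l" for l e
  proof -
    have "sharp g l \<bullet> e = g (sharp g l) (E e)" by (metis E pd_formD(2)[OF g])
    also have "\<dots> = l (E e)" by (rule sharp_eq[OF g l])
    finally show ?thesis by (simp add: linear_functional_sum[OF l, of "E e"])
  qed
  have 1: "linear (b v)" "linear (\<lambda>w. b w v)" for v using b by (auto simp: bilinear_def)
  have "metric_trace g (\<lambda>v w. b w v) = (\<Sum>e\<in>Basis. \<Sum>f\<in>Basis. (E e \<bullet> f) * b f e)"
    by (simp add: metric_trace_def * 1)
  also have "\<dots> = (\<Sum>f\<in>Basis. \<Sum>e\<in>Basis. (E f \<bullet> e) * b f e)"
    by (subst sum.swap) (simp add: sym)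
  also have "\<dots> = metric_trace g b"
    by (simp add: metric_trace_def * 1)
  finally show ?thesis .
qed

text \<open>
  The Sherman--Morrison formula. The metric induced on the graph of \<open>u\<close> is \<open>\<lambda>\<^sup>2 g + du \<otimes> du\<close>, so this computes
  its inverse. The parameter \<open>t\<close> interpolates between a multiple of \<open>g\<close> and the perturbed form; it
  serves to differentiate the determinant along this path below.
\<close>

lemma rank_one_update:
  fixes g :: "'e::euclidean_space \<Rightarrow> 'e \<Rightarrow> real"
  assumes g: "pd_form g" and d: "linear d" and c: "c > 0" and t: "t \<ge> 0"
  defines "G \<equiv> sharp g d" and "h \<equiv> \<lambda>v w. c * g v w + t * (d v * d w)"
  shows "pd_form h"
    "linear l \<Longrightarrow> sharp h l = (1 / c) *\<^sub>R (sharp g l - (t * l G / (c + t * d G)) *\<^sub>R G)"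
    "bilinear b \<Longrightarrow> metric_trace h b = (metric_trace g b - t * b G G / (c + t * d G)) / c"
    "d G \<ge> 0"
proof -
  have gb: "bilinear g" using pd_formD(1)[OF g] .
  have dl: "d (x + y) = d x + d y" "d (r *\<^sub>R x) = r * d x" for x y r
    using linear_add[OF d] linear_scale[OF d] by auto
  have bil: "bilinear h" unfolding h_def bilinear_def
    by (auto intro!: linearI simp: bilinear_ladd[OF gb] bilinear_radd[OF gb] bilinear_lmul[OF gb]
       bilinear_rmul[OF gb] dl algebra_simps)
  show pd: "pd_form h" unfolding pd_form_def
  proof (intro conjI allI impI)
    show "bilinear h" by fact
    show "h v w = h w v" for v w by (simp add: h_def pd_formD(2)[OF g, of v w])
    show "h v v > 0" if "v \<noteq> 0" for v
      using pd_formD(3)[OF g that] c t by (simp add: h_def add_pos_nonneg)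
  qed
  have gG: "g G z = d z" for z unfolding G_def by (rule sharp_eq[OF g d])
  show dG: "d G \<ge> 0" using gG[of G] pd_formD(4)[OF g, of G] by simp
  have pos: "c + t * d G > 0" using dG c t by (simp add: add_pos_nonneg)
  show sh: "sharp h l = (1 / c) *\<^sub>R (sharp g l - (t * l G / (c + t * d G)) *\<^sub>R G)" if l: "linear l" for l
  proof (rule sharp_unique[OF pd])
    fix z
    have ds: "d (sharp g l) = l G"
      using gG[of "sharp g l"] sharp_eq[OF g l, of G] pd_formD(2)[OF g, of G] by simp
    have dsub: "d (x - y) = d x - d y" for x y using linear_diff[OF d] .
    let ?X = "(1 / c) *\<^sub>R (sharp g l - (t * l G / (c + t * d G)) *\<^sub>R G)"
    have 1: "c * g ?X z = l z - (t * l G / (c + t * d G)) * d z"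
      using c by (simp add: bilinear_lmul[OF gb] bilinear_lsub[OF gb] gG sharp_eq[OF g l])
    have "d ?X = 1 / c * (l G - (t * l G / (c + t * d G)) * d G)"
      by (simp only: dl dsub ds)
    also have "\<dots> = l G / (c + t * d G)" using pos c by (simp add: field_simps)
    finally show "h ?X z = l z" unfolding h_def 1 by simp
  qed
  show "metric_trace h b = (metric_trace g b - t * b G G / (c + t * d G)) / c" if b: "bilinear b"
  proof -
    have 1: "linear (b v)" "linear (\<lambda>v. b v w)" for v w using b by (auto simp: bilinear_def)
    have "metric_trace h b = (\<Sum>e\<in>Basis. (sharp g (b e) \<bullet> e - t / (c + t * d G) * ((G \<bullet> e) * b e G)) / c)"
      by (simp add: metric_trace_def sh[OF 1(1)] inner_diff_left diff_divide_distrib mult_ac)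
    also have "\<dots> = (metric_trace g b - t / (c + t * d G) * (\<Sum>e\<in>Basis. (G \<bullet> e) * b e G)) / c"
      by (simp add: metric_trace_def sum_subtractf sum_distrib_left sum_divide_distrib[symmetric])
    also have "(\<Sum>e\<in>Basis. (G \<bullet> e) * b e G) = b G G"
      by (rule linear_functional_sum[OF 1(2), symmetric])
    finally show ?thesis by simp
  qed
qed

section \<open>Gram determinants\<close>

text \<open>
  An index type with as many elements as the basis of \<open>'e\<close>. It turns forms and linear maps on \<open>'e\<close> into
  matrices, for which multiplicativity of the determinant, Cramer's rule and the change of variables
  formula are known.
\<close>

typedef (overloaded) ('e::euclidean_space) basis_index = "Basis :: 'e set"
  morphisms basis_vec Abs_basis_index
  using nonempty_Basis by blast

lemma basis_vec_in [simp]: "basis_vec i \<in> Basis"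
  using basis_vec .

lemma basis_vec_inj: "inj basis_vec"
  by (metis basis_vec_inject injI)

lemma range_basis_vec: "range (basis_vec :: 'e::euclidean_space basis_index \<Rightarrow> 'e) = Basis"
  using type_definition.Rep_range[OF type_definition_basis_index] .

lemma bij_basis_vec: "bij_betw (basis_vec :: 'e::euclidean_space basis_index \<Rightarrow> 'e) UNIV Basis"
  by (simp add: bij_betw_def basis_vec_inj range_basis_vec)

lemma inner_basis_vec [simp]: "basis_vec i \<bullet> basis_vec j = (if i = j then 1 else 0)"
  by (simp add: inner_Basis basis_vec_inject)

lemma sum_basis_vec: "(\<Sum>i\<in>UNIV. f (basis_vec i)) = sum f (Basis :: 'e::euclidean_space set)"
  using sum.reindex_bij_betw[OF bij_basis_vec] .

lemma prod_basis_vec: "(\<Prod>i\<in>UNIV. f (basis_vec i)) = prod f (Basis :: 'e::euclidean_space set)"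
  using prod.reindex_bij_betw[OF bij_basis_vec] .

instance basis_index :: (euclidean_space) finite
proof
  have "finite (basis_vec -` Basis :: 'a basis_index set)"
    by (intro finite_vimageI finite_Basis basis_vec_inj)
  then show "finite (UNIV :: 'a basis_index set)"
    by (rule rev_finite_subset) auto
qed

text \<open>
  The order is arbitrary: the change of variables formula for \<open>real ^ 'n\<close> asks for a well-ordered
  index type.
\<close>

instantiation basis_index :: (euclidean_space) wellorder
begin

definition basis_rank :: "'a basis_index \<Rightarrow> nat" where
  "basis_rank = (SOME f. inj f)"

lemma basis_rank_inj: "inj (basis_rank :: 'a basis_index \<Rightarrow> nat)"
proof -
  have "\<exists>f :: 'a basis_index \<Rightarrow> nat. inj f"
    using finite_imp_inj_to_nat_seg[of "UNIV :: 'a basis_index set"] by auto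
  then show ?thesis unfolding basis_rank_def by (rule someI_ex)
qed

definition less_eq_basis_index :: "'a basis_index \<Rightarrow> 'a basis_index \<Rightarrow> bool" where
  "less_eq_basis_index i j \<longleftrightarrow> basis_rank i \<le> basis_rank j"

definition less_basis_index :: "'a basis_index \<Rightarrow> 'a basis_index \<Rightarrow> bool" where
  "less_basis_index i j \<longleftrightarrow> basis_rank i < basis_rank j"

instance
proof
  fix P :: "'a basis_index \<Rightarrow> bool" and x :: "'a basis_index"
  assume *: "\<And>x. (\<And>y. y < x \<Longrightarrow> P y) \<Longrightarrow> P x"
  show "P x"
    by (induction x rule: measure_induct_rule[of basis_rank]) (auto intro: * simp: less_basis_index_def)
qed (use basis_rank_inj in \<open>auto simp: less_eq_basis_index_def less_basis_index_def inj_def\<close>)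

end

definition form_matrix :: "('e::euclidean_space \<Rightarrow> 'e \<Rightarrow> real) \<Rightarrow> real^'e basis_index^'e basis_index" where
  "form_matrix g = (\<chi> i j. g (basis_vec i) (basis_vec j))"

text \<open>
  Both signs count the same transpositions: renaming commutes with composition and maps a transposition to a transposition.
\<close>

lemma sign_map_permutation:
  assumes f: "inj_on f A" and "p permutes A" and "finite A"
  shows "sign (map_permutation A f p) = sign p"
  using assms(2,3)
proof (induction rule: permutes_induct)
  case id
  then show ?case by (simp add: map_permutation_id'[OF f, unfolded id_def] id_def sign_id[unfolded id_def])
next
  case (swap a b p)
  have bij: "bij_betw f A (f ` A)" using f by (simp add: bij_betw_def)
  have "map_permutation A f p permutes f ` A"
    by (rule map_permutation_permutes[OF bij swap(4)])
  then have 1: "permutation (map_permutation A f p)"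
    using \<open>finite A\<close> permutation_permutes by blast
  have 2: "permutation p" using swap(4) \<open>finite A\<close> permutation_permutes by blast
  have "map_permutation A f (Transposition.transpose a b \<circ> p)
      = Transposition.transpose (f a) (f b) \<circ> map_permutation A f p"
    using map_permutation_compose'[OF f, of p "Transposition.transpose a b"] swap
      map_permutation_transpose[OF f, of a b]
    by (metis map_permutation_compose' map_permutation_transpose permutes_swap_id f)
  moreover have "f a \<noteq> f b" using swap f by (auto simp: inj_on_def)
  ultimately show ?case
    using swap.hyps by (simp only: sign_compose[OF permutation_swap_id 1] sign_compose[OF permutation_swap_id 2] sign_swap_id swap.IH if_False)
qed

text \<open>
  Needed twice: to pass from \<open>Basis\<close> to the index type of matrices, and from the spatial part of the
  basis of a product to the basis of the factor.
\<close>

lemma leibniz_reindex: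
  fixes m :: "'b \<Rightarrow> 'b \<Rightarrow> real"
  assumes f: "bij_betw f A B" and A: "finite A"
  shows "(\<Sum>p | p permutes B. of_int (sign p) * (\<Prod>b\<in>B. m b (p b)))
       = (\<Sum>p | p permutes A. of_int (sign p) * (\<Prod>a\<in>A. m (f a) (f (p a))))"
proof -
  have inj: "inj_on f A" and im: "f ` A = B" using f by (auto simp: bij_betw_def)
  have bij: "bij_betw (map_permutation A f) {p. p permutes A} {p. p permutes B}"
  proof (rule bij_betw_byWitness[where f' = "map_permutation B (inv_into A f)"])
    show "\<forall>p\<in>{p. p permutes A}. map_permutation B (inv_into A f) (map_permutation A f p) = p"
      by (intro ballI map_permutation_compose_inv[OF f]) (simp_all add: inv_into_f_f[OF inj])
    show "\<forall>p\<in>{p. p permutes B}. map_permutation A f (map_permutation B (inv_into A f) p) = p"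
      by (intro ballI map_permutation_compose_inv[OF bij_betw_inv_into[OF f]]) (simp_all add: im[symmetric] f_inv_into_f)
    show "map_permutation A f ` {p. p permutes A} \<subseteq> {p. p permutes B}"
      using map_permutation_permutes[OF f] by auto
    show "map_permutation B (inv_into A f) ` {p. p permutes B} \<subseteq> {p. p permutes A}"
      using map_permutation_permutes[OF bij_betw_inv_into[OF f]] by auto
  qed
  define F where "F p = of_int (sign p) * (\<Prod>b\<in>B. m b (p b))" for p
  have "F (map_permutation A f p) = of_int (sign p) * (\<Prod>a\<in>A. m (f a) (f (p a)))" if p: "p permutes A" for p
  proof -
    have "(\<Prod>b\<in>B. m b (map_permutation A f p b)) = (\<Prod>a\<in>A. m (f a) (map_permutation A f p (f a)))"
      by (rule prod.reindex_bij_betw[OF f, symmetric])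
    also have "\<dots> = (\<Prod>a\<in>A. m (f a) (f (p a)))"
      by (intro prod.cong) (auto simp: map_permutation_apply inj)
    finally show ?thesis
      by (simp add: F_def sign_map_permutation[OF inj p A])
  qed
  moreover have "(\<Sum>p | p permutes A. F (map_permutation A f p)) = (\<Sum>p | p permutes B. F p)"
    by (rule sum.reindex_bij_betw[OF bij])
  ultimately show ?thesis by (simp add: F_def)
qed

lemma gram_det_form_matrix: "gram_det g = det (form_matrix g)"
  unfolding gram_det_def det_def leibniz_reindex[OF bij_basis_vec finite]
  by (simp add: form_matrix_def)

lemma linear_in_coords:
  assumes "linear (l :: 'e::euclidean_space \<Rightarrow> real)"
  shows "l z = (\<Sum>i\<in>UNIV. (z \<bullet> basis_vec i) * l (basis_vec i))"
  by (subst linear_functional_sum[OF assms]) (simp flip: sum_basis_vec)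

text \<open>
  Cramer's rule. It exhibits \<open>sharp g l\<close> as a quotient of polynomials in the coefficients, hence
  continuously differentiable when they are, and it evaluates the terms of Jacobi's formula.
\<close>

lemma gram_det_replace_row:
  fixes g :: "'e::euclidean_space \<Rightarrow> 'e \<Rightarrow> real"
  assumes g: "pd_form g" and l: "linear l" and b: "b \<in> Basis"
  shows "gram_det (\<lambda>v w. if v = b then l w else g v w) = (sharp g l \<bullet> b) * gram_det g"
proof -
  obtain k where k: "b = basis_vec k" using b range_basis_vec by blast
  let ?x = "\<chi> i. sharp g l \<bullet> basis_vec i"
  have *: "l z = (\<Sum>i\<in>UNIV. (sharp g l \<bullet> basis_vec i) * g (basis_vec i) z)" for z
    using linear_in_coords[OF pd_formD(6)[OF g], of "sharp g l" z] sharp_eq[OF g l, of z] by simp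
  have "form_matrix (\<lambda>v w. if v = b then l w else g v w)
      = (\<chi> i. if i = k then \<Sum>i\<in>UNIV. ?x $ i *s row i (form_matrix g) else row i (form_matrix g))"
    unfolding vec_eq_iff
  proof (intro allI)
    fix i j
    show "form_matrix (\<lambda>v w. if v = b then l w else g v w) $ i $ j = (\<chi> i. if i = k
        then \<Sum>i\<in>UNIV. ?x $ i *s row i (form_matrix g) else row i (form_matrix g)) $ i $ j"
      by (cases "i = k") (simp_all add: form_matrix_def row_def k basis_vec_inject *)
  qed
  then show ?thesis
    using cramer_lemma_transpose[of k ?x "form_matrix g"] by (simp only: gram_det_form_matrix k vec_lambda_beta)
qed

lemma gram_det_nonzero:
  fixes g :: "'e::euclidean_space \<Rightarrow> 'e \<Rightarrow> real"
  assumes g: "pd_form g"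
  shows "gram_det g \<noteq> 0"
proof
  assume "gram_det g = 0"
  then have "\<not> invertible (form_matrix g)" by (simp add: gram_det_form_matrix invertible_det_nz)
  then have "\<not> inj ((*v) (form_matrix g))"
    using invertible_left_inverse matrix_left_invertible_injective by blast
  then obtain x where x: "form_matrix g *v x = 0" "x \<noteq> 0"
    by (metis matrix_left_invertible_ker matrix_left_invertible_injective)
  define v where "v = (\<Sum>i\<in>UNIV. x $ i *\<^sub>R basis_vec i)"
  have coord: "v \<bullet> basis_vec i = x $ i" for i
    by (simp add: v_def inner_sum_left if_distrib cong: if_cong)
  have 1: "g (basis_vec i) v = 0" for i
  proof -
    have "g (basis_vec i) v = (form_matrix g *v x) $ i"
      by (subst linear_in_coords[OF pd_formD(5)[OF g]])
         (simp add: coord matrix_vector_mult_def form_matrix_def mult.commute)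
    then show ?thesis using x by simp
  qed
  have "g v v = 0" by (subst linear_in_coords[OF pd_formD(6)[OF g]]) (simp add: 1)
  then have "v = 0" using pd_formD(3)[OF g, of v] by force
  then show False using x(2) coord by (simp add: vec_eq_iff)
qed

lemma gram_det_inner: "gram_det ((\<bullet>) :: 'e::euclidean_space \<Rightarrow> 'e \<Rightarrow> real) = 1"
proof -
  have "form_matrix ((\<bullet>) :: 'e \<Rightarrow> 'e \<Rightarrow> real) = mat 1"
    by (simp add: form_matrix_def mat_def vec_eq_iff)
  then show ?thesis by (simp add: gram_det_form_matrix)
qed

text \<open>
  The determinant does not vanish on the segment of inner products from the standard one to \<open>g\<close>, and it
  is \<open>1\<close> at the standard one.
\<close>

lemma gram_det_pos:
  fixes g :: "'e::euclidean_space \<Rightarrow> 'e \<Rightarrow> real"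
  assumes g: "pd_form g"
  shows "gram_det g > 0"
proof (rule ccontr)
  assume neg: "\<not> ?thesis"
  define h where "h t = (\<lambda>v w. (1 - t) * (v \<bullet> w) + t * g v w)" for t :: real
  have cont: "continuous_on {0..1} (\<lambda>t. gram_det (h t))"
    unfolding gram_det_def h_def by (intro continuous_intros)
  have "gram_det (h 0) = 1" "gram_det (h 1) = gram_det g"
    using gram_det_inner by (simp_all add: h_def)
  then obtain t where t: "0 \<le> t" "t \<le> 1" "gram_det (h t) = 0"
    using IVT2'[of "\<lambda>t. gram_det (h t)" 1 0 0, OF _ _ _ cont] neg by auto
  have "pd_form (h t)" unfolding pd_form_def
  proof (intro conjI allI impI)
    show "bilinear (h t)" unfolding h_def bilinear_def
      by (auto intro!: linearI simp: bilinear_ladd[OF pd_formD(1)[OF g]] bilinear_radd[OF pd_formD(1)[OF g]]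
          bilinear_lmul[OF pd_formD(1)[OF g]] bilinear_rmul[OF pd_formD(1)[OF g]] inner_add algebra_simps)
    show "h t v w = h t w v" for v w by (simp add: h_def pd_formD(2)[OF g, of v w] inner_commute)
    show "h t v v > 0" if "v \<noteq> 0" for v
    proof (cases "t = 1")
      case False
      then have "(1 - t) * (v \<bullet> v) > 0" using t that by simp
      then show ?thesis using t pd_formD(4)[OF g, of v] by (simp add: h_def add_pos_nonneg)
    qed (use pd_formD(3)[OF g that] in \<open>simp add: h_def\<close>)
  qed
  then show False using gram_det_nonzero t by blast
qed

text \<open>
  Jacobi's formula. By the product rule the derivative is the sum of the determinants in which one row
  of \<open>g\<close> is replaced by its derivative; Cramer's rule turns them into the diagonal entries of
  \<open>g\<^sup>-\<^sup>1 g'\<close>.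
\<close>

lemma has_derivative_gram_det:
  fixes g :: "'x::real_normed_vector \<Rightarrow> 'e::euclidean_space \<Rightarrow> 'e \<Rightarrow> real"
  assumes g: "pd_form (g x)"
    and g': "\<And>b c. b \<in> Basis \<Longrightarrow> c \<in> Basis \<Longrightarrow> ((\<lambda>x. g x b c) has_derivative (\<lambda>h. g' h b c)) (at x within S)"
    and lin: "\<And>h v. linear (g' h v)"
  shows "((\<lambda>x. gram_det (g x)) has_derivative (\<lambda>h. gram_det (g x) * metric_trace (g x) (g' h))) (at x within S)"
proof -
  have "((\<lambda>x. gram_det (g x)) has_derivative (\<lambda>h. \<Sum>p | p permutes (Basis :: 'e set). of_int (sign p) *
      (\<Sum>b\<in>Basis. g' h b (p b) * (\<Prod>c\<in>Basis - {b}. g x c (p c))))) (at x within S)"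
    unfolding gram_det_def
  proof (intro has_derivative_sum has_derivative_mult_right has_derivative_prod g')
    fix p b assume "p \<in> {p. p permutes (Basis :: 'e set)}" "b \<in> (Basis :: 'e set)"
    then show "b \<in> Basis" "p b \<in> Basis" by (simp_all add: permutes_in_image)
  qed
  moreover have "(\<Sum>p | p permutes (Basis :: 'e set). of_int (sign p) *
      (\<Sum>b\<in>Basis. g' h b (p b) * (\<Prod>c\<in>Basis - {b}. g x c (p c))))
      = gram_det (g x) * metric_trace (g x) (g' h)" for h
  proof -
    have "(\<Sum>p | p permutes (Basis :: 'e set). of_int (sign p) *
        (\<Sum>b\<in>Basis. g' h b (p b) * (\<Prod>c\<in>Basis - {b}. g x c (p c))))
        = (\<Sum>p | p permutes (Basis :: 'e set). of_int (sign p) *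
        (\<Sum>b\<in>Basis. \<Prod>c\<in>Basis. (if c = b then g' h c (p c) else g x c (p c))))"
      by (intro sum.cong arg_cong2[of _ _ _ _ "(*)"] refl) (simp add: prod.remove[of Basis])
    also have "\<dots> = (\<Sum>b\<in>Basis. gram_det (\<lambda>v w. if v = b then g' h b w else g x v w))"
      unfolding gram_det_def sum_distrib_left
      by (subst sum.swap) (intro sum.cong refl arg_cong2[of _ _ _ _ "(*)"] prod.cong, auto)
    also have "\<dots> = gram_det (g x) * metric_trace (g x) (g' h)"
      by (simp add: gram_det_replace_row[OF g lin] metric_trace_def sum_distrib_left mult.commute)
    finally show ?thesis .
  qed
  ultimately show ?thesis by simp
qed

lemma gram_det_scale:
  fixes g :: "'e::euclidean_space \<Rightarrow> 'e \<Rightarrow> real"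
  shows "gram_det (\<lambda>v w. c * g v w) = c ^ DIM('e) * gram_det g"
  by (simp add: gram_det_def prod.distrib sum_distrib_left mult_ac)

text \<open>
  The matrix determinant lemma. By Jacobi's formula and the Sherman--Morrison formula,
  \<open>p t = det (g + t d \<otimes> d)\<close> solves \<open>p' = p q / (1 + t q)\<close> with \<open>q = d (sharp g d)\<close>, so \<open>p t / (1 + t q)\<close>
  is constant.
\<close>

lemma gram_det_rank_one:
  fixes g :: "'e::euclidean_space \<Rightarrow> 'e \<Rightarrow> real"
  assumes g: "pd_form g" and d: "linear d"
  shows "gram_det (\<lambda>v w. g v w + d v * d w) = (1 + d (sharp g d)) * gram_det g"
proof -
  define q where "q = d (sharp g d)"
  define p where "p t = gram_det (\<lambda>v w. g v w + t * (d v * d w))" for t :: real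
  have q: "q \<ge> 0" unfolding q_def using rank_one_update(4)[OF g d, of 1 0] by simp
  have dd: "bilinear (\<lambda>v w. d v * d w)"
    using linear_add[OF d] linear_scale[OF d] by (auto simp: bilinear_def algebra_simps intro!: linearI)
  have p': "(p has_real_derivative p t * (q / (1 + t * q))) (at t within {0..1})" if t: "t \<ge> 0" for t
  proof -
    note r = rank_one_update[OF g d, of 1 t, simplified, OF t]
    have tr: "metric_trace (\<lambda>v w. g v w + t * (d v * d w)) (\<lambda>v w. h * (d v * d w)) = h * (q / (1 + t * q))" for h
    proof -
      have "metric_trace (\<lambda>v w. g v w + t * (d v * d w)) (\<lambda>v w. d v * d w) = q / (1 + t * q)"
        using r(3)[OF dd] metric_trace_tensor[OF g d d] q t
        by (simp add: q_def[symmetric] field_simps add_nonneg_eq_0_iff)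
      then show ?thesis by (simp add: metric_trace_scale[OF r(1) dd])
    qed
    have lin: "linear (\<lambda>w. h * (d v * d w))" for h v
      using linear_add[OF d] linear_scale[OF d] by (auto simp: algebra_simps intro!: linearI)
    have "(p has_derivative (\<lambda>h. p t * metric_trace (\<lambda>v w. g v w + t * (d v * d w)) (\<lambda>v w. h * (d v * d w))))
        (at t within {0..1})"
      unfolding p_def
      by (rule has_derivative_gram_det) (use r(1) in \<open>auto intro!: derivative_eq_intros lin\<close>)
    then show ?thesis
      unfolding tr has_field_derivative_def by (rule has_derivative_eq_rhs) (simp add: fun_eq_iff)
  qed
  have pos: "1 + t * q > 0" if "t \<ge> 0" for t using that q by (simp add: add_pos_nonneg)
  have "\<exists>c. \<forall>t\<in>{0..1}. p t / (1 + t * q) = c"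
  proof (rule has_field_derivative_zero_constant)
    fix t :: real assume "t \<in> {0..1}"
    then have t: "t \<ge> 0" by simp
    show "((\<lambda>t. p t / (1 + t * q)) has_field_derivative 0) (at t within {0..1})"
      using pos[OF t] by (auto intro!: derivative_eq_intros p'[OF t] simp: field_simps)
  qed auto
  then have "p 1 / (1 + 1 * q) = p 0 / (1 + 0 * q)"
    by (metis atLeastAtMost_iff order_refl zero_le_one)
  then have "p 1 = (1 + q) * p 0" using pos[of 1] by (simp add: field_simps)
  then show ?thesis by (simp add: p_def q_def)
qed

text \<open>
  This gives the area element of a graph, with \<open>c = \<lambda>\<^sup>2\<close> and \<open>d = du\<close>.
\<close>

lemma gram_det_graph:
  fixes g :: "'e::euclidean_space \<Rightarrow> 'e \<Rightarrow> real"
  assumes g: "pd_form g" and d: "linear d" and c: "c > 0"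
  shows "gram_det (\<lambda>v w. c * g v w + d v * d w) = c ^ DIM('e) * (1 + d (sharp g d) / c) * gram_det g"
proof -
  have "(\<lambda>v w. c * g v w + d v * d w) = (\<lambda>v w. c * (g v w + (d v / sqrt c) * (d w / sqrt c)))"
    using c by (auto simp: fun_eq_iff field_simps)
  moreover have d': "linear (\<lambda>v. d v / sqrt c)"
    using linear_add[OF d] linear_scale[OF d] by (auto simp: add_divide_distrib intro!: linearI)
  moreover have "d (sharp g (\<lambda>v. d v / sqrt c)) / sqrt c = d (sharp g d) / c"
  proof -
    have "sharp g (\<lambda>v. d v / sqrt c) = (1 / sqrt c) *\<^sub>R sharp g d"
      by (rule sharp_unique[OF g]) (simp add: bilinear_lmul[OF pd_formD(1)[OF g]] sharp_eq[OF g d])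
    then show ?thesis using c by (simp add: linear_scale[OF d])
  qed
  ultimately show ?thesis using gram_det_rank_one[OF g d'] by (simp add: gram_det_scale)
qed

text \<open>
  This gives the volume element of a warped product. A permutation which moves the radial basis vector
  \<open>(1, 0)\<close> contributes a vanishing factor to the Leibniz sum.
\<close>

lemma gram_det_block:
  fixes m :: "real \<times> 'e::euclidean_space \<Rightarrow> real \<times> 'e \<Rightarrow> real" and g :: "'e \<Rightarrow> 'e \<Rightarrow> real"
  assumes "m (1, 0) (1, 0) = 1" "\<And>w. m (1, 0) (0, w) = 0" "\<And>v w. m (0, v) (0, w) = g v w"
  shows "gram_det m = gram_det g"
proof -
  define B where "B = Pair (0::real) ` (Basis :: 'e set)"
  have Basis_eq: "(Basis :: (real \<times> 'e) set) = insert (1, 0) B"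
    by (auto simp: Basis_prod_def B_def)
  have fin: "finite B" and nB: "(1, 0) \<notin> B" by (auto simp: B_def)
  have bij: "bij_betw (Pair (0::real)) (Basis :: 'e set) B"
    by (auto simp: B_def bij_betw_def inj_on_def)
  let ?f = "\<lambda>p. of_int (sign p) * (\<Prod>b\<in>insert (1, 0) B. m b (p b))"
  have zero: "(\<Sum>q | q permutes B. ?f (Transposition.transpose (1, 0) b \<circ> q)) = 0" if b: "b \<in> B" for b
  proof (intro sum.neutral ballI)
    fix q assume "q \<in> {q. q permutes B}"
    then have "q (1, 0) = (1, 0)" using nB by (simp add: permutes_not_in)
    then have "m (1, 0) ((Transposition.transpose (1, 0) b \<circ> q) (1, 0)) = 0"
      using b assms(2) by (auto simp: B_def)
    then show "?f (Transposition.transpose (1, 0) b \<circ> q) = 0"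
      using fin by simp
  qed
  have "gram_det m = (\<Sum>q | q permutes B. ?f q)"
    unfolding gram_det_def Basis_eq sum_over_permutations_insert[OF fin nB]
    using fin nB zero by simp
  also have "\<dots> = (\<Sum>q | q permutes B. of_int (sign q) * (\<Prod>b\<in>B. m b (q b)))"
  proof (intro sum.cong refl)
    fix q assume "q \<in> {q. q permutes B}"
    then have "q (1, 0) = (1, 0)" using nB by (simp add: permutes_not_in)
    then show "?f q = of_int (sign q) * (\<Prod>b\<in>B. m b (q b))" using fin nB assms(1) by simp
  qed
  also have "\<dots> = gram_det g"
    unfolding leibniz_reindex[OF bij finite_Basis] gram_det_def assms(3) ..
  finally show ?thesis .
qed

definition lin_det :: "('e::euclidean_space \<Rightarrow> 'e) \<Rightarrow> real" where
  "lin_det T = det (\<chi> i j. T (basis_vec j) \<bullet> basis_vec i :: real^'e basis_index^'e basis_index)"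

lemma gram_det_pullback:
  fixes g :: "'e::euclidean_space \<Rightarrow> 'e \<Rightarrow> real"
  assumes g: "bilinear g"
  shows "gram_det (\<lambda>v w. g (T v) (T w)) = (lin_det T)\<^sup>2 * gram_det g"
proof -
  let ?B = "\<chi> i j. T (basis_vec j) \<bullet> basis_vec i :: real^'e basis_index^'e basis_index"
  have 1: "linear (\<lambda>v. g v w)" "linear (g v)" for v w using g by (auto simp: bilinear_def)
  have 2: "g (T (basis_vec i)) (T (basis_vec j)) = (\<Sum>k\<in>UNIV. \<Sum>l\<in>UNIV. (T (basis_vec i) \<bullet> basis_vec k) *
      ((T (basis_vec j) \<bullet> basis_vec l) * g (basis_vec k) (basis_vec l)))" for i j
    by (subst linear_in_coords[OF 1(1)], subst linear_in_coords[OF 1(2)]) (simp add: sum_distrib_left)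
  have "form_matrix (\<lambda>v w. g (T v) (T w)) = Finite_Cartesian_Product.transpose ?B ** (form_matrix g ** ?B)"
    by (simp add: form_matrix_def vec_eq_iff matrix_matrix_mult_def transpose_def 2 sum_distrib_left mult_ac)
  then show ?thesis
    by (simp add: gram_det_form_matrix det_mul det_transpose lin_det_def power2_eq_square)
qed

section \<open>Continuously differentiable functions\<close>

abbreviation fd :: "('a::real_normed_vector \<Rightarrow> 'b::real_normed_vector) \<Rightarrow> 'a \<Rightarrow> 'a \<Rightarrow> 'b" where
  "fd f x \<equiv> frechet_derivative f (at x)"

lemma fd_eq: "(f has_derivative f') (at x) \<Longrightarrow> fd f x = f'"
  by (metis frechet_derivative_at)

lemma fd_cong:
  assumes "open S" "x \<in> S" "\<And>y. y \<in> S \<Longrightarrow> f y = g y"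
  shows "fd f x = fd g x"
proof -
  have "(f has_derivative D) (at x) \<longleftrightarrow> (g has_derivative D) (at x)" for D
    using has_derivative_transform_within_open[of f D x UNIV S g]
      has_derivative_transform_within_open[of g D x UNIV S f] assms by auto
  then show ?thesis by (simp add: frechet_derivative_def)
qed

lemma linear_fd: "f differentiable (at x) \<Longrightarrow> linear (fd f x)"
  using linear_frechet_derivative .

text \<open>
  Like the predicate \<open>Ck_on\<close> this asks for continuity of every directional derivative separately; in finite
  dimension that is continuity of the derivative.
\<close>

definition C1_on :: "'e::euclidean_space set \<Rightarrow> ('e \<Rightarrow> real) \<Rightarrow> bool" where
  "C1_on S f \<longleftrightarrow> (\<forall>x\<in>S. f differentiable (at x)) \<and> (\<forall>v. continuous_on S (\<lambda>x. fd f x v))"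

lemma C1_onI:
  assumes "\<And>x. x \<in> S \<Longrightarrow> (f has_derivative f' x) (at x)" "\<And>v. continuous_on S (\<lambda>x. f' x v)"
  shows "C1_on S f"
proof -
  have "continuous_on S (\<lambda>x. fd f x v)" for v
    using assms(2)[of v] by (rule continuous_on_eq) (simp add: fd_eq[OF assms(1)])
  then show ?thesis using assms(1) by (auto simp: C1_on_def differentiable_def)
qed

lemma C1_onD:
  assumes "C1_on S f"
  shows "x \<in> S \<Longrightarrow> (f has_derivative fd f x) (at x)" "x \<in> S \<Longrightarrow> f differentiable (at x)"
    "continuous_on S (\<lambda>x. fd f x v)" "x \<in> S \<Longrightarrow> linear (fd f x)"
  using assms by (auto simp: C1_on_def frechet_derivative_works[symmetric] linear_fd)

lemma C1_on_continuous: "C1_on S f \<Longrightarrow> continuous_on S f"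
  by (meson C1_onD(1) continuous_at_imp_continuous_on has_derivative_continuous)

lemma C1_on_subset: "C1_on S f \<Longrightarrow> T \<subseteq> S \<Longrightarrow> C1_on T f"
  unfolding C1_on_def by (meson continuous_on_subset subsetD)

lemma C1_on_cong:
  assumes "open S" "C1_on S f" "\<And>y. y \<in> S \<Longrightarrow> f y = g y"
  shows "C1_on S g"
proof (rule C1_onI[of _ _ "fd f"])
  show "(g has_derivative fd f x) (at x)" if "x \<in> S" for x
    using has_derivative_transform_within_open[OF C1_onD(1)[OF assms(2) that], of S g] assms that by auto
qed (rule C1_onD(3)[OF assms(2)])

lemma C1_on_Un:
  assumes "open S" "open T" "C1_on S f" "C1_on T f"
  shows "C1_on (S \<union> T) f"
  using assms unfolding C1_on_def by (auto intro: continuous_on_open_Un)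

lemma C1_on_const [intro]: "C1_on S (\<lambda>x. c)"
  by (rule C1_onI) (auto intro: derivative_eq_intros)

lemma C1_on_add: "C1_on S f \<Longrightarrow> C1_on S g \<Longrightarrow> C1_on S (\<lambda>x. f x + g x)"
  by (rule C1_onI[of _ _ "\<lambda>x v. fd f x v + fd g x v"])
     (auto intro!: has_derivative_add C1_onD continuous_intros)

lemma C1_on_mult:
  assumes "C1_on S f" "C1_on S g" shows "C1_on S (\<lambda>x. f x * g x)"
  by (rule C1_onI[of _ _ "\<lambda>x v. f x * fd g x v + fd f x v * g x"])
     (use assms C1_on_continuous[OF assms(1)] C1_on_continuous[OF assms(2)]
       in \<open>auto intro!: has_derivative_mult C1_onD continuous_intros\<close>)

lemma C1_on_sum: "finite A \<Longrightarrow> (\<And>a. a \<in> A \<Longrightarrow> C1_on S (f a)) \<Longrightarrow> C1_on S (\<lambda>x. \<Sum>a\<in>A. f a x)"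
  by (induction rule: finite_induct) (auto intro: C1_on_add)

lemma C1_on_prod: "finite A \<Longrightarrow> (\<And>a. a \<in> A \<Longrightarrow> C1_on S (f a)) \<Longrightarrow> C1_on S (\<lambda>x. \<Prod>a\<in>A. f a x)"
  by (induction rule: finite_induct) (auto intro: C1_on_mult)

lemma C1_on_compose_real:
  assumes f: "C1_on S f"
    and p: "\<And>x. x \<in> S \<Longrightarrow> (p has_real_derivative p' (f x)) (at (f x))"
    and c: "continuous_on (f ` S) p'"
  shows "C1_on S (\<lambda>x. p (f x))"
proof (rule C1_onI[of _ _ "\<lambda>x v. p' (f x) * fd f x v"])
  show "((\<lambda>x. p (f x)) has_derivative (\<lambda>v. p' (f x) * fd f x v)) (at x)" if "x \<in> S" for x
    using has_derivative_compose[OF C1_onD(1)[OF f that] p[OF that, unfolded has_field_derivative_def]]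
    by (simp add: mult.commute)
  show "continuous_on S (\<lambda>x. p' (f x) * fd f x v)" for v
    using f by (intro continuous_intros C1_onD continuous_on_compose2[OF c] C1_on_continuous) auto
qed

lemma C1_on_inverse:
  assumes f: "C1_on S f" and "\<And>x. x \<in> S \<Longrightarrow> f x \<noteq> 0"
  shows "C1_on S (\<lambda>x. inverse (f x))"
proof (rule C1_on_compose_real[OF f, of inverse "\<lambda>y. - (inverse y * inverse y)"])
  show "(inverse has_real_derivative - (inverse (f x) * inverse (f x))) (at (f x))" if "x \<in> S" for x
    using DERIV_inverse[OF assms(2)[OF that]] by simp
qed (use assms in \<open>auto intro!: continuous_intros\<close>)

lemma C1_on_divide:
  assumes "C1_on S f" "C1_on S g" "\<And>x. x \<in> S \<Longrightarrow> g x \<noteq> 0"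
  shows "C1_on S (\<lambda>x. f x / g x)"
  unfolding divide_inverse using assms by (intro C1_on_mult C1_on_inverse)

lemma C1_on_sqrt:
  assumes f: "C1_on S f" and "\<And>x. x \<in> S \<Longrightarrow> f x > 0"
  shows "C1_on S (\<lambda>x. sqrt (f x))"
  by (rule C1_on_compose_real[OF f, of sqrt "\<lambda>y. inverse (sqrt y) / 2"])
     (use assms in \<open>auto intro!: DERIV_real_sqrt continuous_intros simp: less_imp_neq[symmetric]\<close>)

lemma C1_on_power: "C1_on S f \<Longrightarrow> C1_on S (\<lambda>x. f x ^ n)"
  by (induction n) (auto intro: C1_on_mult)

lemma smooth_on_has_derivative:
  assumes S: "open S" and f: "smooth_on S f" and x: "x \<in> S"
  shows "(f has_derivative fd f x) (at x)" "f differentiable (at x)"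
proof -
  have "Ck_on (Suc 0) S f" using f unfolding smooth_on_def by (rule spec)
  then have "f differentiable_on S" unfolding Ck_on.simps by (rule conjunct1)
  then have "f differentiable (at x within S)" using x unfolding differentiable_on_def by (rule bspec)
  then show "f differentiable (at x)" unfolding at_within_open[OF x S] .
  then show "(f has_derivative fd f x) (at x)" unfolding frechet_derivative_works .
qed

lemma smooth_on_fd:
  assumes "smooth_on S f" shows "smooth_on S (\<lambda>x. fd f x v)"
  unfolding smooth_on_def
proof
  fix k
  have "Ck_on (Suc k) S f" using assms unfolding smooth_on_def by (rule spec)
  then show "Ck_on k S (\<lambda>x. fd f x v)" unfolding Ck_on.simps by (rule conjunct2[THEN spec])
qed

lemma smooth_on_continuous:
  assumes "smooth_on S f" shows "continuous_on S f"
proof -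
  have "Ck_on 0 S f" using assms unfolding smooth_on_def by (rule spec)
  then show ?thesis unfolding Ck_on.simps .
qed

lemma smooth_on_C1:
  assumes "open S" "smooth_on S f" shows "C1_on S f"
proof (rule C1_onI[of _ _ "fd f"])
  show "(f has_derivative fd f x) (at x)" if "x \<in> S" for x
    by (rule smooth_on_has_derivative(1)[OF assms that])
  show "continuous_on S (\<lambda>x. fd f x v)" for v
    by (rule smooth_on_continuous[OF smooth_on_fd[OF assms(2)]])
qed

lemma C1_on_compose:
  fixes q :: "'a::euclidean_space \<Rightarrow> 'b::euclidean_space"
  assumes f: "C1_on T f" and q: "\<And>x. x \<in> S \<Longrightarrow> (q has_derivative q' x) (at x)"
    and q': "\<And>v. continuous_on S (\<lambda>x. q' x v)" and im: "q ` S \<subseteq> T"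
  shows "C1_on S (\<lambda>x. f (q x))"
proof (rule C1_onI[of _ _ "\<lambda>x v. fd f (q x) (q' x v)"])
  show "((\<lambda>x. f (q x)) has_derivative (\<lambda>v. fd f (q x) (q' x v))) (at x)" if "x \<in> S" for x
    using has_derivative_compose[OF q[OF that] C1_onD(1)[OF f]] that im by auto
  have "continuous_on S q" using q
    by (meson continuous_at_imp_continuous_on has_derivative_continuous)
  then have "continuous_on S (\<lambda>x. \<Sum>b\<in>Basis. (q' x v \<bullet> b) * fd f (q x) b)" for v
    using im by (intro continuous_intros q' continuous_on_compose2[OF C1_onD(3)[OF f]]) auto
  moreover have "fd f (q x) (q' x v) = (\<Sum>b\<in>Basis. (q' x v \<bullet> b) * fd f (q x) b)" if "x \<in> S" for x v
    using that im by (intro linear_functional_sum C1_onD(4)[OF f]) auto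
  ultimately show "continuous_on S (\<lambda>x. fd f (q x) (q' x v))" for v
    by (metis (no_types, lifting) continuous_on_cong)
qed

lemma C1_on_gram_det:
  assumes "\<And>b c. b \<in> Basis \<Longrightarrow> c \<in> Basis \<Longrightarrow> C1_on S (\<lambda>y. g y b c)"
  shows "C1_on S (\<lambda>y. gram_det (g y :: 'e::euclidean_space \<Rightarrow> 'e \<Rightarrow> real))"
  unfolding gram_det_def
  by (intro C1_on_sum C1_on_mult C1_on_prod C1_on_const assms)
     (auto simp: permutes_in_image finite_permutations)

text \<open>
  By Cramer's rule the components are quotients of determinants.
\<close>

lemma C1_on_sharp:
  fixes g :: "'x::euclidean_space \<Rightarrow> 'e::euclidean_space \<Rightarrow> 'e \<Rightarrow> real"
  assumes S: "open S" and pd: "\<And>y. y \<in> S \<Longrightarrow> pd_form (g y)" and lin: "\<And>y. y \<in> S \<Longrightarrow> linear (l y)"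
    and g: "\<And>b c. b \<in> Basis \<Longrightarrow> c \<in> Basis \<Longrightarrow> C1_on S (\<lambda>y. g y b c)"
    and l: "\<And>b. b \<in> Basis \<Longrightarrow> C1_on S (\<lambda>y. l y b)" and b: "b \<in> Basis"
  shows "C1_on S (\<lambda>y. sharp (g y) (l y) \<bullet> b)"
proof (rule C1_on_cong[OF S])
  show "gram_det (\<lambda>v w. if v = b then l y w else g y v w) / gram_det (g y) = sharp (g y) (l y) \<bullet> b"
    if "y \<in> S" for y
    using gram_det_replace_row[OF pd lin b, OF that that] gram_det_nonzero[OF pd[OF that]] by simp
  show "C1_on S (\<lambda>y. gram_det (\<lambda>v w. if v = b then l y w else g y v w) / gram_det (g y))"
  proof (intro C1_on_divide C1_on_gram_det g)
    show "gram_det (g y) \<noteq> 0" if "y \<in> S" for y using gram_det_nonzero[OF pd[OF that]] .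
    show "C1_on S (\<lambda>y. if c = b then l y d else g y c d)" if "c \<in> Basis" "d \<in> Basis" for c d
      using l g that by (cases "c = b") auto
  qed
qed

lemma C1_on_linear_apply:
  fixes G :: "'e::euclidean_space \<Rightarrow> 'e"
  assumes S: "open S" and l: "\<And>b. b \<in> Basis \<Longrightarrow> C1_on S (\<lambda>y. l y b)" and lin: "\<And>y. y \<in> S \<Longrightarrow> linear (l y)"
    and G: "\<And>b. b \<in> Basis \<Longrightarrow> C1_on S (\<lambda>y. G y \<bullet> b)"
  shows "C1_on S (\<lambda>y. l y (G y))"
  by (rule C1_on_cong[OF S, of "\<lambda>y. \<Sum>b\<in>Basis. (G y \<bullet> b) * l y b"])
     (auto intro!: C1_on_sum C1_on_mult l G simp: linear_functional_sum[OF lin])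

section \<open>Integrals of compactly supported derivatives\<close>

text \<open>
  The difference quotients of \<open>f\<close> in the direction \<open>v\<close> have integral zero, because Lebesgue measure is
  translation invariant. By the mean value theorem they are bounded by a constant on a fixed compact
  set and vanish elsewhere, so dominated convergence applies.
\<close>

lemma integral_partial_derivative_UNIV:
  fixes f :: "'e::euclidean_space \<Rightarrow> real"
  assumes f: "C1_on UNIV f" and K: "compact K" and 0: "\<And>x. x \<notin> K \<Longrightarrow> f x = 0"
  shows "integrable lborel (\<lambda>x. fd f x v)" "(\<integral>x. fd f x v \<partial>lborel) = 0"
proof -
  note D = C1_onD(1)[OF f, OF UNIV_I]
  have cont: "continuous_on UNIV (\<lambda>x. fd f x v)" by (rule C1_onD(3)[OF f])
  have contf: "continuous_on UNIV f" by (rule C1_on_continuous[OF f])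
  have D0: "fd f x v = 0" if "x \<notin> K" for x
  proof -
    have "fd f x = fd (\<lambda>x. 0) x"
      using that 0 compact_imp_closed[OF K] by (intro fd_cong[of "- K"]) auto
    then show ?thesis by (simp add: frechet_derivative_const)
  qed
  obtain B where B: "\<And>x. x \<in> K \<Longrightarrow> \<bar>fd f x v\<bar> \<le> B"
    using compact_imp_bounded[OF compact_continuous_image[OF continuous_on_subset[OF cont] K]]
    by (auto simp: bounded_iff)
  have B': "\<bar>fd f x v\<bar> \<le> \<bar>B\<bar>" for x using B[of x] D0[of x] by (cases "x \<in> K") auto
  \<comment> \<open>contains every point whose difference quotient can be nonzero\<close>
  define K' where "K' = (\<lambda>(x, t). x - t *\<^sub>R v) ` (K \<times> {0..1})"
  have K': "compact K'" unfolding K'_def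
    by (intro compact_continuous_image compact_Times K compact_Icc)
       (auto simp: case_prod_unfold intro!: continuous_intros)
  have inK': "x + t *\<^sub>R v \<notin> K" if "x \<notin> K'" "t \<in> {0..1}" for x t
  proof
    assume "x + t *\<^sub>R v \<in> K"
    then have "x \<in> K'" unfolding K'_def using that(2)
      by (intro image_eqI[of _ _ "(x + t *\<^sub>R v, t)"]) auto
    then show False using that by simp
  qed
  have intf: "integrable lborel f"
  proof -
    have "integrable lborel (\<lambda>x. indicator K x *\<^sub>R f x)"
      using borel_integrable_compact[OF K continuous_on_subset[OF contf]] by simp
    moreover have "(\<lambda>x. indicator K x *\<^sub>R f x) = f" using 0 by (auto simp: indicator_def fun_eq_iff)
    ultimately show ?thesis by simp
  qed
  have shift: "integrable lborel (\<lambda>x. f (x + c))" "(\<integral>x. f (x + c) \<partial>lborel) = (\<integral>x. f x \<partial>lborel)" for c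
  proof -
    have m: "(\<lambda>x. c + x) \<in> borel_measurable lborel" by simp
    have mf: "f \<in> borel_measurable borel" using contf by (rule borel_measurable_continuous_onI)
    have e: "distr lborel borel (\<lambda>x. c + x) = lborel" using lborel_distr_plus[of c] by simp
    show "integrable lborel (\<lambda>x. f (x + c))"
      using integrable_distr_eq[of "\<lambda>x. c + x" lborel borel f] mf intf e by (simp add: add.commute)
    show "(\<integral>x. f (x + c) \<partial>lborel) = (\<integral>x. f x \<partial>lborel)"
      using integral_distr[of "\<lambda>x. c + x" lborel borel f] mf e by (simp add: add.commute)
  qed
  define q where "q m x = real (Suc m) * (f (x + (1 / real (Suc m)) *\<^sub>R v) - f x)" for m x
  have q0: "(\<integral>x. q m x \<partial>lborel) = 0" for m
    unfolding q_def using shift intf by simp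
  have line: "((\<lambda>t. f (x + t *\<^sub>R v)) has_real_derivative fd f (x + t *\<^sub>R v) v) (at t)" for x t
  proof -
    have "((\<lambda>t. x + t *\<^sub>R v) has_derivative (\<lambda>h. h *\<^sub>R v)) (at t)"
      by (auto intro!: derivative_eq_intros)
    from has_derivative_compose[OF this D] show ?thesis
      unfolding has_field_derivative_def
      by (rule has_derivative_eq_rhs) (auto simp: fun_eq_iff linear_scale[OF C1_onD(4)[OF f]])
  qed
  have lim: "(\<lambda>m. q m x) \<longlonglongrightarrow> fd f x v" for x
  proof -
    have "((\<lambda>h. (f (x + h *\<^sub>R v) - f x) / h) \<longlongrightarrow> fd f x v) (at 0)"
      using line[of x 0] by (simp add: DERIV_def)
    moreover have "filterlim (\<lambda>m. 1 / real (Suc m)) (at 0) sequentially"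
      using LIMSEQ_inverse_real_of_nat by (simp add: filterlim_at field_simps)
    ultimately have "(\<lambda>m. (f (x + (1 / real (Suc m)) *\<^sub>R v) - f x) / (1 / real (Suc m))) \<longlonglongrightarrow> fd f x v"
      by (rule filterlim_compose)
    then show ?thesis by (simp add: q_def mult.commute)
  qed
  have bound: "norm (q m x) \<le> \<bar>B\<bar> * indicator K' x" for m x
  proof (cases "x \<in> K'")
    case False
    have "1 / real (Suc m) \<in> {0..1}" by (simp add: field_simps)
    then have "f (x + (1 / real (Suc m)) *\<^sub>R v) = 0" using 0 inK' False by blast
    moreover have "f x = 0" using 0 inK'[OF False, of 0] by simp
    ultimately show ?thesis by (simp add: q_def)
  next
    case True
    have "\<exists>z>0. z < 1 / real (Suc m) \<and> f (x + (1 / real (Suc m)) *\<^sub>R v) - f (x + 0 *\<^sub>R v)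
        = (1 / real (Suc m) - 0) * fd f (x + z *\<^sub>R v) v"
      by (rule MVT2) (auto intro!: line)
    then obtain z where z: "f (x + (1 / real (Suc m)) *\<^sub>R v) - f x = (1 / real (Suc m)) * fd f (x + z *\<^sub>R v) v"
      by auto
    have "q m x = fd f (x + z *\<^sub>R v) v" unfolding q_def z by simp
    then show ?thesis using B' True by simp
  qed
  have dom: "integrable lborel (\<lambda>x. \<bar>B\<bar> * indicator K' x)"
    using borel_integrable_compact[OF K', of "\<lambda>x. 1 :: real"] by (intro integrable_mult_right) (simp del: integrable_mult_right_iff add: mult.commute)
  have mq: "q m \<in> borel_measurable lborel" for m
  proof -
    have "continuous_on UNIV (q m)"
      unfolding q_def by (intro continuous_intros continuous_on_compose2[OF contf]) auto
    then show ?thesis by (simp add: borel_measurable_continuous_onI)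
  qed
  have mD: "(\<lambda>x. fd f x v) \<in> borel_measurable lborel"
    using cont by (auto intro: borel_measurable_continuous_onI)
  show "integrable lborel (\<lambda>x. fd f x v)"
    by (rule integrable_dominated_convergence[OF mD, where s = q, OF mq dom]) (use lim bound in auto)
  have "(\<lambda>m. \<integral>x. q m x \<partial>lborel) \<longlonglongrightarrow> (\<integral>x. fd f x v \<partial>lborel)"
    by (rule integral_dominated_convergence[OF mD, where s = q, OF mq dom]) (use lim bound in auto)
  then show "(\<integral>x. fd f x v \<partial>lborel) = 0"
    unfolding q0 by (simp add: LIMSEQ_const_iff)
qed

lemma integral_partial_derivative:
  fixes f :: "'e::euclidean_space \<Rightarrow> real"
  assumes S: "open S" and f: "C1_on S f" and K: "compact K" "K \<subseteq> S" and 0: "\<And>x. x \<in> S - K \<Longrightarrow> f x = 0"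
  shows "set_integrable lborel S (\<lambda>x. fd f x v)" "(LINT x:S|lborel. fd f x v) = 0"
proof -
  define F where "F x = (if x \<in> S then f x else 0)" for x
  have oK: "open (- K)" using K by (simp add: compact_imp_closed open_Compl)
  have "C1_on S F" by (rule C1_on_cong[OF S f]) (simp add: F_def)
  moreover have "C1_on (- K) F"
    by (rule C1_on_cong[OF oK C1_on_const[of _ 0]]) (auto simp: F_def 0)
  moreover have "S \<union> - K = UNIV" using K(2) by auto
  ultimately have F: "C1_on UNIV F" using C1_on_Un[OF S oK, of F] by simp
  have F0: "F x = 0" if "x \<notin> K" for x using that 0 by (auto simp: F_def)
  have "indicat_real S x *\<^sub>R fd f x v = fd F x v" for x
  proof (cases "x \<in> S")
    case True
    then show ?thesis using fd_cong[OF S, of x f F] by (simp add: F_def)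
  next
    case False
    then have "fd F x = fd (\<lambda>x. 0) x" using K by (intro fd_cong[OF oK]) (auto simp: F0)
    then show ?thesis using False by (simp add: frechet_derivative_const)
  qed
  then show "set_integrable lborel S (\<lambda>x. fd f x v)" "(LINT x:S|lborel. fd f x v) = 0"
    using integral_partial_derivative_UNIV[OF F K(1) F0, of v]
    unfolding set_integrable_def set_lebesgue_integral_def by simp_all
qed

lemma integral_divergence:
  fixes Y :: "'e::euclidean_space \<Rightarrow> 'e"
  assumes S: "open S" and Y: "\<And>b. b \<in> Basis \<Longrightarrow> C1_on S (\<lambda>x. Y x \<bullet> b)"
    and K: "compact K" "K \<subseteq> S" and 0: "\<And>x. x \<in> S - K \<Longrightarrow> Y x = 0"
  shows "set_integrable lborel S (\<lambda>x. \<Sum>b\<in>Basis. fd (\<lambda>y. Y y \<bullet> b) x b)"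
    "(LINT x:S|lborel. \<Sum>b\<in>Basis. fd (\<lambda>y. Y y \<bullet> b) x b) = 0"
proof -
  have *: "set_integrable lborel S (\<lambda>x. fd (\<lambda>y. Y y \<bullet> b) x b)" "(LINT x:S|lborel. fd (\<lambda>y. Y y \<bullet> b) x b) = 0"
    if b: "b \<in> Basis" for b
    using integral_partial_derivative[OF S Y[OF b] K, of b] 0 by auto
  show "set_integrable lborel S (\<lambda>x. \<Sum>b\<in>Basis. fd (\<lambda>y. Y y \<bullet> b) x b)"
    using *(1) unfolding set_integrable_def scaleR_sum_right by (intro Bochner_Integration.integrable_sum)
  show "(LINT x:S|lborel. \<Sum>b\<in>Basis. fd (\<lambda>y. Y y \<bullet> b) x b) = 0"
    using * unfolding set_integrable_def set_lebesgue_integral_def scaleR_sum_right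
    by (subst Bochner_Integration.integral_sum) auto
qed

section \<open>The divergence of the normalised gradient\<close>

lemma smooth_on_real_deriv:
  fixes f :: "real \<Rightarrow> real"
  assumes "open S" "smooth_on S f"
  shows "x \<in> S \<Longrightarrow> (f has_real_derivative deriv f x) (at x)" "continuous_on S (deriv f)"
    "x \<in> S \<Longrightarrow> (deriv f has_real_derivative deriv (deriv f) x) (at x)" "continuous_on S (deriv (deriv f))"
proof -
  have main: "(h has_real_derivative deriv h x) (at x)" "deriv h x = fd h x 1"
    if "smooth_on S h" "x \<in> S" for h :: "real \<Rightarrow> real" and x
  proof -
    have D: "(h has_derivative fd h x) (at x)" and l: "linear (fd h x)"
      using smooth_on_has_derivative[OF assms(1) that] linear_fd by auto
    have "fd h x = (\<lambda>v. fd h x 1 * v)"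
    proof
      fix v show "fd h x v = fd h x 1 * v" using linear_scale[OF l, of v 1] by (simp add: mult.commute)
    qed
    with D have "(h has_derivative (\<lambda>v. fd h x 1 * v)) (at x)" by simp
    then have *: "(h has_real_derivative fd h x 1) (at x)"
      unfolding has_field_derivative_def .
    show "deriv h x = fd h x 1" by (rule DERIV_imp_deriv[OF *])
    then show "(h has_real_derivative deriv h x) (at x)" using * by simp
  qed
  have sm: "smooth_on S (\<lambda>x. fd f x 1)" using assms(2) by (rule smooth_on_fd)
  show "x \<in> S \<Longrightarrow> (f has_real_derivative deriv f x) (at x)" for x using main(1)[OF assms(2)] .
  show "continuous_on S (deriv f)"
    by (rule continuous_on_eq[OF smooth_on_continuous[OF sm]]) (simp add: main(2)[OF assms(2)])
  have D2: "(deriv f has_real_derivative deriv (\<lambda>x. fd f x 1) x) (at x)" if "x \<in> S" for x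
    by (rule has_field_derivative_transform_within_open[OF main(1)[OF sm that] assms(1) that])
       (simp add: main(2)[OF assms(2)])
  have D2': "deriv (deriv f) x = deriv (\<lambda>x. fd f x 1) x" if "x \<in> S" for x
    by (rule DERIV_imp_deriv[OF D2[OF that]])
  show "x \<in> S \<Longrightarrow> (deriv f has_real_derivative deriv (deriv f) x) (at x)" for x
    using D2 D2' by simp
  have "continuous_on S (deriv (\<lambda>x. fd f x 1))"
    by (rule continuous_on_eq[OF smooth_on_continuous[OF smooth_on_fd[OF sm, of 1]]]) (simp add: main(2)[OF sm])
  then show "continuous_on S (deriv (deriv f))"
    by (rule continuous_on_eq) (simp add: D2')
qed

text \<open>
  One coordinate chart of a graph \<open>r = U y\<close> in the warped product with fibre metric \<open>g\<close>.
\<close>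

locale graph_chart =
  fixes S :: "'e::euclidean_space set" and g :: "'e \<Rightarrow> 'e \<Rightarrow> 'e \<Rightarrow> real"
    and U :: "'e \<Rightarrow> real" and lam :: "real \<Rightarrow> real" and a :: real
  assumes S: "open S"
    and pd: "\<And>y. y \<in> S \<Longrightarrow> pd_form (g y)"
    and smooth_g: "\<And>v w. smooth_on S (\<lambda>y. g y v w)"
    and smooth_U: "smooth_on S U"
    and U_gt: "\<And>y. y \<in> S \<Longrightarrow> U y > a"
    and smooth_lam: "smooth_on {a<..} lam"
    and lam_pos: "\<And>r. r > a \<Longrightarrow> lam r > 0"
begin

text \<open>
  In the notation of the chart: \<open>G\<close> is the gradient of \<open>U\<close>, \<open>q\<close> its squared length, \<open>\<rho>\<close> the density of the
  Riemannian measure, \<open>U2\<close> the coordinate Hessian and \<open>Hess\<close> the covariant one; the Christoffel symbols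
  are expanded because only their product with \<open>G\<close> occurs. If \<open>\<nu>\<close> is the unit normal, then \<open>W = L / \<langle>\<nu>, \<partial>\<^sub>r\<rangle>\<close>,
  and the area element of the graph is \<open>L\<^sup>n\<^sup>-\<^sup>1 W \<rho>\<close>.
\<close>

abbreviation "L y \<equiv> lam (U y)"
abbreviation "L' y \<equiv> deriv lam (U y)"
abbreviation "d y \<equiv> fd U y"
definition "G y = sharp (g y) (d y)"
definition "q y = d y (G y)"
definition "W y = sqrt ((L y)\<^sup>2 + q y)"
definition "\<rho> y = sqrt (gram_det (g y))"
definition "U2 y v w = fd (\<lambda>z. fd U z w) y v"
definition "dg y v w z = fd (\<lambda>x. g x w z) y v"
definition "Hess y v w = U2 y v w - (dg y v w (G y) + dg y w v (G y) - dg y (G y) v w) / 2"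

lemmas lam_deriv = smooth_on_real_deriv[OF open_greaterThan smooth_lam, unfolded greaterThan_iff]

lemma L_pos: "y \<in> S \<Longrightarrow> L y > 0" using U_gt lam_pos by blast

lemma C1_U: "C1_on S U" by (rule smooth_on_C1[OF S smooth_U])
lemma C1_d: "C1_on S (\<lambda>y. d y v)" by (rule smooth_on_C1[OF S smooth_on_fd[OF smooth_U]])
lemma C1_g: "C1_on S (\<lambda>y. g y v w)" by (rule smooth_on_C1[OF S smooth_g])
lemma linear_d: "y \<in> S \<Longrightarrow> linear (d y)" by (rule C1_onD(4)[OF C1_U])

lemma fd_g: "y \<in> S \<Longrightarrow> ((\<lambda>y. g y v w) has_derivative (\<lambda>h. dg y h v w)) (at y)"
  unfolding dg_def by (rule C1_onD(1)[OF C1_g])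

lemma fd_d: "y \<in> S \<Longrightarrow> ((\<lambda>y. d y w) has_derivative (\<lambda>h. U2 y h w)) (at y)"
  unfolding U2_def by (rule C1_onD(1)[OF C1_d])

lemma g_bil: "y \<in> S \<Longrightarrow> bilinear (g y)" by (rule pd_formD(1)[OF pd])

text \<open>
  With this the linearity and symmetry of \<open>g\<close> and \<open>dU\<close> pass to their derivatives.
\<close>

lemma has_derivative_unique_on:
  assumes "y \<in> S" "(f has_derivative f') (at y)" "(h has_derivative h') (at y)" "\<And>x. x \<in> S \<Longrightarrow> f x = h x"
  shows "f' v = h' v"
  using fd_eq[OF assms(2)] fd_eq[OF assms(3)] fd_cong[OF S assms(1,4)] by simp

lemma dg_linear1: "y \<in> S \<Longrightarrow> linear (\<lambda>v. dg y v w z)"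
  unfolding dg_def by (rule C1_onD(4)[OF C1_g])

lemma dg_linear3: "y \<in> S \<Longrightarrow> linear (dg y v w)"
proof (rule linearI)
  fix z1 z2 r assume y: "y \<in> S"
  show "dg y v w (z1 + z2) = dg y v w z1 + dg y v w z2"
    by (rule has_derivative_unique_on[OF y fd_g[OF y] has_derivative_add[OF fd_g[OF y] fd_g[OF y]]])
       (simp add: bilinear_radd[OF g_bil])
  show "dg y v w (r *\<^sub>R z1) = r *\<^sub>R dg y v w z1"
    unfolding real_scaleR_def
    by (rule has_derivative_unique_on[OF y fd_g[OF y] has_derivative_mult_right[OF fd_g[OF y]]])
       (simp add: bilinear_rmul[OF g_bil])
qed

lemma dg_sym: "y \<in> S \<Longrightarrow> dg y v w z = dg y v z w"
  by (rule has_derivative_unique_on[OF _ fd_g fd_g]) (auto simp: pd_formD(2)[OF pd])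

lemma dg_linear2: "y \<in> S \<Longrightarrow> linear (\<lambda>w. dg y v w z)"
proof -
  assume y: "y \<in> S"
  have "(\<lambda>w. dg y v w z) = dg y v z" using dg_sym[OF y] by blast
  then show ?thesis using dg_linear3[OF y] by simp
qed

lemma U2_linear: "y \<in> S \<Longrightarrow> linear (\<lambda>v. U2 y v w)" "y \<in> S \<Longrightarrow> linear (U2 y v)"
proof -
  assume y: "y \<in> S"
  show "linear (\<lambda>v. U2 y v w)" unfolding U2_def by (rule C1_onD(4)[OF C1_d y])
  show "linear (U2 y v)"
  proof (rule linearI)
    fix z1 z2 r
    show "U2 y v (z1 + z2) = U2 y v z1 + U2 y v z2"
      by (rule has_derivative_unique_on[OF y fd_d[OF y] has_derivative_add[OF fd_d[OF y] fd_d[OF y]]])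
         (simp add: linear_add[OF linear_d])
    show "U2 y v (r *\<^sub>R z1) = r *\<^sub>R U2 y v z1"
      unfolding real_scaleR_def
      by (rule has_derivative_unique_on[OF y fd_d[OF y] has_derivative_mult_right[OF fd_d[OF y]]])
         (simp add: linear_scale[OF linear_d])
  qed
qed

lemma g_G: "y \<in> S \<Longrightarrow> g y (G y) z = d y z"
  unfolding G_def by (rule sharp_eq[OF pd linear_d])

lemma q_nonneg: "y \<in> S \<Longrightarrow> q y \<ge> 0"
  unfolding q_def using g_G[of y "G y"] pd_formD(4)[OF pd, of y "G y"] by simp

lemma W_pos: "y \<in> S \<Longrightarrow> W y > 0" and W_sq: "y \<in> S \<Longrightarrow> (W y)\<^sup>2 = (L y)\<^sup>2 + q y"
proof -
  assume y: "y \<in> S"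
  have "(L y)\<^sup>2 + q y > 0" using L_pos[OF y] q_nonneg[OF y] by (intro add_pos_nonneg) auto
  then show "W y > 0" "(W y)\<^sup>2 = (L y)\<^sup>2 + q y" by (simp_all add: W_def)
qed

lemma bilinear_U2: "y \<in> S \<Longrightarrow> bilinear (U2 y)" and bilinear_dg: "y \<in> S \<Longrightarrow> bilinear (dg y v)"
  and bilinear_dgG: "y \<in> S \<Longrightarrow> bilinear (\<lambda>v w. dg y v w z)"
  by (auto simp: bilinear_def U2_linear dg_linear1 dg_linear2 dg_linear3)

lemma bilinear_combination:
  assumes "bilinear b" "bilinear c"
  shows "bilinear (\<lambda>v w. s * b v w + t * c v w :: real)"
  unfolding bilinear_def
  by (auto intro!: linearI simp: bilinear_ladd[OF assms(1)] bilinear_ladd[OF assms(2)] bilinear_radd[OF assms(1)]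
      bilinear_radd[OF assms(2)] bilinear_lmul[OF assms(1)] bilinear_lmul[OF assms(2)]
      bilinear_rmul[OF assms(1)] bilinear_rmul[OF assms(2)] algebra_simps)

lemma bilinear_dgG': "y \<in> S \<Longrightarrow> bilinear (\<lambda>v w. dg y w v z)"
  by (auto simp: bilinear_def dg_linear1 dg_linear2)

lemma Hess_alt:
  "Hess y v w = 1 * U2 y v w + (-1/2) * (1 * (1 * dg y v w (G y) + 1 * dg y w v (G y)) + (-1) * dg y (G y) v w)"
  by (simp add: Hess_def)

lemma bilinear_Hess: "y \<in> S \<Longrightarrow> bilinear (Hess y)"
  unfolding Hess_alt[abs_def]
  by (intro bilinear_combination bilinear_U2 bilinear_dgG bilinear_dgG' bilinear_dg)

lemma metric_trace_combination:
  fixes b c :: "'e \<Rightarrow> 'e \<Rightarrow> real"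
  assumes g: "pd_form h" and b: "bilinear b" and c: "bilinear c"
  shows "metric_trace h (\<lambda>v w. s * b v w + t * c v w) = s * metric_trace h b + t * metric_trace h c"
proof -
  have "bilinear (\<lambda>v w. s * b v w)" if "bilinear b" for s and b :: "'e \<Rightarrow> 'e \<Rightarrow> real"
    using bilinear_combination[OF that that, of s 0] by simp
  from metric_trace_add[OF g this[OF b] this[OF c]] show ?thesis
    by (simp only: metric_trace_scale[OF g b] metric_trace_scale[OF g c])
qed

text \<open>
  The first summand will be the coordinate divergence of \<open>G\<close>, the second the logarithmic derivative of
  \<open>\<rho>\<close> along \<open>G\<close>: together they form the Laplacian.
\<close>

lemma trace_Hess:
  assumes y: "y \<in> S"
  shows "metric_trace (g y) (Hess y)
    = metric_trace (g y) (\<lambda>w z. U2 y w z - dg y w (G y) z) + metric_trace (g y) (dg y (G y)) / 2"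
proof -
  note b = bilinear_combination bilinear_U2[OF y] bilinear_dgG[OF y] bilinear_dgG'[OF y] bilinear_dg[OF y]
  have 1: "(\<lambda>w z. U2 y w z - dg y w (G y) z) = (\<lambda>w z. 1 * U2 y w z + (-1) * dg y w z (G y))"
    by (auto simp: fun_eq_iff dg_sym[OF y])
  have 2: "metric_trace (g y) (\<lambda>w v. dg y v w (G y)) = metric_trace (g y) (\<lambda>w v. dg y w v (G y))"
    by (rule metric_trace_transpose[OF pd[OF y] bilinear_dgG[OF y], of "G y"])
  show ?thesis
    unfolding 1 Hess_alt[abs_def]
    by (subst metric_trace_combination[OF pd[OF y]], (intro b)+)+ (simp add: 2 field_simps)
qed

lemma C1_G: "b \<in> Basis \<Longrightarrow> C1_on S (\<lambda>y. G y \<bullet> b)"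
  unfolding G_def by (rule C1_on_sharp[OF S pd linear_d C1_g C1_d])

lemma C1_L: "C1_on S L"
proof (rule C1_on_compose_real[OF C1_U])
  show "(lam has_real_derivative deriv lam (U x)) (at (U x))" if "x \<in> S" for x
    using lam_deriv(1) U_gt that by blast
  show "continuous_on (U ` S) (deriv lam)"
    using U_gt by (intro continuous_on_subset[OF lam_deriv(2)]) auto
qed

lemma C1_q: "C1_on S q"
  unfolding q_def[abs_def] by (rule C1_on_linear_apply[OF S C1_d linear_d C1_G])

lemma C1_W: "C1_on S W"
  unfolding W_def[abs_def] using W_pos W_sq
  by (intro C1_on_sqrt C1_on_add C1_on_power C1_L C1_q) (metis zero_less_power)

lemma C1_rho: "C1_on S \<rho>"
  unfolding \<rho>_def[abs_def] using gram_det_pos[OF pd] by (intro C1_on_sqrt C1_on_gram_det C1_g)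

lemma rho_pos: "y \<in> S \<Longrightarrow> \<rho> y > 0" unfolding \<rho>_def using gram_det_pos[OF pd] by simp

definition "DG y w = (\<Sum>b\<in>Basis. fd (\<lambda>y. G y \<bullet> b) y w *\<^sub>R b)"

lemma DG_inner: "b \<in> Basis \<Longrightarrow> DG y w \<bullet> b = fd (\<lambda>y. G y \<bullet> b) y w"
  by (simp add: DG_def)

text \<open>
  Obtained by differentiating \<open>g (G, z) = dU z\<close>.
\<close>

lemma g_DG:
  assumes y: "y \<in> S"
  shows "g y (DG y w) z = U2 y w z - dg y w (G y) z"
proof -
  have "((\<lambda>y. \<Sum>b\<in>Basis. (G y \<bullet> b) * g y b z) has_derivative
     (\<lambda>w. \<Sum>b\<in>Basis. (G y \<bullet> b) * dg y w b z + fd (\<lambda>y. G y \<bullet> b) y w * g y b z)) (at y)"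
    by (intro has_derivative_sum has_derivative_mult fd_g[OF y] C1_onD(1)[OF C1_G _] y)
  moreover have "(\<Sum>b\<in>Basis. (G x \<bullet> b) * g x b z) = d x z" if "x \<in> S" for x
    using g_G[OF that] linear_functional_sum[OF pd_formD(6)[OF pd[OF that]], of "G x" z] by simp
  ultimately have "(\<Sum>b\<in>Basis. (G y \<bullet> b) * dg y w b z + fd (\<lambda>y. G y \<bullet> b) y w * g y b z) = U2 y w z"
    by (rule has_derivative_unique_on[OF y _ fd_d[OF y]])
  moreover have "(\<Sum>b\<in>Basis. (G y \<bullet> b) * dg y w b z) = dg y w (G y) z"
    by (rule linear_functional_sum[OF dg_linear2[OF y], symmetric])
  moreover have "(\<Sum>b\<in>Basis. fd (\<lambda>y. G y \<bullet> b) y w * g y b z) = g y (DG y w) z"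
    by (subst linear_functional_sum[OF pd_formD(6)[OF pd[OF y]], of "DG y w"]) (simp add: DG_inner)
  ultimately show ?thesis by (simp add: sum.distrib)
qed

text \<open>
  Here \<open>q = dU G\<close> is differentiated; the coordinate derivatives of \<open>G\<close> are eliminated with \<open>g_DG\<close>.
\<close>

lemma fd_q:
  assumes y: "y \<in> S"
  shows "fd q y (G y) = 2 * Hess y (G y) (G y)"
proof -
  have "((\<lambda>y. \<Sum>b\<in>Basis. (G y \<bullet> b) * d y b) has_derivative
     (\<lambda>w. \<Sum>b\<in>Basis. (G y \<bullet> b) * U2 y w b + fd (\<lambda>y. G y \<bullet> b) y w * d y b)) (at y)"
    by (intro has_derivative_sum has_derivative_mult fd_d[OF y] C1_onD(1)[OF C1_G _] y)
  moreover have "(\<Sum>b\<in>Basis. (G x \<bullet> b) * d x b) = q x" if "x \<in> S" for x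
    unfolding q_def by (rule linear_functional_sum[OF linear_d[OF that], symmetric])
  ultimately have "(\<Sum>b\<in>Basis. (G y \<bullet> b) * U2 y w b + fd (\<lambda>y. G y \<bullet> b) y w * d y b) = fd q y w" for w
    by (rule has_derivative_unique_on[OF y _ C1_onD(1)[OF C1_q y]])
  moreover have "(\<Sum>b\<in>Basis. (G y \<bullet> b) * U2 y w b) = U2 y w (G y)" for w
    by (rule linear_functional_sum[OF U2_linear(2)[OF y], symmetric])
  moreover have "(\<Sum>b\<in>Basis. fd (\<lambda>y. G y \<bullet> b) y w * d y b) = d y (DG y w)" for w
    by (subst linear_functional_sum[OF linear_d[OF y], of "DG y w"]) (simp add: DG_inner)
  moreover have "d y (DG y w) = U2 y w (G y) - dg y w (G y) (G y)" for w
    using g_DG[OF y, of w "G y"] g_G[OF y, of "DG y w"] pd_formD(2)[OF pd[OF y], of "G y"] by simp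
  ultimately have "fd q y w = 2 * U2 y w (G y) - dg y w (G y) (G y)" for w
    by (simp add: sum.distrib)
  then show ?thesis by (simp add: Hess_def)
qed

lemma fd_rho:
  assumes y: "y \<in> S"
  shows "fd \<rho> y w = \<rho> y * metric_trace (g y) (dg y w) / 2"
proof -
  have "((\<lambda>y. gram_det (g y)) has_derivative (\<lambda>w. gram_det (g y) * metric_trace (g y) (dg y w))) (at y)"
    by (rule has_derivative_gram_det[where g = g and x = y and g' = "dg y"]) (use pd[OF y] fd_g[OF y] dg_linear3[OF y] in auto)
  then have "(\<rho> has_derivative (\<lambda>w. (gram_det (g y) * metric_trace (g y) (dg y w)) * inverse (\<rho> y) / 2)) (at y)"
    unfolding \<rho>_def[abs_def] using gram_det_pos[OF pd[OF y]]
    by (auto intro!: derivative_eq_intros simp: field_simps)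
  from fd_eq[OF this] have "fd \<rho> y w = (gram_det (g y) * metric_trace (g y) (dg y w)) * inverse (\<rho> y) / 2" by simp
  also have "gram_det (g y) = \<rho> y * \<rho> y" using gram_det_pos[OF pd[OF y]] by (simp add: \<rho>_def)
  finally show ?thesis using rho_pos[OF y] by (simp add: field_simps)
qed

lemma fd_W:
  assumes y: "y \<in> S"
  shows "fd W y (G y) = (L y * L' y * q y + Hess y (G y) (G y)) / W y"
proof -
  have DL: "(L has_derivative (\<lambda>w. L' y * d y w)) (at y)"
    using has_derivative_compose[OF C1_onD(1)[OF C1_U y] lam_deriv(1)[OF U_gt[OF y], unfolded has_field_derivative_def]]
    by simp
  have "(W has_derivative (\<lambda>w. (2 * L y * (L' y * d y w) + fd q y w) * (inverse (W y) / 2))) (at y)"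
    unfolding W_def[abs_def] using W_pos[OF y] W_sq[OF y]
    by (auto intro!: derivative_eq_intros DL C1_onD(1)[OF C1_q y] simp: W_def)
  from fd_eq[OF this] show ?thesis
    using W_pos[OF y] by (simp add: fd_q[OF y] q_def[symmetric] field_simps)
qed

text \<open>
  The right-hand side is \<open>\<rho>\<close> times the Riemannian divergence of \<open>\<eta> G / W\<close>. The test function \<open>\<eta>\<close> is
  included to make the field compactly supported in the chart.
\<close>

lemma divergence_formula:
  assumes y: "y \<in> S" and eta: "C1_on S \<eta>"
  shows "(\<Sum>b\<in>Basis. fd (\<lambda>y. (\<rho> y * \<eta> y / W y) *\<^sub>R G y \<bullet> b) y b)
    = \<rho> y / W y * fd \<eta> y (G y)
      + \<rho> y * \<eta> y / W y * (metric_trace (g y) (Hess y) - (L y * L' y * q y + Hess y (G y) (G y)) / (W y)\<^sup>2)"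
proof -
  define \<psi> where "\<psi> y = \<rho> y * \<eta> y / W y" for y
  have W0: "W y \<noteq> 0" using W_pos[OF y] by simp
  have psi: "(\<psi> has_derivative (\<lambda>w. ((\<rho> y * fd \<eta> y w + fd \<rho> y w * \<eta> y) * W y - \<rho> y * \<eta> y * fd W y w) / (W y * W y))) (at y)"
    unfolding \<psi>_def[abs_def]
    by (intro has_derivative_divide' has_derivative_mult C1_onD(1)[OF eta y] C1_onD(1)[OF C1_rho y] C1_onD(1)[OF C1_W y] W0)
  then have lin: "linear (fd \<psi> y)" using fd_eq[OF psi] has_derivative_linear by metis
  have "fd (\<lambda>y. (\<rho> y * \<eta> y / W y) *\<^sub>R G y \<bullet> b) y b = \<psi> y * (DG y b \<bullet> b) + (G y \<bullet> b) * fd \<psi> y b" if b: "b \<in> Basis" for b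
  proof -
    have "((\<lambda>y. (\<rho> y * \<eta> y / W y) *\<^sub>R G y \<bullet> b) has_derivative (\<lambda>w. \<psi> y * fd (\<lambda>y. G y \<bullet> b) y w + fd \<psi> y w * (G y \<bullet> b))) (at y)"
      unfolding inner_scaleR_left \<psi>_def[symmetric]
      by (intro has_derivative_mult C1_onD(1)[OF C1_G[OF b] y]) (use psi fd_eq[OF psi] in simp)
    from fd_eq[OF this] show ?thesis by (simp add: DG_inner b)
  qed
  then have "(\<Sum>b\<in>Basis. fd (\<lambda>y. (\<rho> y * \<eta> y / W y) *\<^sub>R G y \<bullet> b) y b) = \<psi> y * (\<Sum>b\<in>Basis. DG y b \<bullet> b) + fd \<psi> y (G y)"
    by (simp add: sum.distrib sum_distrib_left linear_functional_sum[OF lin, of "G y"])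
  also have "(\<Sum>b\<in>Basis. DG y b \<bullet> b) = metric_trace (g y) (\<lambda>w z. U2 y w z - dg y w (G y) z)"
  proof -
    have "DG y b = sharp (g y) (\<lambda>z. U2 y b z - dg y b (G y) z)" for b
      using sharp_unique[OF pd[OF y], of "DG y b"] g_DG[OF y] by auto
    then show ?thesis by (simp add: metric_trace_def)
  qed
  also have "\<dots> = metric_trace (g y) (Hess y) - metric_trace (g y) (dg y (G y)) / 2"
    by (simp add: trace_Hess[OF y])
  also have "fd \<psi> y (G y) = \<rho> y / W y * fd \<eta> y (G y) + \<psi> y * metric_trace (g y) (dg y (G y)) / 2
     - \<psi> y * ((L y * L' y * q y + Hess y (G y) (G y)) / (W y)\<^sup>2)"
    unfolding fd_eq[OF psi] fd_rho[OF y] fd_W[OF y] \<psi>_def using W0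
    by (simp add: field_simps power2_eq_square)
  finally show ?thesis
    unfolding \<psi>_def[symmetric] by (simp only: right_diff_distrib)
qed

end

section \<open>The mean curvature of a graph\<close>

lemma met_warped: "met (warped_product a lam N) i z Z Y
   = fst Z * fst Y + (lam (fst z))\<^sup>2 * met N i (snd z) (snd Z) (snd Y)"
  by (simp add: warped_product_def split: prod.splits)

lemma warped_simps [simp]:
  "idx (warped_product a lam N) = idx N" "cdom (warped_product a lam N) i = {a..} \<times> cdom N i"
  "chart (warped_product a lam N) i (r, x) = (r, chart N i x)"
  by (simp_all add: warped_product_def)

lemma pd_form_warped:
  fixes N :: "('i, 'm, 'e::euclidean_space) riem"
  assumes g: "pd_form (met N i y)" and "lam r \<noteq> 0"
  shows "pd_form (met (warped_product a lam N) i (r, y))"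
proof -
  note b = pd_formD(1)[OF g]
  show ?thesis
    unfolding pd_form_def
  proof (intro conjI allI impI)
    show "bilinear (met (warped_product a lam N) i (r, y))"
      unfolding bilinear_def
      by (auto intro!: linearI simp: met_warped bilinear_ladd[OF b] bilinear_radd[OF b]
          bilinear_lmul[OF b] bilinear_rmul[OF b] algebra_simps)
    show "met (warped_product a lam N) i (r, y) v w = met (warped_product a lam N) i (r, y) w v" for v w
      by (simp add: met_warped pd_formD(2)[OF g, of "snd v"])
    show "met (warped_product a lam N) i (r, y) v v > 0" if "v \<noteq> 0" for v
    proof (cases "snd v = 0")
      case True
      then have "fst v \<noteq> 0" using that by (simp add: prod_eq_iff)
      then have "fst v * fst v > 0" by (simp add: power2_eq_square[symmetric])
      then show ?thesis using True by (simp add: met_warped bilinear_lzero[OF b])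
    next
      case False
      then show ?thesis using pd_formD(3)[OF g False] assms(2)
        by (simp add: met_warped add_nonneg_pos)
    qed
  qed
qed

locale warped_graph_chart =
  fixes N :: "('i, 'm, 'e::euclidean_space) riem" and i :: 'i and u :: "'m \<Rightarrow> real"
    and U :: "'e \<Rightarrow> real" and lam :: "real \<Rightarrow> real" and a :: real
  assumes graph_chart: "graph_chart (cimg N i) (met N i) U lam a"
    and U_eq: "\<And>y. U y = u (cinv N i y)"
begin

sublocale graph_chart "cimg N i" "met N i" U lam a
  by (rule graph_chart)

abbreviation "M \<equiv> warped_product a lam N"

lemma local_rep_graph: "y \<in> cimg N i \<Longrightarrow> local_rep N M (graph_map u) i y = (U y, y)"
  by (simp add: U_eq local_rep_def graph_map_def cinv_def cimg_def f_inv_into_f)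

lemma fd_local_rep:
  assumes y: "y \<in> cimg N i"
  shows "fd (local_rep N M (graph_map u) i) y = (\<lambda>v. (d y v, v))"
proof -
  have "fd (local_rep N M (graph_map u) i) y = fd (\<lambda>y. (U y, y)) y"
    by (rule fd_cong[OF S y]) (rule local_rep_graph)
  also have "\<dots> = (\<lambda>v. (d y v, v))"
    by (rule fd_eq) (intro has_derivative_Pair C1_onD(1)[OF C1_U y] has_derivative_ident)
  finally show ?thesis .
qed

lemma fd2_local_rep:
  assumes y: "y \<in> cimg N i"
  shows "fd (\<lambda>z. fd (local_rep N M (graph_map u) i) z w) y v = (U2 y v w, 0)"
proof -
  have "fd (\<lambda>z. fd (local_rep N M (graph_map u) i) z w) y = fd (\<lambda>z. (d z w, w)) y"
    by (rule fd_cong[OF S y]) (simp add: fd_local_rep)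
  also have "\<dots> = (\<lambda>v. (U2 y v w, 0))"
    by (rule fd_eq) (intro has_derivative_Pair fd_d y has_derivative_const)
  finally show ?thesis by simp
qed

lemma met_induced_graph:
  assumes y: "y \<in> cimg N i"
  shows "met (induced N M (graph_map u)) i y = (\<lambda>v w. (L y)\<^sup>2 * met N i y v w + 1 * (d y v * d y w))"
  by (simp add: induced_def Let_def fd_local_rep[OF y] local_rep_graph[OF y] met_warped fun_eq_iff)

lemma has_derivative_met_warped:
  assumes y: "y \<in> cimg N i" and r: "r > a"
  shows "((\<lambda>z. met M i z Y Z) has_derivative (\<lambda>X. 2 * lam r * (deriv lam r * fst X) * met N i y (snd Y) (snd Z)
      + (lam r)\<^sup>2 * dg y (snd X) (snd Y) (snd Z))) (at (r, y))"
proof -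
  have 1: "((\<lambda>z. lam (fst z)) has_derivative (\<lambda>X. deriv lam r * fst X)) (at (r, y))"
    using has_derivative_compose[OF has_derivative_fst[OF has_derivative_ident], of lam _ "(r, y)" UNIV]
      lam_deriv(1)[OF r, unfolded has_field_derivative_def] by simp
  have 2: "((\<lambda>z. met N i (snd z) (snd Y) (snd Z)) has_derivative (\<lambda>X. dg y (snd X) (snd Y) (snd Z))) (at (r, y))"
    using has_derivative_compose[OF has_derivative_snd[OF has_derivative_ident],
        of "\<lambda>y. met N i y (snd Y) (snd Z)" _ "(r, y)" UNIV]
        fd_g[OF y, of "snd Y" "snd Z"] by simp
  show ?thesis
    unfolding met_warped
    by (rule has_derivative_eq_rhs, (rule derivative_intros 1 2)+) (auto simp: fun_eq_iff)
qed

text \<open>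
  The Koszul formula in the warped product. Only the product of the Christoffel symbol with the unit
  normal enters the second fundamental form, so the symbol itself is never solved for.
\<close>

lemma met_christoffel_warped:
  assumes y: "y \<in> cimg N i" and r: "r > a"
  shows "met M i (r, y) (christoffel (met M i) (r, y) X Y) Z =
     lam r * deriv lam r * (fst X * met N i y (snd Y) (snd Z) + fst Y * met N i y (snd X) (snd Z) - fst Z * met N i y (snd X) (snd Y))
     + (lam r)\<^sup>2 * (dg y (snd X) (snd Y) (snd Z) + dg y (snd Y) (snd X) (snd Z) - dg y (snd Z) (snd X) (snd Y)) / 2"
proof -
  define l where "l Z =
     lam r * deriv lam r * (fst X * met N i y (snd Y) (snd Z) + fst Y * met N i y (snd X) (snd Z) - fst Z * met N i y (snd X) (snd Y))
     + (lam r)\<^sup>2 * (dg y (snd X) (snd Y) (snd Z) + dg y (snd Y) (snd X) (snd Z) - dg y (snd Z) (snd X) (snd Y)) / 2" for Z :: "real \<times> 'e"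
  have "(\<lambda>Z. (fd (\<lambda>z. met M i z Y Z) (r, y) X + fd (\<lambda>z. met M i z X Z) (r, y) Y
      - fd (\<lambda>z. met M i z X Y) (r, y) Z) / 2) = l"
    unfolding fd_eq[OF has_derivative_met_warped[OF y r]] l_def
    by (simp add: fun_eq_iff field_simps)
  then have "christoffel (met M i) (r, y) X Y = sharp (met M i (r, y)) l"
    by (simp add: christoffel_def)
  moreover have "linear l"
    by (rule linearI) (simp_all add: l_def bilinear_radd[OF g_bil[OF y]] bilinear_rmul[OF g_bil[OF y]]
       linear_add[OF dg_linear3[OF y]] linear_scale[OF dg_linear3[OF y]]
       linear_add[OF dg_linear1[OF y]] linear_scale[OF dg_linear1[OF y]] field_simps)
  moreover have "pd_form (met M i (r, y))"
    using pd_form_warped[OF pd[OF y]] lam_pos[OF r] by (simp add: less_imp_neq[symmetric])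
  ultimately show ?thesis using sharp_eq[of "met M i (r, y)" l Z] by (simp add: l_def)
qed

lemma unit_normal_graph:
  assumes y: "y \<in> cimg N i"
  shows "unit_normal N M (graph_map u) (1, 0) i y = (L y / W y, - (1 / (L y * W y)) *\<^sub>R G y)"
proof -
  note L = L_pos[OF y] and W = W_pos[OF y] and Wsq = W_sq[OF y] and b = g_bil[OF y]
  let ?\<nu> = "(L y / W y, - (1 / (L y * W y)) *\<^sub>R G y)"
  have qG: "met N i y (G y) (G y) = q y" using g_G[OF y] by (simp add: q_def)
  show ?thesis
    unfolding unit_normal_def Let_def fd_local_rep[OF y] local_rep_graph[OF y] met_warped fst_conv snd_conv
  proof (intro the_equality conjI allI)
    show "fst ?\<nu> * d y v + (L y)\<^sup>2 * met N i y (snd ?\<nu>) v = 0" for v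
      using L W by (simp add: bilinear_lneg[OF b] bilinear_lmul[OF b] g_G[OF y] field_simps power2_eq_square)
    have "fst ?\<nu> * fst ?\<nu> + (L y)\<^sup>2 * met N i y (snd ?\<nu>) (snd ?\<nu>) = ((L y)\<^sup>2 + q y) / (W y)\<^sup>2"
      using L W by (simp add: bilinear_lneg[OF b] bilinear_lmul[OF b] bilinear_rneg[OF b] bilinear_rmul[OF b]
         qG field_simps power2_eq_square)
    then show "fst ?\<nu> * fst ?\<nu> + (L y)\<^sup>2 * met N i y (snd ?\<nu>) (snd ?\<nu>) = 1"
      unfolding Wsq[symmetric] using W by simp
    show "0 < fst ?\<nu> * 1 + (L y)\<^sup>2 * met N i y (snd ?\<nu>) 0"
      using L W by (simp add: bilinear_rzero[OF b])
    fix n assume n: "(\<forall>v. fst n * d y v + (L y)\<^sup>2 * met N i y (snd n) v = 0) \<and>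
      fst n * fst n + (L y)\<^sup>2 * met N i y (snd n) (snd n) = 1 \<and> 0 < fst n * 1 + (L y)\<^sup>2 * met N i y (snd n) 0"
    then have pos: "fst n > 0" by (simp add: bilinear_rzero[OF b])
    have "met N i y (snd n) v = met N i y ((- fst n / (L y)\<^sup>2) *\<^sub>R G y) v" for v
      using spec[OF conjunct1[OF n], of v] L by (simp add: bilinear_lneg[OF b] bilinear_lmul[OF b] g_G[OF y] field_simps)
    then have sn: "snd n = (- fst n / (L y)\<^sup>2) *\<^sub>R G y" by (rule pd_form_unique[OF pd[OF y]])
    have "1 = fst n * fst n + (L y)\<^sup>2 * met N i y (snd n) (snd n)" using n by simp
    also have "\<dots> = (fst n * W y / L y)\<^sup>2"
      unfolding sn power_mult_distrib power_divide Wsq using L by (simp add: bilinear_lneg[OF b] bilinear_rneg[OF b] bilinear_lmul[OF b] bilinear_rmul[OF b] qG)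
         (simp add: field_simps power2_eq_square power4_eq_xxxx)
    finally have "(fst n * W y / L y)\<^sup>2 = 1\<^sup>2" by simp
    then have "fst n * W y / L y = 1"
      using pos W L by (intro power2_eq_imp_eq[of _ 1]) auto
    then have f: "fst n = L y / W y" using W L by (simp add: field_simps)
    show "n = ?\<nu>" using sn f W L by (auto simp: prod_eq_iff power2_eq_square)
  qed
qed

lemma second_fundamental_form_graph:
  assumes y: "y \<in> cimg N i"
  shows "second_fundamental_form N M (graph_map u) (1, 0) i y v w
    = (L y / W y) * (L y * L' y * met N i y v w + 2 * (L' y / L y) * (d y v * d y w) - Hess y v w)"
proof -
  note L = L_pos[OF y] and W = W_pos[OF y] and b = g_bil[OF y]
  have r: "U y > a" by (rule U_gt[OF y])
  have bM: "bilinear (met M i (U y, y))"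
    using pd_formD(1)[OF pd_form_warped[OF pd[OF y]]] L by force
  have gG: "met N i y z (G y) = d y z" for z using g_G[OF y, of z] pd_formD(2)[OF pd[OF y]] by simp
  have 1: "met M i (U y, y) (U2 y v w, 0) Z = U2 y v w * fst Z" for Z
    by (simp add: met_warped bilinear_lzero[OF b])
  have dgs: "dg y p z (r *\<^sub>R x) = r * dg y p z x" "dg y (r *\<^sub>R x) p z = r * dg y x p z" for p z r x
    using linear_scale[OF dg_linear3[OF y]] linear_scale[OF dg_linear1[OF y]] by auto
  show ?thesis
    unfolding second_fundamental_form_def Let_def unit_normal_graph[OF y] fd_local_rep[OF y]
      local_rep_graph[OF y] fd2_local_rep[OF y] bilinear_ladd[OF bM] 1 met_christoffel_warped[OF y r] fst_conv snd_conv
      dgs bilinear_rmul[OF b] gG Hess_def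
    using L W by (simp add: field_simps power2_eq_square)
qed

text \<open>
  Comparison with \<open>divergence_formula\<close> shows that \<open>\<lambda> H = n \<lambda> \<lambda>' / W - div (G / W)\<close>, where \<open>H\<close> is the mean
  curvature and \<open>div\<close> the divergence on the fibre. All second derivatives of \<open>U\<close> sit in the divergence.
\<close>

lemma mean_curvature_graph:
  assumes y: "y \<in> cimg N i"
  shows "L y * mean_curvature N M (graph_map u) (1, 0) i y
    = (real DIM('e) * L y * L' y - metric_trace (met N i y) (Hess y)
       + (L y * L' y * q y + Hess y (G y) (G y)) / (W y)\<^sup>2) / W y"
proof -
  note L = L_pos[OF y] and W = W_pos[OF y] and Wsq = W_sq[OF y] and b = g_bil[OF y]
  let ?h = "\<lambda>v w. L y * L' y * met N i y v w + 2 * (L' y / L y) * (d y v * d y w)"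
  let ?b = "\<lambda>v w. (L y / W y) * ?h v w + (- (L y / W y)) * Hess y v w"
  have bdd: "bilinear (\<lambda>v w. d y v * d y w)"
    using linear_add[OF linear_d[OF y]] linear_scale[OF linear_d[OF y]]
    by (auto simp: bilinear_def algebra_simps intro!: linearI)
  have bh: "bilinear ?h" by (rule bilinear_combination[OF b bdd])
  have bb: "bilinear ?b" by (rule bilinear_combination[OF bh bilinear_Hess[OF y]])
  have qG: "met N i y (G y) (G y) = q y" "d y (G y) = q y" using g_G[OF y] by (simp_all add: q_def)
  have tr: "metric_trace (met N i y) ?b
     = (L y / W y) * (L y * L' y * DIM('e) + 2 * (L' y / L y) * q y - metric_trace (met N i y) (Hess y))"
    unfolding metric_trace_combination[OF pd[OF y] bh bilinear_Hess[OF y]] metric_trace_combination[OF pd[OF y] b bdd]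
      metric_trace_tensor[OF pd[OF y] linear_d[OF y] linear_d[OF y]] metric_trace_self[OF pd[OF y]]
      G_def[symmetric] qG by (simp add: algebra_simps)
  have "second_fundamental_form N M (graph_map u) (1, 0) i y = ?b"
    by (simp add: fun_eq_iff second_fundamental_form_graph[OF y] algebra_simps)
  then have "mean_curvature N M (graph_map u) (1, 0) i y
     = metric_trace (\<lambda>v w. (L y)\<^sup>2 * met N i y v w + 1 * (d y v * d y w)) ?b"
    unfolding mean_curvature_def met_induced_graph[OF y] by simp
  also have "\<dots> = (metric_trace (met N i y) ?b - 1 * ?b (G y) (G y) / ((L y)\<^sup>2 + 1 * q y)) / (L y)\<^sup>2"
    using rank_one_update(3)[OF pd[OF y] linear_d[OF y] _ _ bb, of "(L y)\<^sup>2" 1] L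
    by (simp only: G_def[symmetric] qG zero_le_one) simp
  finally have mc: "mean_curvature N M (graph_map u) (1, 0) i y
    = (L y / W y * (L y * L' y * real DIM('e) + 2 * (L' y / L y) * q y - metric_trace (met N i y) (Hess y))
      - ?b (G y) (G y) / (W y)\<^sup>2) / (L y)\<^sup>2"
    unfolding tr by (simp only: mult_1 Wsq)
  have "L y * mean_curvature N M (graph_map u) (1, 0) i y
    = (1 / W y) * (L y * L' y * DIM('e) + 2 * (L' y / L y) * q y - metric_trace (met N i y) (Hess y)
      - (L y * L' y * q y + 2 * (L' y / L y) * (q y * q y) - Hess y (G y) (G y)) / (W y)\<^sup>2)"
    unfolding mc qG using L W
    by (simp add: field_simps power2_eq_square)
  \<comment> \<open>the terms quadratic in \<open>q\<close> cancel after expanding \<open>W\<^sup>2 = L\<^sup>2 + q\<close>\<close>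
  also have "2 * (L' y / L y) * q y = 2 * (L' y / L y) * q y * (W y)\<^sup>2 / (W y)\<^sup>2" using W by simp
  also have "2 * (L' y / L y) * q y * (W y)\<^sup>2 = 2 * L y * L' y * q y + 2 * (L' y / L y) * (q y * q y)"
    unfolding Wsq using L by (simp add: field_simps power2_eq_square)
  finally show ?thesis
    by (simp add: diff_divide_distrib add_divide_distrib algebra_simps)
qed

end

section \<open>Change of variables in Euclidean spaces\<close>

definition to_vec :: "'e::euclidean_space \<Rightarrow> real^'e basis_index" where
  "to_vec x = (\<chi> i. x \<bullet> basis_vec i)"

definition of_vec :: "real^'e basis_index \<Rightarrow> 'e::euclidean_space" where
  "of_vec v = (\<Sum>i\<in>UNIV. v $ i *\<^sub>R basis_vec i)"

lemma of_vec_inner: "of_vec v \<bullet> basis_vec i = v $ i"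
  by (simp add: of_vec_def inner_sum_left if_distrib cong: if_cong)

lemma to_vec_of_vec [simp]: "to_vec (of_vec v) = v"
  by (simp add: to_vec_def vec_eq_iff of_vec_inner)

lemma of_vec_to_vec [simp]: "of_vec (to_vec x) = x"
proof (rule euclidean_eqI)
  fix b :: 'a assume "b \<in> Basis"
  then obtain k where "b = basis_vec k" using range_basis_vec by blast
  then show "of_vec (to_vec x) \<bullet> b = x \<bullet> b" by (simp add: of_vec_inner) (simp add: to_vec_def)
qed

lemma linear_to_vec: "linear to_vec"
  by (rule linearI) (auto simp: to_vec_def vec_eq_iff inner_add_left)

lemma linear_of_vec: "linear of_vec"
  by (rule linearI) (auto simp: of_vec_def scaleR_add_left sum.distrib scaleR_sum_right)

lemma bounded_linear_to_vec: "bounded_linear (to_vec :: 'e::euclidean_space \<Rightarrow> _)"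
  using linear_to_vec linear_conv_bounded_linear by blast

lemma bounded_linear_of_vec: "bounded_linear (of_vec :: _ \<Rightarrow> 'e::euclidean_space)"
  using linear_of_vec linear_conv_bounded_linear by blast

lemma of_vec_measurable [measurable]: "(of_vec :: _ \<Rightarrow> 'e::euclidean_space) \<in> borel_measurable borel"
  by (intro borel_measurable_continuous_onI linear_continuous_on bounded_linear_of_vec)

lemma distr_of_vec: "distr lborel borel of_vec = (lborel :: 'e::euclidean_space measure)"
proof (rule lborel_eqI[symmetric])
  fix l r :: 'e assume le: "\<And>b. b \<in> Basis \<Longrightarrow> l \<bullet> b \<le> r \<bullet> b"
  have vim: "of_vec -` box l r \<inter> space lborel = box (to_vec l) (to_vec r)"
  proof -
    have "x \<in> box (to_vec l) (to_vec r) \<longleftrightarrow> (\<forall>i. l \<bullet> basis_vec i < x $ i \<and> x $ i < r \<bullet> basis_vec i)" for x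
      by (simp add: mem_box_cart to_vec_def)
    moreover have "of_vec x \<in> box l r \<longleftrightarrow> (\<forall>i. l \<bullet> basis_vec i < x $ i \<and> x $ i < r \<bullet> basis_vec i)" for x
      unfolding mem_box range_basis_vec[symmetric] by (simp add: of_vec_inner)
    ultimately show ?thesis by auto
  qed
  have "emeasure (distr lborel borel of_vec) (box l r) = emeasure lborel (box (to_vec l) (to_vec r))"
    by (subst emeasure_distr) (simp_all add: vim[simplified])
  also have "\<dots> = (\<Prod>b\<in>Basis. (to_vec r - to_vec l) \<bullet> b)"
  proof (rule emeasure_lborel_box)
    fix b :: "real^'e basis_index" assume "b \<in> Basis"
    then obtain i where "b = axis i 1" by (auto simp: Basis_vec_def)
    then show "to_vec l \<bullet> b \<le> to_vec r \<bullet> b" using le[of "basis_vec i"] by (simp add: inner_axis to_vec_def)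
  qed
  also have "(\<Prod>b\<in>Basis. (to_vec r - to_vec l) \<bullet> b) = (\<Prod>i\<in>UNIV. (r - l) \<bullet> basis_vec i)"
  proof -
    have "(\<Prod>b\<in>Basis. (to_vec r - to_vec l) \<bullet> b) = (\<Prod>b\<in>(\<lambda>i. axis i 1) ` UNIV. (to_vec r - to_vec l) \<bullet> b)"
      by (rule prod.cong) (auto simp: Basis_vec_def)
    also have "\<dots> = (\<Prod>i\<in>UNIV. (r - l) \<bullet> basis_vec i)"
      by (subst prod.reindex) (auto simp: inj_on_def axis_eq_axis inner_axis to_vec_def inner_diff_left)
    finally show ?thesis .
  qed
  also have "\<dots> = (\<Prod>b\<in>Basis. (r - l) \<bullet> b)" by (rule prod_basis_vec)
  finally show "emeasure (distr lborel borel of_vec) (box l r) = (\<Prod>b\<in>Basis. (r - l) \<bullet> b)" .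
qed simp

lemma nn_integral_of_vec:
  assumes "f \<in> borel_measurable borel"
  shows "(\<integral>\<^sup>+v. f (of_vec v) \<partial>lborel) = (\<integral>\<^sup>+x. f x \<partial>(lborel :: 'e::euclidean_space measure))"
  using nn_integral_distr[of of_vec lborel borel f] assms by (simp add: distr_of_vec)

lemma has_integral_iff_nn_integral:
  fixes f :: "'a::euclidean_space \<Rightarrow> real"
  assumes f: "\<And>x. x \<in> A \<Longrightarrow> f x \<ge> 0" and m: "(\<lambda>x. indicator A x * f x) \<in> borel_measurable borel"
  shows "(f has_integral r) A \<longleftrightarrow> 0 \<le> r \<and> (\<integral>\<^sup>+x. indicator A x * ennreal (f x) \<partial>lborel) = ennreal r"
proof -
  have e: "indicator A x * ennreal (f x) = ennreal (indicator A x * f x)" for x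
    by (simp add: indicator_def)
  have "(f has_integral r) A \<longleftrightarrow> ((\<lambda>x. indicator A x * f x) has_integral r) UNIV"
  proof -
    have "(\<lambda>x. indicator A x * f x) = (\<lambda>x. if x \<in> A then f x else 0)" by auto
    then show ?thesis using has_integral_restrict_UNIV[of A f r] by simp
  qed
  moreover have "((\<lambda>x. indicator A x * f x) has_integral r) UNIV \<longleftrightarrow>
      0 \<le> r \<and> (\<integral>\<^sup>+x. ennreal (indicator A x * f x) \<partial>lborel) = ennreal r"
  proof
    assume *: "((\<lambda>x. indicator A x * f x) has_integral r) UNIV"
    have nn: "0 \<le> indicator A x * f x" for x using f by (simp add: indicator_def)
    show "0 \<le> r \<and> (\<integral>\<^sup>+x. ennreal (indicator A x * f x) \<partial>lborel) = ennreal r"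
      using nn_integral_has_integral_lebesgue[OF _ *] has_integral_nonneg[OF *] nn by auto
  qed (use nn_integral_has_integral[OF m] f in \<open>auto simp: indicator_def\<close>)
  ultimately show ?thesis by (simp add: e)
qed

lemma has_integral_change_of_variables:
  fixes h :: "real^'n::{finite,wellorder} \<Rightarrow> real" and p :: "real^'n::_ \<Rightarrow> real^'n::_"
  assumes A: "A \<in> sets borel" and der: "\<And>x. x \<in> A \<Longrightarrow> (p has_derivative p' x) (at x within A)" and inj: "inj_on p A"
    and h: "\<And>y. h y \<ge> 0"
  shows "((\<lambda>x. \<bar>det (matrix (p' x))\<bar> * h (p x)) has_integral m) A \<longleftrightarrow> (h has_integral m) (p ` A)"
proof -
  have A': "A \<in> sets lebesgue" using A by auto
  have *: "f absolutely_integrable_on B \<and> integral B f = m \<longleftrightarrow> (f has_integral m) B"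
    if "\<And>x. f x \<ge> 0" for f :: "real^'n::{finite,wellorder} \<Rightarrow> real" and B
    using that by (auto simp: absolutely_integrable_on_iff_nonneg has_integral_iff)
  show ?thesis
    using has_absolute_integral_change_of_variables [OF A' der inj, of "\<lambda>x. (vec (h x) :: real^1)" "vec m"]
    unfolding absolutely_integrable_on_1_iff integral_on_1_eq integrable_on_1_iff
    by (simp add: * h)
qed

text \<open>
  Change of variables for nonnegative functions whose integrals may be infinite: one side is finite if
  and only if the other is, and then the formula for integrable functions applies.
\<close>

lemma nn_integral_change_of_variables:
  fixes p :: "'e::euclidean_space \<Rightarrow> 'e" and h :: "'e \<Rightarrow> real"
  assumes A: "A \<in> sets borel" and pA: "p ` A \<in> sets borel"
    and der: "\<And>x. x \<in> A \<Longrightarrow> (p has_derivative T x) (at x within A)" and inj: "inj_on p A"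
    and h: "\<And>y. h y \<ge> 0"
    and m1: "(\<lambda>x. indicator A x * (\<bar>lin_det (T x)\<bar> * h (p x))) \<in> borel_measurable borel"
    and m2: "(\<lambda>y. indicator (p ` A) y * h y) \<in> borel_measurable borel"
  shows "(\<integral>\<^sup>+x. indicator A x * ennreal (\<bar>lin_det (T x)\<bar> * h (p x)) \<partial>lborel)
    = (\<integral>\<^sup>+y. indicator (p ` A) y * ennreal (h y) \<partial>lborel)"
proof -
  define B where "B = (to_vec ` A :: (real^'e basis_index) set)"
  define P where "P v = to_vec (p (of_vec v))" for v
  define P' where "P' v = to_vec \<circ> T (of_vec v) \<circ> of_vec" for v
  have inB: "v \<in> B \<longleftrightarrow> of_vec v \<in> A" for v
    unfolding B_def by (metis image_iff of_vec_to_vec to_vec_of_vec)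
  have inA: "indicator B v = (indicator A (of_vec v) :: 'z::zero_neq_one)" for v
    by (simp add: inB indicator_def)
  have PB: "P ` B = to_vec ` p ` A" by (auto simp: P_def B_def image_image)
  have inPB: "v \<in> P ` B \<longleftrightarrow> of_vec v \<in> p ` A" for v
    unfolding PB by (metis image_iff of_vec_to_vec to_vec_of_vec)
  have inPA: "indicator (P ` B) v = (indicator (p ` A) (of_vec v) :: 'z::zero_neq_one)" for v
    by (simp add: inPB indicator_def)
  have Bm: "B \<in> sets borel"
  proof -
    have "B = of_vec -` A \<inter> space borel" using inB by auto
    then show ?thesis using A measurable_sets[OF of_vec_measurable A] by simp
  qed
  have derP: "(P has_derivative P' v) (at v within B)" if "v \<in> B" for v
  proof -
    have v: "of_vec v \<in> A" using that by (auto simp: B_def)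
    have "of_vec ` B = A" by (auto simp: B_def image_image)
    then have "((\<lambda>v. p (of_vec v)) has_derivative (\<lambda>h. T (of_vec v) (of_vec h))) (at v within B)"
      using has_derivative_in_compose[OF bounded_linear_imp_has_derivative[OF bounded_linear_of_vec], of p _ v B] der[OF v] by simp
    from has_derivative_compose[OF this bounded_linear_imp_has_derivative[OF bounded_linear_to_vec]]
    show ?thesis unfolding P_def[abs_def] P'_def by (simp add: o_def)
  qed
  have det: "det (matrix (P' v)) = lin_det (T (of_vec v))" for v
  proof -
    have "of_vec (axis j 1) = basis_vec j" for j :: "'e basis_index"
      by (simp add: of_vec_def axis_def if_distrib[of "\<lambda>x. x *\<^sub>R _"] cong: if_cong)
    then have "matrix (P' v) = (\<chi> i j. T (of_vec v) (basis_vec j) \<bullet> basis_vec i)"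
      by (simp add: matrix_def P'_def vec_eq_iff) (simp add: to_vec_def)
    then show ?thesis by (simp add: lin_det_def)
  qed
  have injP: "inj_on P B"
    using inj by (auto simp: inj_on_def P_def B_def) (metis of_vec_to_vec)
  have *: "((\<lambda>x. \<bar>lin_det (T (of_vec x))\<bar> * h (p (of_vec x))) has_integral r) B \<longleftrightarrow> ((\<lambda>v. h (of_vec v)) has_integral r) (P ` B)" for r
    using has_integral_change_of_variables[OF Bm derP injP, of "\<lambda>v. h (of_vec v)" r] h by (simp add: det P_def)
  have M1: "(\<lambda>x. indicator B x * (\<bar>lin_det (T (of_vec x))\<bar> * h (p (of_vec x)))) \<in> borel_measurable borel"
    unfolding inA using measurable_compose[OF of_vec_measurable m1] by simp
  have M2: "(\<lambda>x. indicator (P ` B) x * h (of_vec x)) \<in> borel_measurable borel"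
    unfolding inPA using measurable_compose[OF of_vec_measurable m2] by simp
  let ?I = "\<integral>\<^sup>+x. indicator B x * ennreal (\<bar>lin_det (T (of_vec x))\<bar> * h (p (of_vec x))) \<partial>lborel"
  let ?J = "\<integral>\<^sup>+v. indicator (P ` B) v * ennreal (h (of_vec v)) \<partial>lborel"
  have iff: "?I = ennreal r \<longleftrightarrow> ?J = ennreal r" if "r \<ge> 0" for r
    using *[of r] that has_integral_iff_nn_integral[OF h M2, of r] has_integral_iff_nn_integral[OF _ M1, of r] h by auto
  have "?I = ?J"
  proof (cases "?I = \<infinity>")
    case True
    then show ?thesis using iff[of "enn2real ?J"] by (cases "?J") (auto)
  next
    case False
    then show ?thesis using iff[of "enn2real ?I"] by (auto simp: less_top)
  qed
  also have "?I = (\<integral>\<^sup>+x. indicator A x * ennreal (\<bar>lin_det (T x)\<bar> * h (p x)) \<partial>lborel)"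
  proof -
    have "(\<lambda>x. indicator A x * ennreal (\<bar>lin_det (T x)\<bar> * h (p x))) \<in> borel_measurable borel"
      using measurable_compose[OF m1 measurable_ennreal]
      by (rule measurable_cong[THEN iffD1, rotated]) (simp add: indicator_def)
    from nn_integral_of_vec[OF this] show ?thesis unfolding inA .
  qed
  also have "?J = (\<integral>\<^sup>+y. indicator (p ` A) y * ennreal (h y) \<partial>lborel)"
  proof -
    have "(\<lambda>x. indicator (p ` A) x * ennreal (h x)) \<in> borel_measurable borel"
      using measurable_compose[OF m2 measurable_ennreal]
      by (rule measurable_cong[THEN iffD1, rotated]) (simp add: indicator_def)
    from nn_integral_of_vec[OF this] show ?thesis unfolding inPA .
  qed
  finally show ?thesis .
qed

section \<open>The Riemannian measure\<close>

text \<open>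
  The local densities determine the measure, since the space is a finite disjoint union of pieces
  lying in chart domains.
\<close>

lemma riem_measure_eqI:
  fixes R :: "('i, 'm::topological_space, 'e::euclidean_space) riem"
  assumes F: "finite F" "F \<subseteq> idx R" "points R = (\<Union>i\<in>F. cdom R i)"
    and dom: "\<And>i. i \<in> idx R \<Longrightarrow> cdom R i \<in> sets (restrict_space borel (points R))"
    and sp: "space M = points R" and se: "sets M = sets (restrict_space borel (points R))"
    and M: "\<And>i E. i \<in> idx R \<Longrightarrow> E \<in> sets M \<Longrightarrow> E \<subseteq> cdom R i \<Longrightarrow>
      emeasure M E = (\<integral>\<^sup>+y\<in>chart R i ` E. ennreal (sqrt (gram_det (met R i y))) \<partial>lborel)"
  shows "riem_measure R = M"
  unfolding riem_measure_def
proof (rule the_equality)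
  fix M' assume M': "space M' = points R \<and> sets M' = sets (restrict_space borel (points R)) \<and>
        (\<forall>i\<in>idx R. \<forall>E\<in>sets M'. E \<subseteq> cdom R i \<longrightarrow>
           emeasure M' E = (\<integral>\<^sup>+y\<in>chart R i ` E. ennreal (sqrt (gram_det (met R i y))) \<partial>lborel))"
  then have se': "sets M' = sets M" using se by simp
  have *: "emeasure M' E = emeasure M E" if "finite F0" "F0 \<subseteq> idx R" "E \<in> sets M" "E \<subseteq> (\<Union>i\<in>F0. cdom R i)" for F0 E
    using that
  proof (induction F0 arbitrary: E rule: finite_induct)
    case (insert i F0)
    have c: "cdom R i \<in> sets M" using dom insert.prems se by simp
    have 1: "E \<inter> cdom R i \<in> sets M" "E - cdom R i \<in> sets M" using c insert.prems by auto
    have "emeasure M' (E \<inter> cdom R i) = emeasure M (E \<inter> cdom R i)"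
      using M[of i "E \<inter> cdom R i"] M'[THEN conjunct2, THEN conjunct2, rule_format, of i "E \<inter> cdom R i"]
        1 se' insert.prems by simp
    moreover have "emeasure M' (E - cdom R i) = emeasure M (E - cdom R i)"
      using insert.IH[of "E - cdom R i"] insert.prems 1 by auto
    moreover have "emeasure X E = emeasure X (E \<inter> cdom R i) + emeasure X (E - cdom R i)" if "sets X = sets M" for X
      using plus_emeasure[of "E \<inter> cdom R i" X "E - cdom R i"] 1 that by (simp add: Int_Diff_Un Int_Diff_disjoint)
    ultimately show ?case using se' by metis
  qed simp
  show "M' = M"
  proof (rule measure_eqI[OF se'])
    fix E assume "E \<in> sets M'"
    then show "emeasure M' E = emeasure M E"
      using *[OF F(1,2), of E] se' sets.sets_into_space[of E M] sp F(3) by simp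
  qed
qed (use sp se M in blast)

lemma sum_measure_exists:
  assumes F: "finite F" and s: "\<And>j. j \<in> F \<Longrightarrow> sets (\<nu> j) = sets (borel :: 'm::topological_space measure)"
  shows "\<exists>M. sets M = sets (borel :: 'm measure) \<and> (\<forall>E\<in>sets borel. emeasure M E = (\<Sum>j\<in>F. emeasure (\<nu> j) E))"
proof -
  define M where "M = measure_of UNIV (sets (borel :: 'm measure)) (\<lambda>E. \<Sum>j\<in>F. emeasure (\<nu> j) E)"
  have sets_M: "sets M = sets borel"
    unfolding M_def using sets.sigma_sets_eq[of "borel :: 'm measure"] by (simp add: sets_measure_of_conv)
  moreover have "emeasure M E = (\<Sum>j\<in>F. emeasure (\<nu> j) E)" if "E \<in> sets borel" for E
  proof (rule emeasure_measure_of[OF M_def])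
    show "countably_additive (sets M) (\<lambda>E. \<Sum>j\<in>F. emeasure (\<nu> j) E)"
      unfolding countably_additive_def sets_M
    proof (intro allI impI)
      fix A :: "nat \<Rightarrow> 'm set" assume A: "range A \<subseteq> sets borel" "disjoint_family A"
      have "(\<Sum>n. \<Sum>j\<in>F. emeasure (\<nu> j) (A n)) = (\<Sum>j\<in>F. \<Sum>n. emeasure (\<nu> j) (A n))"
        by (rule suminf_sum) auto
      also have "\<dots> = (\<Sum>j\<in>F. emeasure (\<nu> j) (\<Union>n. A n))"
        using A s by (intro sum.cong refl suminf_emeasure) auto
      finally show "(\<Sum>n. \<Sum>j\<in>F. emeasure (\<nu> j) (A n)) = (\<Sum>j\<in>F. emeasure (\<nu> j) (\<Union>n. A n))" .
    qed
    show "E \<in> sets M" using that sets_M by simp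
  qed (auto simp: positive_def)
  ultimately show ?thesis by blast
qed

locale closed_manifold =
  fixes N :: "('i, 'm::t2_space, 'e::euclidean_space) riem"
  assumes closed_N: "closed_riemannian_manifold N"
begin

lemma atlas:
  assumes "i \<in> idx N"
  shows open_cdom: "open (cdom N i)" and open_cimg: "open (cimg N i)"
    and homeo: "homeomorphism (cdom N i) (cimg N i) (chart N i) (cinv N i)"
  using closed_N assms unfolding closed_riemannian_manifold_def smooth_atlas_def by auto

lemma cinv_chart: "i \<in> idx N \<Longrightarrow> p \<in> cdom N i \<Longrightarrow> cinv N i (chart N i p) = p"
  and chart_cinv: "y \<in> cimg N i \<Longrightarrow> chart N i (cinv N i y) = y"
  and cinv_in: "y \<in> cimg N i \<Longrightarrow> cinv N i y \<in> cdom N i"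
  and chart_in: "p \<in> cdom N i \<Longrightarrow> chart N i p \<in> cimg N i"
  and cont_chart: "i \<in> idx N \<Longrightarrow> continuous_on (cdom N i) (chart N i)"
  and cont_cinv: "i \<in> idx N \<Longrightarrow> continuous_on (cimg N i) (cinv N i)"
  using homeo by (auto simp: homeomorphism_def cimg_def cinv_def f_inv_into_f inv_into_into)

lemma cover: "\<exists>i\<in>idx N. p \<in> cdom N i"
  using closed_N unfolding closed_riemannian_manifold_def points_def by auto

lemma points_UNIV: "points N = UNIV"
  using closed_N unfolding closed_riemannian_manifold_def by auto

lemma compact_M: "compact (UNIV :: 'm set)"
  using closed_N unfolding closed_riemannian_manifold_def by auto

lemma finite_cover: obtains F where "finite F" "F \<subseteq> idx N" "(\<Union>i\<in>F. cdom N i) = UNIV"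
proof -
  have "UNIV \<subseteq> (\<Union>i\<in>idx N. cdom N i)" using cover by auto
  from compactE_image[OF compact_M open_cdom this] show ?thesis
    using that by (metis UNIV_eq_I UNIV_I subsetD)
qed

lemma metric:
  assumes "i \<in> idx N"
  shows smooth_met: "smooth_on (cimg N i) (\<lambda>y. met N i y v w)"
    and pd_met: "y \<in> cimg N i \<Longrightarrow> pd_form (met N i y)"
  using closed_N assms
  unfolding closed_riemannian_manifold_def riemannian_metric_def pd_form_def by blast+

definition trans where "trans i j = chart N j \<circ> cinv N i"

lemma open_overlap:
  assumes "i \<in> idx N" "j \<in> idx N"
  shows "open (chart N i ` (cdom N i \<inter> cdom N j))"
proof -
  have "chart N i ` (cdom N i \<inter> cdom N j) = cimg N i \<inter> cinv N i -` cdom N j"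
    using assms cinv_chart chart_cinv cinv_in chart_in by (auto simp: image_iff) (metis IntI)
  then show ?thesis
    using continuous_open_preimage[OF cont_cinv open_cimg open_cdom] assms by simp
qed

lemma smooth_trans:
  "i \<in> idx N \<Longrightarrow> j \<in> idx N \<Longrightarrow> smooth_on (chart N i ` (cdom N i \<inter> cdom N j)) (trans i j)"
  using closed_N unfolding closed_riemannian_manifold_def smooth_atlas_def trans_def by blast

lemma trans_has_derivative:
  assumes "i \<in> idx N" "j \<in> idx N" "p \<in> cdom N i" "p \<in> cdom N j"
  shows "(trans i j has_derivative fd (trans i j) (chart N i p)) (at (chart N i p))"
  using smooth_on_has_derivative(1)[OF open_overlap smooth_trans] assms by auto

lemma met_trans:
  assumes "i \<in> idx N" "j \<in> idx N" "p \<in> cdom N i" "p \<in> cdom N j"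
  shows "met N i (chart N i p) = (\<lambda>v w. met N j (chart N j p)
     (fd (trans i j) (chart N i p) v) (fd (trans i j) (chart N i p) w))"
  using closed_N assms
  unfolding closed_riemannian_manifold_def riemannian_metric_def Let_def trans_def fun_eq_iff by blast

text \<open>
  A vector annihilated by the transition map would have length zero by invariance of the metric.
\<close>

lemma fd_trans_surj:
  assumes "i \<in> idx N" "j \<in> idx N" "p \<in> cdom N i" "p \<in> cdom N j"
  shows "surj (fd (trans i j) (chart N i p))"
proof -
  let ?T = "fd (trans i j) (chart N i p)"
  have lin: "linear ?T" using trans_has_derivative[OF assms] has_derivative_linear by blast
  have "v = 0" if "?T v = 0" for v
  proof (rule ccontr)
    assume "v \<noteq> 0"
    then have "met N i (chart N i p) v v > 0" using pd_formD(3)[OF pd_met] chart_in assms by blast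
    then show False unfolding met_trans[OF assms] that
      using bilinear_lzero[OF pd_formD(1)[OF pd_met]] chart_in assms by simp
  qed
  then have "inj ?T" using linear_injective_0[OF lin] by blast
  then show ?thesis using linear_injective_imp_surjective[OF lin] by blast
qed

definition dens where "dens i y = sqrt (gram_det (met N i y))"

lemma dens_pos: "i \<in> idx N \<Longrightarrow> y \<in> cimg N i \<Longrightarrow> dens i y > 0"
  unfolding dens_def using gram_det_pos[OF pd_met] by simp

lemma C1_dens: "i \<in> idx N \<Longrightarrow> C1_on (cimg N i) (dens i)"
  unfolding dens_def[abs_def] using gram_det_pos[OF pd_met]
  by (intro C1_on_sqrt C1_on_gram_det smooth_on_C1 open_cimg smooth_met)

lemma cont_dens: "i \<in> idx N \<Longrightarrow> continuous_on (cimg N i) (dens i)"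
  by (rule C1_on_continuous[OF C1_dens])

lemma measurable_on_chart:
  fixes f :: "'e \<Rightarrow> real"
  assumes "i \<in> idx N" "continuous_on (cimg N i) f"
  shows "(\<lambda>y. indicator (cimg N i) y * f y) \<in> borel_measurable borel"
  using borel_measurable_continuous_on_indicator[OF borel_open[OF open_cimg] assms(2)] assms(1) by simp

text \<open>
  The inverse chart as a total function, so that measures can be transported along it.
\<close>

definition cinvx where "cinvx i y = (if y \<in> cimg N i then cinv N i y else undefined)"

lemma cinvx_measurable [measurable]: "i \<in> idx N \<Longrightarrow> cinvx i \<in> measurable borel borel"
proof (rule borel_measurableI)
  fix T :: "'m set" assume i: "i \<in> idx N" and T: "open T"
  have "cinvx i -` T \<inter> space borel = (cimg N i \<inter> cinv N i -` T) \<union> (if undefined \<in> T then - cimg N i else {})"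
    by (auto simp: cinvx_def split: if_splits)
  moreover have "open (cimg N i \<inter> cinv N i -` T)"
    using continuous_open_preimage[OF cont_cinv open_cimg T] i by simp
  ultimately show "cinvx i -` T \<inter> space borel \<in> sets borel"
    using borel_open[OF open_cimg[OF i]] by auto
qed

lemma chart_image:
  assumes "i \<in> idx N" "E \<subseteq> cdom N i"
  shows "chart N i ` E = cimg N i \<inter> cinvx i -` E"
proof
  show "chart N i ` E \<subseteq> cimg N i \<inter> cinvx i -` E"
    using assms chart_in cinv_chart by (auto simp: cinvx_def)
  show "cimg N i \<inter> cinvx i -` E \<subseteq> chart N i ` E"
    using chart_cinv by (auto simp: cinvx_def image_iff) (metis)
qed

lemma chart_image_borel:
  assumes i: "i \<in> idx N" and "E \<subseteq> cdom N i" and E: "E \<in> sets borel"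
  shows "chart N i ` E \<in> sets borel"
  unfolding chart_image[OF assms(1,2)]
  using measurable_sets[OF cinvx_measurable[OF i] E] borel_open[OF open_cimg[OF i]] by auto

definition chart_measure where
  "chart_measure i = distr (density lborel (\<lambda>y. ennreal (indicator (cimg N i) y * dens i y))) borel (cinvx i)"

lemma sets_chart_measure [simp]: "sets (chart_measure i) = sets borel"
  by (simp add: chart_measure_def)

lemma emeasure_chart_measure:
  assumes i: "i \<in> idx N" and E: "E \<in> sets borel"
  shows "emeasure (chart_measure i) E = (\<integral>\<^sup>+y. indicator (chart N i ` (E \<inter> cdom N i)) y * ennreal (dens i y) \<partial>lborel)"
proof -
  have m: "(\<lambda>y. indicator (cimg N i) y * dens i y) \<in> borel_measurable borel"
    by (rule measurable_on_chart[OF i cont_dens[OF i]])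
  have 1: "cinvx i -` E \<in> sets borel" using measurable_sets[OF cinvx_measurable[OF i] E] by simp
  have "emeasure (chart_measure i) E = (\<integral>\<^sup>+y. ennreal (indicator (cimg N i) y * dens i y) * indicator (cinvx i -` E) y \<partial>lborel)"
    unfolding chart_measure_def using m i E 1
    by (simp add: emeasure_distr emeasure_density)
  also have "\<dots> = (\<integral>\<^sup>+y. indicator (chart N i ` (E \<inter> cdom N i)) y * ennreal (dens i y) \<partial>lborel)"
    unfolding chart_image[OF i Int_lower2]
    by (intro nn_integral_cong) (use cinv_in in \<open>auto simp: indicator_def cinvx_def\<close>)
  finally show ?thesis .
qed

text \<open>
  By invariance of the metric, \<open>det g\<^sub>i = (det T)\<^sup>2 det g\<^sub>j\<close> with \<open>T\<close> the derivative of the transition map; its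
  square root is the Jacobian factor in the change of variables.
\<close>

lemma chart_measure_agree:
  assumes i: "i \<in> idx N" and j: "j \<in> idx N" and E: "E \<in> sets borel" "E \<subseteq> cdom N i" "E \<subseteq> cdom N j"
  shows "emeasure (chart_measure i) E = emeasure (chart_measure j) E"
proof -
  define A where "A = chart N i ` E"
  define T where "T = fd (trans i j)"
  define h where "h y = indicator (cimg N j) y * dens j y" for y
  have tr: "trans i j (chart N i p) = chart N j p" if "p \<in> E" for p
    using that E cinv_chart[OF i] by (auto simp: trans_def)
  have pA: "trans i j ` A = chart N j ` E" by (force simp: A_def image_image tr)
  have der: "(trans i j has_derivative T y) (at y within A)" if "y \<in> A" for y
    using trans_has_derivative[OF i j] that E unfolding A_def T_def
    by (auto intro: has_derivative_at_withinI)
  have inj: "inj_on (trans i j) A"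
  proof (rule inj_onI)
    fix x y assume "x \<in> A" "y \<in> A" "trans i j x = trans i j y"
    then obtain p q where pq: "p \<in> E" "q \<in> E" "x = chart N i p" "y = chart N i q" "chart N j p = chart N j q"
      by (auto simp: A_def tr)
    then have "p = q" using cinv_chart[OF j] E(3) by (metis subsetD)
    then show "x = y" using pq by simp
  qed
  have hnn: "h y \<ge> 0" for y
    using dens_pos[OF j, of y] by (auto simp: h_def indicator_def intro: less_imp_le)
  have eq: "\<bar>lin_det (T x)\<bar> * h (trans i j x) = dens i x" if x: "x \<in> A" for x
  proof -
    obtain p where p: "p \<in> E" "x = chart N i p" using x by (auto simp: A_def)
    then have pd: "p \<in> cdom N i" "p \<in> cdom N j" using E by auto
    have "gram_det (met N i x) = (lin_det (T x))\<^sup>2 * gram_det (met N j (chart N j p))"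
      unfolding p(2) T_def met_trans[OF i j pd]
      by (rule gram_det_pullback[OF pd_formD(1)[OF pd_met[OF j chart_in[OF pd(2)]]]])
    then have "dens i x = \<bar>lin_det (T x)\<bar> * dens j (chart N j p)"
      by (simp add: dens_def real_sqrt_mult)
    then show ?thesis using tr[OF p(1)] chart_in[OF pd(2)] p(2) by (simp add: h_def)
  qed
  have Am: "A \<in> sets borel" unfolding A_def by (rule chart_image_borel[OF i E(2,1)])
  have pAm: "trans i j ` A \<in> sets borel" unfolding pA by (rule chart_image_borel[OF j E(3,1)])
  have mi: "(\<lambda>x. indicator A x * dens i x) \<in> borel_measurable borel"
  proof -
    have "(\<lambda>x. indicator A x * dens i x) = (\<lambda>x. indicator A x * (indicator (cimg N i) x * dens i x))"
      using E(2) chart_in by (auto simp: A_def indicator_def fun_eq_iff)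
    then show ?thesis using measurable_on_chart[OF i cont_dens[OF i]] Am by simp
  qed
  have e: "indicator A x * (\<bar>lin_det (T x)\<bar> * h (trans i j x)) = indicator A x * dens i x"
     "indicator A x * ennreal (\<bar>lin_det (T x)\<bar> * h (trans i j x)) = indicator A x * ennreal (dens i x)" for x
    using eq by (auto simp: indicator_def)
  have "(\<integral>\<^sup>+x. indicator A x * ennreal (dens i x) \<partial>lborel) = (\<integral>\<^sup>+y. indicator (trans i j ` A) y * ennreal (h y) \<partial>lborel)"
    using nn_integral_change_of_variables[where h = h, OF Am pAm der inj hnn] pAm measurable_on_chart[OF j cont_dens[OF j]] mi
    unfolding e h_def[symmetric] by simp
  also have "\<dots> = (\<integral>\<^sup>+y. indicator (chart N j ` E) y * ennreal (dens j y) \<partial>lborel)"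
    unfolding pA using chart_in E(3) by (intro nn_integral_cong) (auto simp: h_def indicator_def)
  finally show ?thesis
    using E by (simp add: emeasure_chart_measure[OF i E(1)] emeasure_chart_measure[OF j E(1)] A_def Int_absorb2)
qed

text \<open>
  The chart measures are restricted to the disjoint sets \<open>D n\<close>, each in one domain of a finite cover, and
  added up; by \<open>chart_measure_agree\<close> the choices do not matter.
\<close>

lemma riem_measure_exists:
  "\<exists>M. sets M = sets (borel :: 'm measure) \<and>
     (\<forall>i\<in>idx N. \<forall>E\<in>sets borel. E \<subseteq> cdom N i \<longrightarrow> emeasure M E = emeasure (chart_measure i) E)"
proof -
  obtain F where F: "finite F" "F \<subseteq> idx N" "(\<Union>i\<in>F. cdom N i) = UNIV" by (rule finite_cover)
  then obtain e :: "nat \<Rightarrow> 'i" and m where e: "F = e ` {0..<m}"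
    using finite_imp_nat_seg_image_inj_on[OF F(1)] by (metis atLeast0LessThan lessThan_def)
  define D where "D = disjointed (\<lambda>n. cdom N (e n))"
  have eF: "e n \<in> idx N" if "n < m" for n using that e F(2) by auto
  have D: "D n \<in> sets borel" if "n < m" for n
    using that eF unfolding D_def disjointed_def by (intro sets.Diff sets.finite_UN borel_open open_cdom) auto
  have Dsub: "D n \<subseteq> cdom N (e n)" for n unfolding D_def by (rule disjointed_subset)
  have DU: "(\<Union>n\<in>{0..<m}. D n) = UNIV"
    unfolding D_def finite_UN_disjointed_eq using F(3) e by auto
  have disj: "disjoint_family_on D {0..<m}"
    using disjoint_family_disjointed unfolding D_def by (rule disjoint_family_on_mono[rotated]) auto
  define \<nu> where "\<nu> n = density (chart_measure (e n)) (indicator (D n))" for n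
  obtain M where M: "sets M = sets (borel :: 'm measure)"
      "\<And>E. E \<in> sets borel \<Longrightarrow> emeasure M E = (\<Sum>n\<in>{0..<m}. emeasure (\<nu> n) E)"
    using sum_measure_exists[of "{0..<m}" \<nu>] by (auto simp: \<nu>_def)
  have "emeasure M E = emeasure (chart_measure i) E" if i: "i \<in> idx N" and E: "E \<in> sets borel" "E \<subseteq> cdom N i" for i E
  proof -
    have "emeasure (\<nu> n) E = emeasure (chart_measure i) (E \<inter> D n)" if n: "n \<in> {0..<m}" for n
    proof -
      have "emeasure (\<nu> n) E = emeasure (chart_measure (e n)) (D n \<inter> E)"
        unfolding \<nu>_def using E D n
        by (subst emeasure_density) (auto simp: nn_integral_indicator indicator_inter_arith[symmetric]
          measurable_cong_sets[OF sets_chart_measure refl])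
      also have "\<dots> = emeasure (chart_measure i) (D n \<inter> E)"
        using eF n i E D Dsub[of n] by (intro chart_measure_agree) auto
      finally show ?thesis by (simp add: Int_commute)
    qed
    then have "emeasure M E = (\<Sum>n\<in>{0..<m}. emeasure (chart_measure i) (E \<inter> D n))"
      using M E by simp
    also have "\<dots> = emeasure (chart_measure i) (\<Union>n\<in>{0..<m}. E \<inter> D n)"
    proof (intro sum_emeasure)
      show "disjoint_family_on (\<lambda>n. E \<inter> D n) {0..<m}"
        using disj unfolding disjoint_family_on_def by blast
    qed (use E D in auto)
    also have "(\<Union>n\<in>{0..<m}. E \<inter> D n) = E" using DU by auto
    finally show ?thesis .
  qed
  then show ?thesis using M by blast
qed

abbreviation "\<mu> \<equiv> riem_measure N"

lemma riem_measure:
  shows sets_mu [simp, measurable_cong]: "sets \<mu> = sets borel"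
    and emeasure_mu: "i \<in> idx N \<Longrightarrow> E \<in> sets borel \<Longrightarrow> E \<subseteq> cdom N i \<Longrightarrow> emeasure \<mu> E = emeasure (chart_measure i) E"
proof -
  obtain M where M: "sets M = sets (borel :: 'm measure)"
     "\<And>i E. i \<in> idx N \<Longrightarrow> E \<in> sets borel \<Longrightarrow> E \<subseteq> cdom N i \<Longrightarrow> emeasure M E = emeasure (chart_measure i) E"
    using riem_measure_exists by blast
  obtain F where F: "finite F" "F \<subseteq> idx N" "(\<Union>i\<in>F. cdom N i) = UNIV" by (rule finite_cover)
  have "\<mu> = M"
  proof (rule riem_measure_eqI[OF F(1,2)])
    show "points N = (\<Union>i\<in>F. cdom N i)" using F points_UNIV by simp
    show "cdom N i \<in> sets (restrict_space borel (points N))" if "i \<in> idx N" for i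
      using borel_open[OF open_cdom[OF that]] by (simp add: points_UNIV)
    show "space M = points N" "sets M = sets (restrict_space borel (points N))"
      using M(1) sets_eq_imp_space_eq[OF M(1)] by (simp_all add: points_UNIV)
    show "emeasure M E = (\<integral>\<^sup>+y\<in>chart N i ` E. ennreal (sqrt (gram_det (met N i y))) \<partial>lborel)"
      if "i \<in> idx N" "E \<in> sets M" "E \<subseteq> cdom N i" for i E
      using M that emeasure_chart_measure[of i E] by (simp add: Int_absorb2 dens_def mult.commute)
  qed
  then show "sets \<mu> = sets borel" and "i \<in> idx N \<Longrightarrow> E \<in> sets borel \<Longrightarrow> E \<subseteq> cdom N i \<Longrightarrow> emeasure \<mu> E = emeasure (chart_measure i) E"
    using M by auto
qed

lemma space_mu [simp]: "space \<mu> = UNIV"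
  using sets_eq_imp_space_eq[OF sets_mu] by simp

lemma density_chart:
  assumes i: "i \<in> idx N"
  shows "density \<mu> (indicator (cdom N i)) = chart_measure i"
proof (rule measure_eqI)
  fix E assume "E \<in> sets (density \<mu> (indicator (cdom N i)))"
  then have E: "E \<in> sets borel" by simp
  have c: "cdom N i \<in> sets borel" using open_cdom[OF i] by simp
  have "emeasure (density \<mu> (indicator (cdom N i))) E = emeasure \<mu> (cdom N i \<inter> E)"
    using E c by (subst emeasure_density) (auto simp: nn_integral_indicator indicator_inter_arith[symmetric])
  also have "\<dots> = emeasure (chart_measure i) (cdom N i \<inter> E)"
    using E c by (intro emeasure_mu[OF i]) auto
  also have "\<dots> = emeasure (chart_measure i) E"
    using E c by (simp add: emeasure_chart_measure[OF i] Int_commute Int_left_commute)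
  finally show "emeasure (density \<mu> (indicator (cdom N i))) E = emeasure (chart_measure i) E" .
qed simp

lemma nn_integral_chart:
  assumes i: "i \<in> idx N" and f: "f \<in> borel_measurable borel"
  shows "(\<integral>\<^sup>+p. indicator (cdom N i) p * f p \<partial>\<mu>)
    = (\<integral>\<^sup>+y. indicator (cimg N i) y * (ennreal (dens i y) * f (cinv N i y)) \<partial>lborel)"
proof -
  have c: "cdom N i \<in> sets borel" using open_cdom[OF i] by simp
  have m: "(\<lambda>y. indicator (cimg N i) y * dens i y) \<in> borel_measurable borel"
    by (rule measurable_on_chart[OF i cont_dens[OF i]])
  have "(\<integral>\<^sup>+p. indicator (cdom N i) p * f p \<partial>\<mu>) = (\<integral>\<^sup>+p. f p \<partial>density \<mu> (indicator (cdom N i)))"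
    using c f by (subst nn_integral_density) (auto simp: measurable_cong_sets[OF sets_mu refl])
  also have "\<dots> = (\<integral>\<^sup>+y. ennreal (indicator (cimg N i) y * dens i y) * f (cinvx i y) \<partial>lborel)"
    unfolding density_chart[OF i] chart_measure_def using f i m
    by (simp add: nn_integral_distr nn_integral_density)
  also have "\<dots> = (\<integral>\<^sup>+y. indicator (cimg N i) y * (ennreal (dens i y) * f (cinv N i y)) \<partial>lborel)"
    by (intro nn_integral_cong) (auto simp: indicator_def cinvx_def)
  finally show ?thesis .
qed

lemma integral_chart:
  fixes f :: "'m \<Rightarrow> real"
  assumes i: "i \<in> idx N" and f: "f \<in> borel_measurable borel"
  shows "(\<integral>p. indicator (cdom N i) p * f p \<partial>\<mu>)
    = (LINT y:cimg N i|lborel. dens i y * f (cinv N i y))"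
proof -
  have c: "cdom N i \<in> sets borel" using open_cdom[OF i] by simp
  have m: "(\<lambda>y. indicator (cimg N i) y * dens i y) \<in> borel_measurable borel"
    by (rule measurable_on_chart[OF i cont_dens[OF i]])
  have nn: "AE y in lborel. 0 \<le> indicator (cimg N i) y * dens i y"
    using dens_pos[OF i] by (auto simp: indicator_def intro: less_imp_le)
  have "(\<integral>p. indicator (cdom N i) p * f p \<partial>\<mu>) = (\<integral>p. f p \<partial>density \<mu> (\<lambda>p. ennreal (indicator (cdom N i) p)))"
    using c f by (subst integral_real_density) (auto simp: measurable_cong_sets[OF sets_mu refl])
  also have "\<dots> = (\<integral>y. (indicator (cimg N i) y * dens i y) * f (cinvx i y) \<partial>lborel)"
    unfolding ennreal_indicator density_chart[OF i] chart_measure_def using f i m nn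
    by (simp add: integral_distr integral_real_density)
  also have "\<dots> = (LINT y:cimg N i|lborel. dens i y * f (cinv N i y))"
    unfolding set_lebesgue_integral_def
    by (intro Bochner_Integration.integral_cong) (auto simp: indicator_def cinvx_def)
  finally show ?thesis .
qed

end

section \<open>Bump functions and products of gradients\<close>

lemma DERIV_max_sq: "((\<lambda>t. (max 0 t)\<^sup>2) has_real_derivative 2 * max 0 t) (at t)"
proof -
  consider "t > 0" | "t < 0" | "t = 0" by linarith
  then show ?thesis
  proof cases
    case 1
    have "((\<lambda>t. t\<^sup>2) has_real_derivative 2 * max 0 t) (at t)"
      using 1 by (auto intro!: derivative_eq_intros)
    then show ?thesis
      by (rule has_field_derivative_transform_within_open[where S = "{0<..}"]) (use 1 in auto)
  next
    case 2
    have "((\<lambda>t. 0) has_real_derivative 2 * max 0 t) (at t)" using 2 by auto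
    then show ?thesis
      by (rule has_field_derivative_transform_within_open[where S = "{..<0}"]) (use 2 in auto)
  next
    case 3
    have "((\<lambda>h::real. (max 0 h)\<^sup>2 / h) \<longlongrightarrow> 0) (at 0)"
    proof (rule Lim_null_comparison)
      show "\<forall>\<^sub>F h in at 0. norm ((max 0 h)\<^sup>2 / h) \<le> norm (h::real)"
        by (rule always_eventually) (auto simp: max_def power2_eq_square)
      show "((\<lambda>h::real. norm h) \<longlongrightarrow> 0) (at 0)" by (intro tendsto_norm_zero tendsto_ident_at)
    qed
    then show ?thesis using 3 by (simp add: DERIV_def)
  qed
qed

lemma C1_bump: "C1_on UNIV (\<lambda>y. (max 0 (r\<^sup>2 - (y - c) \<bullet> (y - c)))\<^sup>2)" for c :: "'e::euclidean_space"
proof (rule C1_on_compose_real[where p = "\<lambda>t. (max 0 t)\<^sup>2" and p' = "\<lambda>t. 2 * max 0 t"])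
  show "C1_on UNIV (\<lambda>y. r\<^sup>2 - (y - c) \<bullet> (y - c))"
    by (rule C1_onI[of _ _ "\<lambda>y v. - ((y - c) \<bullet> v + v \<bullet> (y - c))"])
       (auto intro!: derivative_eq_intros continuous_intros)
qed (auto intro!: DERIV_max_sq continuous_intros)

text \<open>
  A nonempty open set is not a null set.
\<close>

lemma open_AE_zero:
  fixes f :: "'e::euclidean_space \<Rightarrow> real"
  assumes S: "open S" and f: "continuous_on S f" and ae: "AE y in lborel. y \<in> S \<longrightarrow> f y = 0" and y: "y \<in> S"
  shows "f y = 0"
proof (rule ccontr)
  assume n: "f y \<noteq> 0"
  have O: "open (S \<inter> f -` (- {0}))" by (rule continuous_open_preimage[OF f S]) auto
  have "AE y in lborel. y \<notin> S \<inter> f -` (- {0})" using ae by eventually_elim auto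
  then have "S \<inter> f -` (- {0}) \<in> null_sets lborel"
    using O by (subst (asm) AE_iff_null_sets[symmetric]) auto
  then have "negligible (S \<inter> f -` (- {0}))"
    by (simp add: negligible_iff_null_sets null_sets_completionI)
  then show False using open_not_negligible[OF O] n y by auto
qed

context closed_manifold
begin

abbreviation rep :: "'i \<Rightarrow> ('m \<Rightarrow> real) \<Rightarrow> 'e \<Rightarrow> real" where
  "rep i f \<equiv> \<lambda>y. f (cinv N i y)"

definition C1_fun :: "('m \<Rightarrow> real) \<Rightarrow> bool" where
  "C1_fun f \<longleftrightarrow> (\<forall>i\<in>idx N. C1_on (cimg N i) (rep i f))"

lemma C1_funD: "C1_fun f \<Longrightarrow> i \<in> idx N \<Longrightarrow> C1_on (cimg N i) (rep i f)"
  by (simp add: C1_fun_def)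

lemma C1_fun_mult: "C1_fun f \<Longrightarrow> C1_fun g \<Longrightarrow> C1_fun (\<lambda>p. f p * g p)"
  unfolding C1_fun_def by (auto intro: C1_on_mult)

lemma C1_fun_divide: "C1_fun f \<Longrightarrow> C1_fun g \<Longrightarrow> (\<And>p. g p \<noteq> 0) \<Longrightarrow> C1_fun (\<lambda>p. f p / g p)"
  unfolding C1_fun_def by (auto intro: C1_on_divide)

lemma C1_fun_sum: "finite A \<Longrightarrow> (\<And>a. a \<in> A \<Longrightarrow> C1_fun (f a)) \<Longrightarrow> C1_fun (\<lambda>p. \<Sum>a\<in>A. f a p)"
  unfolding C1_fun_def by (auto intro: C1_on_sum)

lemma continuous_from_charts:
  fixes f :: "'m \<Rightarrow> real"
  assumes "\<And>i. i \<in> idx N \<Longrightarrow> continuous_on (cimg N i) (rep i f)"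
  shows "continuous_on UNIV f"
proof (rule continuous_at_imp_continuous_on, rule ballI)
  fix p
  obtain i where i: "i \<in> idx N" "p \<in> cdom N i" using cover by blast
  have "continuous_on (cdom N i) (\<lambda>p. rep i f (chart N i p))"
    by (rule continuous_on_compose2[OF assms cont_chart]) (use i chart_in in auto)
  then have "continuous_on (cdom N i) f"
    by (rule continuous_on_eq) (simp add: cinv_chart i)
  then show "isCont f p" using open_cdom i by (simp add: continuous_on_eq_continuous_at)
qed

lemma continuous_C1_fun: "C1_fun f \<Longrightarrow> continuous_on UNIV f"
  by (rule continuous_from_charts) (blast intro: C1_on_continuous C1_funD)

subsection \<open>Bump functions\<close>

definition supported_in_chart :: "'i \<Rightarrow> ('m \<Rightarrow> real) \<Rightarrow> bool" where
  "supported_in_chart i f \<longleftrightarrow> (\<exists>K. compact K \<and> K \<subseteq> cimg N i \<and> (\<forall>p. p \<notin> cinv N i ` K \<longrightarrow> f p = 0))"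

lemma closed_cinv_image: "i \<in> idx N \<Longrightarrow> compact K \<Longrightarrow> K \<subseteq> cimg N i \<Longrightarrow> closed (cinv N i ` K)"
  using compact_continuous_image[OF continuous_on_subset[OF cont_cinv]] compact_imp_closed by blast

text \<open>
  In another chart the function is a composition with the transition map on the overlap, and it
  vanishes on the complement of its support, which is open because a compact set is closed in a
  Hausdorff space.
\<close>

lemma C1_fun_local:
  assumes i: "i \<in> idx N" and f: "C1_on (cimg N i) (rep i f)" and supp: "supported_in_chart i f"
  shows "C1_fun f"
  unfolding C1_fun_def
proof
  fix j assume j: "j \<in> idx N"
  obtain K where K: "compact K" "K \<subseteq> cimg N i" and 0: "\<And>p. p \<notin> cinv N i ` K \<Longrightarrow> f p = 0"
    using supp by (auto simp: supported_in_chart_def)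
  let ?A = "chart N j ` (cdom N j \<inter> cdom N i)"
  let ?B = "cimg N j \<inter> cinv N j -` (- cinv N i ` K)"
  have oA: "open ?A" by (rule open_overlap[OF j i])
  have oB: "open ?B"
    by (rule continuous_open_preimage[OF cont_cinv open_cimg]) (use closed_cinv_image[OF i K] j in auto)
  have "C1_on ?A (\<lambda>y. rep i f (trans j i y))"
  proof (rule C1_on_compose[OF f])
    show "(trans j i has_derivative fd (trans j i) y) (at y)" if "y \<in> ?A" for y
      using that trans_has_derivative[OF j i] by auto
    show "continuous_on ?A (\<lambda>y. fd (trans j i) y v)" for v
      by (rule smooth_on_continuous[OF smooth_on_fd[OF smooth_trans[OF j i]]])
    show "trans j i ` ?A \<subseteq> cimg N i"
      using cinv_chart[OF j] chart_in by (auto simp: trans_def)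
  qed
  then have "C1_on ?A (rep j f)"
    by (rule C1_on_cong[OF oA]) (use cinv_chart i j in \<open>auto simp: trans_def\<close>)
  moreover have "C1_on ?B (rep j f)"
    by (rule C1_on_cong[OF oB C1_on_const[of _ 0]]) (auto simp: 0)
  moreover have "cimg N j \<subseteq> ?A \<union> ?B"
  proof
    fix y assume y: "y \<in> cimg N j"
    show "y \<in> ?A \<union> ?B"
    proof (cases "cinv N j y \<in> cinv N i ` K")
      case True
      then have "cinv N j y \<in> cdom N j \<inter> cdom N i" using K cinv_in y by auto
      then have "y \<in> ?A" using chart_cinv[OF y] by (metis image_eqI)
      then show ?thesis ..
    qed (use y in auto)
  qed
  ultimately show "C1_on (cimg N j) (rep j f)"
    using C1_on_Un[OF oA oB] C1_on_subset by blast
qed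

text \<open>
  The bump \<open>(max 0 (r\<^sup>2 - \<bar>y - c\<bar>\<^sup>2))\<^sup>2\<close> is continuously differentiable and supported in a compact ball of the chart.
\<close>

lemma bump_exists:
  "\<exists>b i. i \<in> idx N \<and> C1_fun b \<and> supported_in_chart i b \<and> (\<forall>q. b q \<ge> 0) \<and> b p > 0"
proof -
  obtain i where i: "i \<in> idx N" "p \<in> cdom N i" using cover by blast
  obtain r where r: "r > 0" "cball (chart N i p) r \<subseteq> cimg N i"
    using open_contains_cball[of "cimg N i"] open_cimg[OF i(1)] chart_in[OF i(2)] by blast
  let ?c = "chart N i p"
  define \<beta> where "\<beta> y = (max 0 (r\<^sup>2 - (y - ?c) \<bullet> (y - ?c)))\<^sup>2" for y
  define b where "b q = (if q \<in> cdom N i then \<beta> (chart N i q) else 0)" for q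
  have \<beta>0: "\<beta> y = 0" if "y \<notin> cball ?c r" for y
  proof -
    have "r < norm (y - ?c)" using that by (simp add: dist_norm norm_minus_commute)
    then have "r\<^sup>2 < (norm (y - ?c))\<^sup>2" using r by (intro power_strict_mono) auto
    then show ?thesis by (simp add: \<beta>_def dot_square_norm)
  qed
  have supp: "supported_in_chart i b"
    unfolding supported_in_chart_def
  proof (intro exI conjI allI impI)
    show "compact (cball ?c r)" "cball ?c r \<subseteq> cimg N i" using r by auto
    fix q assume "q \<notin> cinv N i ` cball ?c r"
    then show "b q = 0" using \<beta>0 cinv_chart[OF i(1)] by (force simp: b_def)
  qed
  have "C1_on (cimg N i) (rep i b)"
    by (rule C1_on_cong[OF open_cimg[OF i(1)] C1_on_subset[OF C1_bump[of r ?c]]])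
       (auto simp: b_def \<beta>_def cinv_in chart_cinv)
  then have "C1_fun b" by (rule C1_fun_local[OF i(1) _ supp])
  moreover have "b p > 0" using r i by (simp add: b_def \<beta>_def)
  moreover have "\<forall>q. b q \<ge> 0" by (simp add: b_def \<beta>_def)
  ultimately show ?thesis using supp i by blast
qed

lemma bump_cover:
  obtains J :: "'m set" and ci b where "finite J" "\<And>j. j \<in> J \<Longrightarrow> ci j \<in> idx N" "\<And>j. j \<in> J \<Longrightarrow> C1_fun (b j)"
    "\<And>j. j \<in> J \<Longrightarrow> supported_in_chart (ci j) (b j)" "\<And>j q. b j q \<ge> 0" "\<And>q. (\<Sum>j\<in>J. b j q) > 0"
proof -
  have "\<forall>p. \<exists>b i. i \<in> idx N \<and> C1_fun b \<and> supported_in_chart i b \<and> (\<forall>q. b q \<ge> 0) \<and> b p > 0"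
    using bump_exists by blast
  then obtain b where "\<forall>p. \<exists>i. i \<in> idx N \<and> C1_fun (b p) \<and> supported_in_chart i (b p) \<and> (\<forall>q. b p q \<ge> 0) \<and> b p p > 0"
    unfolding choice_iff by blast
  then obtain ci where "\<forall>p. ci p \<in> idx N \<and> C1_fun (b p) \<and> supported_in_chart (ci p) (b p) \<and> (\<forall>q. b p q \<ge> 0) \<and> b p p > 0"
    unfolding choice_iff by blast
  then have b: "ci p \<in> idx N" "C1_fun (b p)" "supported_in_chart (ci p) (b p)" "b p q \<ge> 0" "b p p > 0" for p q
    by simp_all
  have op: "open {q. b p q > 0}" for p
    by (rule open_Collect_less[OF continuous_on_const continuous_C1_fun[OF b(2)]])
  have "UNIV \<subseteq> (\<Union>p\<in>UNIV. {q. b p q > 0})" using b(5) by blast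
  from compactE_image[OF compact_M op this]
  obtain J where J: "finite J" "UNIV \<subseteq> (\<Union>p\<in>J. {q. b p q > 0})" by metis
  have "(\<Sum>j\<in>J. b j q) > 0" for q
  proof -
    obtain p where "p \<in> J" "b p q > 0" using J by blast
    then show ?thesis using b(4) J by (intro sum_pos2) auto
  qed
  then show ?thesis by (intro that[of J ci b] b J(1))
qed

subsection \<open>The gradient product\<close>

definition grad where "grad i u y = sharp (met N i y) (fd (rep i u) y)"

definition chart_at where "chart_at p = (SOME i. i \<in> idx N \<and> p \<in> cdom N i)"

lemma chart_at: "chart_at p \<in> idx N" "p \<in> cdom N (chart_at p)"
  using someI_ex[of "\<lambda>i. i \<in> idx N \<and> p \<in> cdom N i"] cover by (auto simp: chart_at_def)

text \<open>
  The product \<open>\<langle>\<nabla>f, \<nabla>u\<rangle>\<close>, computed in an arbitrarily chosen chart; \<open>gradprod_eq\<close> shows that every chart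
  gives the same value.
\<close>

definition gradprod :: "('m \<Rightarrow> real) \<Rightarrow> ('m \<Rightarrow> real) \<Rightarrow> 'm \<Rightarrow> real" where
  "gradprod f u p = (let i = chart_at p in fd (rep i f) (chart N i p) (grad i u (chart N i p)))"

lemma fd_rep_trans:
  assumes f: "C1_fun f" and ij: "i \<in> idx N" "j \<in> idx N" and p: "p \<in> cdom N i" "p \<in> cdom N j"
  shows "fd (rep i f) (chart N i p) v = fd (rep j f) (chart N j p) (fd (trans i j) (chart N i p) v)"
proof -
  have "fd (rep i f) (chart N i p) = fd (\<lambda>y. rep j f (trans i j y)) (chart N i p)"
    by (rule fd_cong[OF open_overlap[OF ij]]) (use p cinv_chart ij in \<open>auto simp: trans_def\<close>)
  moreover have "trans i j (chart N i p) = chart N j p"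
    using p cinv_chart[OF ij(1)] by (simp add: trans_def)
  then have "((\<lambda>y. rep j f (trans i j y)) has_derivative
      (\<lambda>v. fd (rep j f) (chart N j p) (fd (trans i j) (chart N i p) v))) (at (chart N i p))"
    using has_derivative_compose[OF trans_has_derivative[OF ij p], of "rep j f" "fd (rep j f) (chart N j p)"]
      C1_onD(1)[OF C1_funD[OF f ij(2)] chart_in[OF p(2)]] by simp
  ultimately show ?thesis using fd_eq by metis
qed

text \<open>
  The transition map sends the gradient in one chart to the gradient in the other.
\<close>

lemma gradprod_eq:
  assumes f: "C1_fun f" and u: "C1_fun u" and i: "i \<in> idx N" and p: "p \<in> cdom N i"
  shows "gradprod f u p = fd (rep i f) (chart N i p) (grad i u (chart N i p))"
proof -
  let ?j = "chart_at p"
  note j = chart_at[of p]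
  let ?T = "fd (trans i ?j) (chart N i p)"
  have pi: "pd_form (met N i (chart N i p))" and pj: "pd_form (met N ?j (chart N ?j p))"
    using pd_met i p j chart_in by auto
  have li: "linear (fd (rep i u) (chart N i p))" and lj: "linear (fd (rep ?j u) (chart N ?j p))"
    using C1_onD(4)[OF C1_funD[OF u]] i p j chart_in by auto
  have "?T (grad i u (chart N i p)) = grad ?j u (chart N ?j p)"
  proof (rule pd_form_unique[OF pj])
    fix z
    obtain x where x: "z = ?T x" using fd_trans_surj[OF i j(1) p j(2)] by (metis surjD)
    have "met N ?j (chart N ?j p) (?T (grad i u (chart N i p))) z = met N i (chart N i p) (grad i u (chart N i p)) x"
      unfolding met_trans[OF i j(1) p j(2)] x ..
    also have "\<dots> = fd (rep i u) (chart N i p) x" unfolding grad_def by (rule sharp_eq[OF pi li])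
    also have "\<dots> = fd (rep ?j u) (chart N ?j p) z" unfolding x by (rule fd_rep_trans[OF u i j(1) p j(2)])
    also have "\<dots> = met N ?j (chart N ?j p) (grad ?j u (chart N ?j p)) z"
      unfolding grad_def by (rule sharp_eq[OF pj lj, symmetric])
    finally show "met N ?j (chart N ?j p) (?T (grad i u (chart N i p))) z
      = met N ?j (chart N ?j p) (grad ?j u (chart N ?j p)) z" .
  qed
  then show ?thesis
    using fd_rep_trans[OF f i j(1) p j(2), of "grad i u (chart N i p)"] by (simp add: gradprod_def Let_def)
qed

lemma gradprod_cinv:
  assumes "C1_fun f" "C1_fun u" "i \<in> idx N" "y \<in> cimg N i"
  shows "gradprod f u (cinv N i y) = fd (rep i f) y (grad i u y)"
  using gradprod_eq[OF assms(1-3) cinv_in[OF assms(4)]] chart_cinv[OF assms(4)] by simp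

lemma gradprod_sum:
  assumes J: "finite J" and f: "\<And>j. j \<in> J \<Longrightarrow> C1_fun (f j)"
  shows "gradprod (\<lambda>p. \<Sum>j\<in>J. f j p) u p = (\<Sum>j\<in>J. gradprod (f j) u p)"
proof -
  let ?i = "chart_at p"
  have "((\<lambda>y. \<Sum>j\<in>J. rep ?i (f j) y) has_derivative (\<lambda>v. \<Sum>j\<in>J. fd (rep ?i (f j)) (chart N ?i p) v)) (at (chart N ?i p))"
    using f chart_in[OF chart_at(2)] by (intro has_derivative_sum C1_onD(1)[OF C1_funD[OF _ chart_at(1)]]) auto
  from fd_eq[OF this] show ?thesis by (simp add: gradprod_def Let_def)
qed

lemma gradprod_compose:
  assumes u: "C1_fun u" and h: "(h has_real_derivative h') (at (u p))"
  shows "gradprod (\<lambda>p. h (u p)) u p = h' * gradprod u u p"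
proof -
  let ?i = "chart_at p"
  have up: "rep ?i u (chart N ?i p) = u p" using cinv_chart[OF chart_at] by simp
  have h': "(h has_derivative (*) h') (at (rep ?i u (chart N ?i p)))"
    unfolding up using h unfolding has_field_derivative_def .
  have "((\<lambda>y. h (rep ?i u y)) has_derivative (\<lambda>v. h' * fd (rep ?i u) (chart N ?i p) v)) (at (chart N ?i p))"
    by (rule has_derivative_compose[OF C1_onD(1)[OF C1_funD[OF u chart_at(1)] chart_in[OF chart_at(2)]] h'])
  from fd_eq[OF this] show ?thesis by (simp add: gradprod_def Let_def)
qed

lemma gradprod_nonneg:
  assumes u: "C1_fun u" shows "gradprod u u p \<ge> 0"
proof -
  let ?i = "chart_at p" let ?y = "chart N ?i p"
  have y: "?y \<in> cimg N ?i" by (rule chart_in[OF chart_at(2)])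
  have "gradprod u u p = met N ?i ?y (grad ?i u ?y) (grad ?i u ?y)"
    unfolding gradprod_def Let_def
    using sharp_eq[OF pd_met[OF chart_at(1) y] C1_onD(4)[OF C1_funD[OF u chart_at(1)] y]]
    by (simp add: grad_def)
  then show ?thesis using pd_formD(4)[OF pd_met[OF chart_at(1) y]] by simp
qed

lemma gradprod_outside:
  assumes f: "C1_fun f" and i: "i \<in> idx N" and supp: "supported_in_chart i f" and p: "p \<notin> cdom N i"
  shows "gradprod f u p = 0"
proof -
  let ?j = "chart_at p"
  note j = chart_at[of p]
  obtain K where K: "compact K" "K \<subseteq> cimg N i" and 0: "\<And>p. p \<notin> cinv N i ` K \<Longrightarrow> f p = 0"
    using supp by (auto simp: supported_in_chart_def)
  have "p \<notin> cinv N i ` K" using p K cinv_in by auto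
  moreover have "open (cimg N ?j \<inter> cinv N ?j -` (- cinv N i ` K))"
    by (rule continuous_open_preimage[OF cont_cinv open_cimg]) (use closed_cinv_image[OF i K] j in auto)
  ultimately have "fd (rep ?j f) (chart N ?j p) = fd (\<lambda>_. 0) (chart N ?j p)"
    using j chart_in cinv_chart 0
    by (intro fd_cong[of "cimg N ?j \<inter> cinv N ?j -` (- cinv N i ` K)"]) auto
  then show ?thesis by (simp add: gradprod_def Let_def frechet_derivative_const)
qed

subsection \<open>Integrals of continuous functions\<close>

text \<open>
  Every point has a neighbourhood of finite measure, and finitely many of them cover the compact manifold.
\<close>

lemma finite_mu: "finite_measure \<mu>"
proof -
  have "\<exists>Op. open Op \<and> p \<in> Op \<and> emeasure \<mu> Op < \<infinity>" for p
  proof -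
    obtain i where i: "i \<in> idx N" "p \<in> cdom N i" using cover by blast
    obtain r where r: "r > 0" "cball (chart N i p) r \<subseteq> cimg N i"
      using open_contains_cball[of "cimg N i"] open_cimg[OF i(1)] chart_in[OF i(2)] by blast
    define Op where "Op = cdom N i \<inter> chart N i -` ball (chart N i p) r"
    have Op: "open Op" unfolding Op_def
      by (rule continuous_open_preimage[OF cont_chart open_cdom]) (use i in auto)
    have "compact (dens i ` cball (chart N i p) r)"
      using compact_continuous_image[OF continuous_on_subset[OF cont_dens[OF i(1)] r(2)]] by simp
    then obtain B where B: "\<And>y. y \<in> cball (chart N i p) r \<Longrightarrow> \<bar>dens i y\<bar> \<le> B"
      using compact_imp_bounded by (fastforce simp: bounded_iff)
    have "emeasure \<mu> Op = emeasure (chart_measure i) Op"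
      using Op by (intro emeasure_mu[OF i(1)]) (auto simp: Op_def)
    also have "\<dots> = (\<integral>\<^sup>+y. indicator (chart N i ` (Op \<inter> cdom N i)) y * ennreal (dens i y) \<partial>lborel)"
      using Op by (intro emeasure_chart_measure[OF i(1)]) auto
    also have "\<dots> \<le> (\<integral>\<^sup>+y. ennreal B * indicator (cball (chart N i p) r) y \<partial>lborel)"
    proof (rule nn_integral_mono)
      fix y
      show "indicator (chart N i ` (Op \<inter> cdom N i)) y * ennreal (dens i y) \<le> ennreal B * indicator (cball (chart N i p) r) y"
        using B[of y] by (auto simp: Op_def indicator_def intro!: ennreal_leI)
    qed
    also have "\<dots> = ennreal B * emeasure lborel (cball (chart N i p) r)"
      by (simp add: nn_integral_cmult_indicator)
    also have "\<dots> < \<infinity>" using emeasure_lborel_cball_finite[of "chart N i p" r] by (simp add: ennreal_mult_less_top)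
    finally show ?thesis using Op i r by (intro exI[of _ Op]) (auto simp: Op_def)
  qed
  then obtain Op where Op: "\<And>p. open (Op p)" "\<And>p. p \<in> Op p" "\<And>p. emeasure \<mu> (Op p) < \<infinity>" by metis
  have "UNIV \<subseteq> (\<Union>p\<in>UNIV. Op p)" using Op(2) by blast
  from compactE_image[OF compact_M Op(1) this]
  obtain J where J: "finite J" "UNIV \<subseteq> (\<Union>p\<in>J. Op p)" by metis
  have "emeasure \<mu> (\<Union>p\<in>J. Op p) \<le> (\<Sum>p\<in>J. emeasure \<mu> (Op p))"
    using J Op by (intro emeasure_subadditive_finite) auto
  also have "\<dots> < \<infinity>" using J Op by (simp add: less_top)
  finally show ?thesis using J by (intro finite_measureI) (auto simp: top.extremum_unique)
qed

lemma integrable_continuous: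
  fixes f :: "'m \<Rightarrow> real"
  assumes "continuous_on UNIV f"
  shows "integrable \<mu> f"
proof -
  obtain B where B: "\<And>p. \<bar>f p\<bar> \<le> B"
    using compact_imp_bounded[OF compact_continuous_image[OF assms compact_M]] by (auto simp: bounded_iff)
  have "f \<in> borel_measurable \<mu>"
    using borel_measurable_continuous_onI[OF assms] by (simp add: measurable_cong_sets[OF sets_mu refl])
  then show ?thesis
    by (rule finite_measure.integrable_const_bound[OF finite_mu, of _ B, rotated]) (use B in auto)
qed

lemma continuous_zero:
  fixes f :: "'m \<Rightarrow> real"
  assumes f: "continuous_on UNIV f" and nn: "\<And>p. f p \<ge> 0" and 0: "(\<integral>p. f p \<partial>\<mu>) = 0"
  shows "f p = 0"
proof -
  obtain i where i: "i \<in> idx N" "p \<in> cdom N i" using cover by blast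
  have m: "f \<in> borel_measurable borel" by (rule borel_measurable_continuous_onI[OF f])
  have ae: "AE p in \<mu>. f p = 0"
    using integral_nonneg_eq_0_iff_AE[OF integrable_continuous[OF f]] nn 0 by auto
  have "(\<integral>\<^sup>+p. indicator (cdom N i) p * ennreal (f p) \<partial>\<mu>) = (\<integral>\<^sup>+p. 0 \<partial>\<mu>)"
    by (rule nn_integral_cong_AE) (use ae in eventually_elim, auto)
  then have "(\<integral>\<^sup>+y. indicator (cimg N i) y * (ennreal (dens i y) * ennreal (f (cinv N i y))) \<partial>lborel) = 0"
    using nn_integral_chart[OF i(1), of "\<lambda>p. ennreal (f p)"] m by simp
  moreover have e: "indicator (cimg N i) y * (ennreal (dens i y) * ennreal (f (cinv N i y)))
      = ennreal (indicator (cimg N i) y * (dens i y * f (cinv N i y)))" for y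
    using dens_pos[OF i(1), of y] nn by (auto simp: indicator_def ennreal_mult less_imp_le)
  have cf: "continuous_on (cimg N i) (\<lambda>y. f (cinv N i y))"
    by (rule continuous_on_compose2[OF f cont_cinv[OF i(1)]]) auto
  have "(\<lambda>y. indicator (cimg N i) y * (dens i y * f (cinv N i y))) \<in> borel_measurable borel"
    by (intro measurable_on_chart[OF i(1)] continuous_intros cont_dens[OF i(1)] cf)
  ultimately have "AE y in lborel. ennreal (indicator (cimg N i) y * (dens i y * f (cinv N i y))) = 0"
    unfolding e by (subst (asm) nn_integral_0_iff_AE) auto
  then have "AE y in lborel. y \<in> cimg N i \<longrightarrow> f (cinv N i y) = 0"
  proof eventually_elim
    case (elim y)
    show ?case
    proof
      assume y: "y \<in> cimg N i"
      then have "dens i y * f (cinv N i y) \<le> 0" using elim by (simp add: ennreal_eq_0_iff)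
      then show "f (cinv N i y) = 0" using dens_pos[OF i(1) y] nn[of "cinv N i y"]
        by (simp add: mult_le_0_iff)
    qed
  qed
  from open_AE_zero[OF open_cimg[OF i(1)] cf this chart_in[OF i(2)]] show ?thesis
    using cinv_chart[OF i] by simp
qed

end

section \<open>Mean convexity in weak form\<close>

context closed_manifold
begin

lemma integrable_chart:
  fixes f :: "'m \<Rightarrow> real"
  assumes i: "i \<in> idx N" and f: "continuous_on UNIV f"
  shows "set_integrable lborel (cimg N i) (\<lambda>y. dens i y * f (cinv N i y))"
proof -
  have fm: "f \<in> borel_measurable borel" by (rule borel_measurable_continuous_onI[OF f])
  have c: "cdom N i \<in> sets borel" using open_cdom[OF i] by simp
  have m: "(\<lambda>y. indicator (cimg N i) y * dens i y) \<in> borel_measurable borel"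
    by (rule measurable_on_chart[OF i cont_dens[OF i]])
  have nn: "AE y in lborel. 0 \<le> indicator (cimg N i) y * dens i y"
    using dens_pos[OF i] by (auto simp: indicator_def intro: less_imp_le)
  have "integrable \<mu> (\<lambda>p. indicator (cdom N i) p * f p)"
    using integrable_real_mult_indicator[OF _ integrable_continuous[OF f], of "cdom N i"] c by (simp add: mult.commute)
  then have "integrable (density \<mu> (\<lambda>p. ennreal (indicator (cdom N i) p))) f"
    using c fm by (subst integrable_real_density) (auto simp: measurable_cong_sets[OF sets_mu refl])
  then have "integrable lborel (\<lambda>y. (indicator (cimg N i) y * dens i y) * f (cinvx i y))"
    unfolding ennreal_indicator density_chart[OF i] chart_measure_def using fm i m nn
    by (simp add: integrable_distr_eq integrable_real_density)
  also have "(\<lambda>y. (indicator (cimg N i) y * dens i y) * f (cinvx i y))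
    = (\<lambda>y. indicator (cimg N i) y *\<^sub>R (dens i y * f (cinv N i y)))"
    by (auto simp: indicator_def cinvx_def)
  finally show ?thesis unfolding set_integrable_def .
qed

end

locale star_graph = closed_manifold N
  for N :: "('i, 'm::t2_space, 'e::euclidean_space) riem" +
  fixes u :: "'m \<Rightarrow> real" and lam :: "real \<Rightarrow> real" and a :: real
  assumes star: "star_shaped a N u"
    and smooth_lam: "smooth_on {a<..} lam"
    and lam_pos: "\<And>r. r > a \<Longrightarrow> lam r > 0"
begin

lemma u_gt: "u p > a" using star by (simp add: star_shaped_def)

lemma chart_locale: "i \<in> idx N \<Longrightarrow> warped_graph_chart N i u (rep i u) lam a"
proof (unfold_locales)
  assume i: "i \<in> idx N"
  show "open (cimg N i)" by (rule open_cimg[OF i])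
  show "pd_form (met N i y)" if "y \<in> cimg N i" for y by (rule pd_met[OF i that])
  show "smooth_on (cimg N i) (\<lambda>y. met N i y v w)" for v w by (rule smooth_met[OF i])
  show "smooth_on (cimg N i) (rep i u)"
    using star i by (simp add: star_shaped_def smooth_fun_def o_def)
qed (use u_gt smooth_lam lam_pos in auto)

lemmas lam_deriv = smooth_on_real_deriv[OF open_greaterThan smooth_lam, unfolded greaterThan_iff]

lemma C1_u: "C1_fun u"
  unfolding C1_fun_def
proof
  fix i assume i: "i \<in> idx N"
  interpret c: warped_graph_chart N i u "rep i u" lam a by (rule chart_locale[OF i])
  show "C1_on (cimg N i) (rep i u)" by (rule c.C1_U)
qed

definition "W p = sqrt ((lam (u p))\<^sup>2 + gradprod u u p)"

lemma W_sq: "(W p)\<^sup>2 = (lam (u p))\<^sup>2 + gradprod u u p"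
  unfolding W_def using gradprod_nonneg[OF C1_u, of p] by simp

lemma W_ge: "W p \<ge> lam (u p)" "W p > 0"
proof -
  show 1: "W p \<ge> lam (u p)"
    unfolding W_def using gradprod_nonneg[OF C1_u, of p] by (intro real_le_rsqrt) simp
  show "W p > 0" using 1 lam_pos[OF u_gt[of p]] by simp
qed

text \<open>
  By the divergence theorem its integral equals that of \<open>\<eta> \<lambda> H\<close>, with \<open>H\<close> the mean curvature of the
  graph, but it contains no second derivatives of \<open>u\<close>.
\<close>

definition "weak_curvature \<eta> p =
  (gradprod \<eta> u p + real DIM('e) * lam (u p) * deriv lam (u p) * \<eta> p) / W p"

lemma chart_quantities:
  assumes i: "i \<in> idx N" and y: "y \<in> cimg N i"
  shows "graph_chart.G (met N i) (rep i u) y = grad i u y"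
    "graph_chart.q (met N i) (rep i u) y = gradprod u u (cinv N i y)"
    "graph_chart.W (met N i) (rep i u) lam y = W (cinv N i y)"
    "graph_chart.\<rho> (met N i) y = dens i y"
proof -
  interpret c: warped_graph_chart N i u "rep i u" lam a by (rule chart_locale[OF i])
  show G: "c.G y = grad i u y" by (simp add: c.G_def grad_def)
  show q: "c.q y = gradprod u u (cinv N i y)"
    unfolding c.q_def G gradprod_cinv[OF C1_u C1_u i y] ..
  show "c.W y = W (cinv N i y)" unfolding c.W_def q W_def ..
  show "c.\<rho> y = dens i y" by (simp add: c.\<rho>_def dens_def)
qed

lemma continuous_gradprod: "C1_fun \<eta> \<Longrightarrow> continuous_on UNIV (gradprod \<eta> u)"
proof (rule continuous_from_charts)
  fix i assume eta: "C1_fun \<eta>" and i: "i \<in> idx N"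
  interpret c: warped_graph_chart N i u "rep i u" lam a by (rule chart_locale[OF i])
  note D = C1_funD[OF eta i]
  have "continuous_on (cimg N i) (\<lambda>y. \<Sum>b\<in>Basis. (c.G y \<bullet> b) * fd (rep i \<eta>) y b)"
    by (intro continuous_intros C1_onD(3)[OF D] C1_on_continuous[OF c.C1_G])
  then show "continuous_on (cimg N i) (rep i (gradprod \<eta> u))"
  proof (rule continuous_on_eq)
    fix y assume y: "y \<in> cimg N i"
    show "(\<Sum>b\<in>Basis. (c.G y \<bullet> b) * fd (rep i \<eta>) y b) = gradprod \<eta> u (cinv N i y)"
      unfolding gradprod_cinv[OF eta C1_u i y] chart_quantities(1)[OF i y]
      by (rule linear_functional_sum[OF C1_onD(4)[OF D y], symmetric])
  qed
qed

lemma continuous_u: "continuous_on UNIV u" by (rule continuous_C1_fun[OF C1_u])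

lemma continuous_compose_u: "continuous_on {a<..} h \<Longrightarrow> continuous_on UNIV (\<lambda>p. h (u p))"
  by (rule continuous_on_compose2[OF _ continuous_u]) (auto simp: u_gt)

lemma continuous_lam: "continuous_on {a<..} lam" by (rule smooth_on_continuous[OF smooth_lam])

lemma continuous_W: "continuous_on UNIV W"
  unfolding W_def[abs_def] by (intro continuous_intros continuous_compose_u continuous_lam continuous_gradprod C1_u)

lemma continuous_weak_curvature: "C1_fun \<eta> \<Longrightarrow> continuous_on UNIV (weak_curvature \<eta>)"
  unfolding weak_curvature_def[abs_def] using W_ge(2)
  by (intro continuous_intros continuous_compose_u continuous_lam lam_deriv(2) continuous_gradprod
      continuous_W continuous_C1_fun) (auto simp: less_imp_neq[symmetric])

text \<open>
  The field \<open>\<eta> \<nabla>u / W\<close> has compact support in the chart, so its divergence integrates to zero, and what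
  remains is the integral of \<open>\<eta> \<lambda> H\<close> over the chart. There \<open>\<lambda> H\<close> is positive.
\<close>

lemma weak_curvature_local:
  assumes i: "i \<in> idx N" and eta: "C1_fun \<eta>" and supp: "supported_in_chart i \<eta>" and nn: "\<And>p. \<eta> p \<ge> 0"
    and H: "mean_convex a lam N u"
  shows "(\<integral>p. weak_curvature \<eta> p \<partial>\<mu>) \<ge> 0"
    "(\<integral>p. weak_curvature \<eta> p \<partial>\<mu>) = 0 \<Longrightarrow> \<eta> p = 0"
proof -
  interpret c: warped_graph_chart N i u "rep i u" lam a by (rule chart_locale[OF i])
  define h where "h y = lam (rep i u y) * mean_curvature N (warped_product a lam N) (graph_map u) (1, 0) i y" for y
  have hpos: "h y > 0" if "y \<in> cimg N i" for y
    using H i that c.L_pos[OF that] by (simp add: mean_convex_def h_def)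
  obtain K where K: "compact K" "K \<subseteq> cimg N i" and 0: "\<And>p. p \<notin> cinv N i ` K \<Longrightarrow> \<eta> p = 0"
    using supp by (auto simp: supported_in_chart_def)
  have eta0: "\<eta> (cinv N i y) = 0" if "y \<in> cimg N i - K" for y
  proof (rule 0)
    show "cinv N i y \<notin> cinv N i ` K"
    proof
      assume "cinv N i y \<in> cinv N i ` K"
      then obtain x where "x \<in> K" "cinv N i y = cinv N i x" by blast
      then show False using chart_cinv that K(2) by (metis DiffD1 DiffD2 subsetD)
    qed
  qed
  define Y where "Y y = (c.\<rho> y * rep i \<eta> y / c.W y) *\<^sub>R c.G y" for y
  define D where "D y = (\<Sum>b\<in>Basis. fd (\<lambda>y. Y y \<bullet> b) y b)" for y
  have C1_Y: "C1_on (cimg N i) (\<lambda>y. Y y \<bullet> b)" if "b \<in> Basis" for b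
    unfolding Y_def inner_scaleR_left using c.W_pos
    by (intro C1_on_mult C1_on_divide c.C1_rho C1_funD[OF eta i] c.C1_W c.C1_G that) (auto simp: less_imp_neq[symmetric])
  have Y0: "Y y = 0" if "y \<in> cimg N i - K" for y using eta0[OF that] by (simp add: Y_def)
  have div: "set_integrable lborel (cimg N i) D" "(LINT y:cimg N i|lborel. D y) = 0"
    unfolding D_def[abs_def] by (rule integral_divergence[OF open_cimg[OF i] C1_Y K Y0]; assumption)+
  have D: "D y = dens i y * weak_curvature \<eta> (cinv N i y) - dens i y * (\<eta> (cinv N i y) * h y)" if y: "y \<in> cimg N i" for y
  proof -
    note W = c.W_pos[OF y]
    have "D y = c.\<rho> y / c.W y * fd (rep i \<eta>) y (c.G y)
      + c.\<rho> y * rep i \<eta> y / c.W y * (metric_trace (met N i y) (c.Hess y)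
          - (c.L y * c.L' y * c.q y + c.Hess y (c.G y) (c.G y)) / (c.W y)\<^sup>2)"
      unfolding D_def Y_def by (rule c.divergence_formula[OF y C1_funD[OF eta i]])
    moreover have "h y = (real DIM('e) * c.L y * c.L' y - metric_trace (met N i y) (c.Hess y)
       + (c.L y * c.L' y * c.q y + c.Hess y (c.G y) (c.G y)) / (c.W y)\<^sup>2) / c.W y"
      unfolding h_def by (rule c.mean_curvature_graph[OF y])
    then have "metric_trace (met N i y) (c.Hess y) - (c.L y * c.L' y * c.q y + c.Hess y (c.G y) (c.G y)) / (c.W y)\<^sup>2
       = real DIM('e) * c.L y * c.L' y - c.W y * h y"
      using W by simp
    ultimately have "D y = c.\<rho> y / c.W y * fd (rep i \<eta>) y (c.G y)
      + c.\<rho> y * rep i \<eta> y / c.W y * (real DIM('e) * c.L y * c.L' y - c.W y * h y)"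
      by simp
    also have "\<dots> = c.\<rho> y * ((fd (rep i \<eta>) y (c.G y) + real DIM('e) * c.L y * c.L' y * rep i \<eta> y) / c.W y)
      - c.\<rho> y * (rep i \<eta> y * h y)"
      using W by (simp add: field_simps)
    finally show ?thesis
      unfolding chart_quantities[OF i y] weak_curvature_def gradprod_cinv[OF eta C1_u i y] .
  qed
  have int1: "set_integrable lborel (cimg N i) (\<lambda>y. dens i y * weak_curvature \<eta> (cinv N i y))"
    by (rule integrable_chart[OF i continuous_weak_curvature[OF eta]])
  have e: "indicator (cimg N i) y *\<^sub>R (dens i y * (\<eta> (cinv N i y) * h y)) =
      indicator (cimg N i) y *\<^sub>R (dens i y * weak_curvature \<eta> (cinv N i y)) - indicator (cimg N i) y *\<^sub>R D y" for y
    using D[of y] by (auto simp: indicator_def)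
  have int2: "integrable lborel (\<lambda>y. indicator (cimg N i) y *\<^sub>R (dens i y * (\<eta> (cinv N i y) * h y)))"
    unfolding e using int1 div(1) unfolding set_integrable_def by (rule Bochner_Integration.integrable_diff)
  have "(LINT y:cimg N i|lborel. dens i y * (\<eta> (cinv N i y) * h y))
     = (LINT y:cimg N i|lborel. dens i y * weak_curvature \<eta> (cinv N i y)) - (LINT y:cimg N i|lborel. D y)"
    unfolding set_lebesgue_integral_def e
    using int1 div(1) unfolding set_integrable_def by (rule Bochner_Integration.integral_diff)
  also have "\<dots> = (\<integral>p. indicator (cdom N i) p * weak_curvature \<eta> p \<partial>\<mu>)"
    using integral_chart[OF i borel_measurable_continuous_onI[OF continuous_weak_curvature[OF eta]]] div(2) by simp
  also have "(\<lambda>p. indicator (cdom N i) p * weak_curvature \<eta> p) = weak_curvature \<eta>"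
  proof
    fix p show "indicator (cdom N i) p * weak_curvature \<eta> p = weak_curvature \<eta> p"
    proof (cases "p \<in> cdom N i")
      case False
      then have "p \<notin> cinv N i ` K" using K cinv_in by auto
      then show ?thesis using 0 gradprod_outside[OF eta i supp False] False by (simp add: weak_curvature_def)
    qed simp
  qed
  finally have main: "(\<integral>p. weak_curvature \<eta> p \<partial>\<mu>)
     = (\<integral>y. indicator (cimg N i) y *\<^sub>R (dens i y * (\<eta> (cinv N i y) * h y)) \<partial>lborel)"
    by (simp add: set_lebesgue_integral_def)
  have nonneg: "indicator (cimg N i) y *\<^sub>R (dens i y * (\<eta> (cinv N i y) * h y)) \<ge> 0" for y
  proof (cases "y \<in> cimg N i")
    case True
    then show ?thesis using mult_nonneg_nonneg[OF less_imp_le[OF dens_pos[OF i True]]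
        mult_nonneg_nonneg[OF nn[of "cinv N i y"] less_imp_le[OF hpos[OF True]]]] by simp
  qed simp
  show "(\<integral>p. weak_curvature \<eta> p \<partial>\<mu>) \<ge> 0"
    unfolding main using nonneg by (intro integral_nonneg_AE) auto
  assume "(\<integral>p. weak_curvature \<eta> p \<partial>\<mu>) = 0"
  then have "AE y in lborel. indicator (cimg N i) y *\<^sub>R (dens i y * (\<eta> (cinv N i y) * h y)) = 0"
    unfolding main using integral_nonneg_eq_0_iff_AE[OF int2] nonneg by auto
  then have ae: "AE y in lborel. y \<in> cimg N i \<longrightarrow> \<eta> (cinv N i y) = 0"
    by eventually_elim (use dens_pos[OF i] hpos in \<open>force simp: indicator_def\<close>)
  show "\<eta> p = 0"
  proof (cases "p \<in> cdom N i")
    case True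
    have "\<eta> (cinv N i (chart N i p)) = 0"
      by (rule open_AE_zero[OF open_cimg[OF i] C1_on_continuous[OF C1_funD[OF eta i]] ae chart_in[OF True]])
    then show ?thesis by (simp add: cinv_chart[OF i True])
  next
    case False
    then have "p \<notin> cinv N i ` K" using K cinv_in by auto
    then show ?thesis by (rule 0)
  qed
qed

text \<open>
  The test function is cut into pieces \<open>\<eta> b\<^sub>j / \<Sigma> b\<close> supported in charts. The gradients of the cut-off
  functions cancel because \<open>\<langle>\<nabla>\<eta>, \<nabla>u\<rangle>\<close> is additive in \<open>\<eta>\<close> and independent of the chart.
\<close>

lemma weak_curvature_nonneg:
  assumes eta: "C1_fun \<eta>" and nn: "\<And>p. \<eta> p \<ge> 0" and H: "mean_convex a lam N u"
  shows "(\<integral>p. weak_curvature \<eta> p \<partial>\<mu>) \<ge> 0"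
    "(\<integral>p. weak_curvature \<eta> p \<partial>\<mu>) = 0 \<Longrightarrow> \<eta> p = 0"
proof -
  obtain J :: "'m set" and b :: "'m \<Rightarrow> 'm \<Rightarrow> real" and ci where J: "finite J" and b: "\<And>j. j \<in> J \<Longrightarrow> ci j \<in> idx N" "\<And>j. j \<in> J \<Longrightarrow> C1_fun (b j)"
    "\<And>j. j \<in> J \<Longrightarrow> supported_in_chart (ci j) (b j)" "\<And>j q. b j q \<ge> 0" "\<And>q. (\<Sum>j\<in>J. b j q) > 0"
  proof (rule bump_cover, goal_cases)
    case 1
    show thesis by (rule 1(1)) (fact 1)+
  qed
  define B where "B q = (\<Sum>j\<in>J. b j q)" for q
  define e where "e j q = \<eta> q * b j q / B q" for j q
  have B: "B q \<noteq> 0" for q using b(5)[of q] by (simp add: B_def)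
  have C1_B: "C1_fun B" unfolding B_def by (rule C1_fun_sum[OF J b(2)])
  have C1_e: "C1_fun (e j)" if "j \<in> J" for j
    unfolding e_def by (intro C1_fun_divide C1_fun_mult eta b(2) C1_B B that)
  have supp_e: "supported_in_chart (ci j) (e j)" if j: "j \<in> J" for j
  proof -
    obtain K where "compact K" "K \<subseteq> cimg N (ci j)" "\<And>p. p \<notin> cinv N (ci j) ` K \<Longrightarrow> b j p = 0"
      using b(3)[OF j] unfolding supported_in_chart_def by blast
    then show ?thesis unfolding supported_in_chart_def by (intro exI[of _ K]) (simp add: e_def)
  qed
  have nn_e: "e j q \<ge> 0" for j q
    unfolding e_def using nn b(4,5) by (auto simp: B_def intro!: divide_nonneg_pos mult_nonneg_nonneg)
  have sum_e: "(\<Sum>j\<in>J. e j q) = \<eta> q" for q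
    unfolding e_def sum_divide_distrib[symmetric] sum_distrib_left[symmetric] B_def[symmetric] using B by simp
  have "weak_curvature \<eta> q = (\<Sum>j\<in>J. weak_curvature (e j) q)" for q
  proof -
    have "gradprod \<eta> u q = (\<Sum>j\<in>J. gradprod (e j) u q)"
      using gradprod_sum[where f = e and u = u and p = q, OF J C1_e] by (simp add: sum_e)
    then show ?thesis
      by (simp add: weak_curvature_def sum_divide_distrib[symmetric] sum.distrib sum_distrib_left[symmetric] sum_e)
  qed
  then have main: "(\<integral>p. weak_curvature \<eta> p \<partial>\<mu>) = (\<Sum>j\<in>J. \<integral>p. weak_curvature (e j) p \<partial>\<mu>)"
    using C1_e by (simp add: integrable_continuous continuous_weak_curvature)
  note loc = weak_curvature_local[OF b(1) C1_e supp_e nn_e H]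
  show "(\<integral>p. weak_curvature \<eta> p \<partial>\<mu>) \<ge> 0" unfolding main using loc(1) by (intro sum_nonneg) auto
  assume "(\<integral>p. weak_curvature \<eta> p \<partial>\<mu>) = 0"
  then have "(\<integral>p. weak_curvature (e j) p \<partial>\<mu>) = 0" if "j \<in> J" for j
    using main sum_nonneg_eq_0_iff[OF J, of "\<lambda>j. \<integral>p. weak_curvature (e j) p \<partial>\<mu>"] loc(1) that by auto
  then have "e j p = 0" if "j \<in> J" for j using loc(2) that by blast
  then show "\<eta> p = 0" using sum_e[of p] by simp
qed

end

section \<open>Area and volume elements\<close>

text \<open>
  Here only the real line is known to be second countable. An open set of the product is still a countable
  union of open rectangles: for each set of a countable base of the real line take the largest open
  set whose product with it is contained in the given one.
\<close>

lemma sets_borel_real_pair: "sets (borel \<Otimes>\<^sub>M borel) = sets (borel :: (real \<times> 'm::topological_space) measure)"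
proof
  have "(\<lambda>x :: real \<times> 'm. (fst x, snd x)) \<in> measurable borel (borel \<Otimes>\<^sub>M borel)"
    by (intro measurable_Pair borel_measurable_continuous_onI continuous_intros)
  then have m: "(\<lambda>x :: real \<times> 'm. x) \<in> measurable borel (borel \<Otimes>\<^sub>M borel)"
    by (simp only: prod.collapse)
  show "sets (borel \<Otimes>\<^sub>M borel) \<subseteq> sets (borel :: (real \<times> 'm) measure)"
  proof
    fix A :: "(real \<times> 'm) set" assume "A \<in> sets (borel \<Otimes>\<^sub>M borel)"
    from measurable_sets[OF m this] show "A \<in> sets borel" by simp
  qed
  obtain \<B> :: "real set set" where B: "countable \<B>" "topological_basis \<B>"
    using ex_countable_basis by blast
  have "X \<in> sets (borel \<Otimes>\<^sub>M borel)" if X: "open X" for X :: "(real \<times> 'm) set"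
  proof -
    define V where "V b = \<Union>{T. open T \<and> b \<times> T \<subseteq> X}" for b
    have "X = (\<Union>b\<in>\<B>. b \<times> V b)"
    proof
      show "X \<subseteq> (\<Union>b\<in>\<B>. b \<times> V b)"
      proof
        fix z assume z: "z \<in> X"
        then obtain S T where ST: "open S" "open T" "z \<in> S \<times> T" "S \<times> T \<subseteq> X"
          using open_prod_elim[OF X z] by blast
        then have "fst z \<in> S" by auto
        then obtain b where b: "b \<in> \<B>" "fst z \<in> b" "b \<subseteq> S"
          using topological_basisE[OF B(2) ST(1)] by blast
        then have "snd z \<in> V b" using ST unfolding V_def by (intro UnionI[of T]) auto
        then show "z \<in> (\<Union>b\<in>\<B>. b \<times> V b)" using b by (intro UN_I[of b]) (auto simp: mem_Times_iff)
      qed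
    qed (auto simp: V_def)
    moreover have "b \<times> V b \<in> sets (borel \<Otimes>\<^sub>M borel)" if "b \<in> \<B>" for b
      using topological_basis_open[OF B(2) that] by (intro pair_measureI borel_open) (auto simp: V_def)
    then have "(\<Union>b\<in>\<B>. b \<times> V b) \<in> sets (borel \<Otimes>\<^sub>M borel)"
      by (intro sets.countable_UN'[OF B(1)]) auto
    ultimately show ?thesis by (simp only:)
  qed
  then have "sigma_sets (space (borel \<Otimes>\<^sub>M borel)) {X :: (real \<times> 'm) set. open X} \<subseteq> sets (borel \<Otimes>\<^sub>M borel)"
    by (intro sets.sigma_sets_subset) auto
  moreover have "sets (borel :: (real \<times> 'm) measure) = sigma_sets UNIV {X. open X}"
    by (simp add: borel_def)
  ultimately show "sets (borel :: (real \<times> 'm) measure) \<subseteq> sets (borel \<Otimes>\<^sub>M borel)"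
    by (simp add: space_pair_measure)
qed

context closed_manifold
begin

lemma borel_measurable_mu: "f \<in> borel_measurable borel \<Longrightarrow> f \<in> borel_measurable \<mu>"
  by (simp add: measurable_cong_sets[OF sets_mu refl])

text \<open>
  This applies to \<open>\<Sigma>\<close> and \<open>\<Gamma>\<close>, whose induced metrics are metrics on \<open>N\<close>. The metric of \<open>\<Gamma>\<close> may degenerate, so \<open>w\<close>
  may vanish.
\<close>

lemma riem_measure_density:
  fixes R :: "('i, 'm, 'e) riem" and w :: "'m \<Rightarrow> real"
  assumes R: "idx R = idx N" "cdom R = cdom N" "chart R = chart N"
    and w: "w \<in> borel_measurable borel" "\<And>p. w p \<ge> 0"
    and m: "\<And>i y. i \<in> idx N \<Longrightarrow> y \<in> cimg N i \<Longrightarrow> sqrt (gram_det (met R i y)) = w (cinv N i y) * dens i y"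
  shows "riem_measure R = density \<mu> (\<lambda>p. ennreal (w p))"
proof -
  obtain F where F: "finite F" "F \<subseteq> idx N" "(\<Union>i\<in>F. cdom N i) = UNIV" by (rule finite_cover)
  have pR: "points R = UNIV" using points_UNIV R by (simp add: points_def)
  show ?thesis
  proof (rule riem_measure_eqI[of F])
    show "finite F" "F \<subseteq> idx R" "points R = (\<Union>i\<in>F. cdom R i)" using F R pR by auto
    show "cdom R i \<in> sets (restrict_space borel (points R))" if "i \<in> idx R" for i
      using borel_open[OF open_cdom] that R pR by simp
    show "space (density \<mu> (\<lambda>p. ennreal (w p))) = points R"
      "sets (density \<mu> (\<lambda>p. ennreal (w p))) = sets (restrict_space borel (points R))"
      using pR by simp_all
    fix i E assume i: "i \<in> idx R" and E: "E \<in> sets (density \<mu> (\<lambda>p. ennreal (w p)))" "E \<subseteq> cdom R i"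
    have i': "i \<in> idx N" and E': "E \<in> sets borel" "E \<subseteq> cdom N i" using i E R by auto
    have "emeasure (density \<mu> (\<lambda>p. ennreal (w p))) E = (\<integral>\<^sup>+p. ennreal (w p) * indicator E p \<partial>\<mu>)"
      using E' w by (subst emeasure_density) (auto intro: borel_measurable_mu)
    also have "\<dots> = (\<integral>\<^sup>+p. indicator (cdom N i) p * (ennreal (w p) * indicator E p) \<partial>\<mu>)"
      using E' by (intro nn_integral_cong) (auto simp: indicator_def)
    also have "\<dots> = (\<integral>\<^sup>+y. indicator (cimg N i) y * (ennreal (dens i y) * (ennreal (w (cinv N i y)) * indicator E (cinv N i y))) \<partial>lborel)"
      using E' w by (intro nn_integral_chart[OF i']) auto
    also have "\<dots> = (\<integral>\<^sup>+y\<in>chart R i ` E. ennreal (sqrt (gram_det (met R i y))) \<partial>lborel)"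
      unfolding R chart_image[OF i' E'(2)]
    proof (intro nn_integral_cong)
      fix y
      show "indicator (cimg N i) y * (ennreal (dens i y) * (ennreal (w (cinv N i y)) * indicator E (cinv N i y))) =
         ennreal (sqrt (gram_det (met R i y))) * indicator (cimg N i \<inter> cinvx i -` E) y"
        using m[OF i', of y] w(2)[of "cinv N i y"] dens_pos[OF i', of y]
        by (auto simp: indicator_def cinvx_def ennreal_mult less_imp_le mult.commute)
    qed
    finally show "emeasure (density \<mu> (\<lambda>p. ennreal (w p))) E
      = (\<integral>\<^sup>+y\<in>chart R i ` E. ennreal (sqrt (gram_det (met R i y))) \<partial>lborel)" .
  qed
qed

lemma induced_simps [simp]: "idx (induced N M f) = idx N" "cdom (induced N M f) = cdom N" "chart (induced N M f) = chart N"
  by (simp_all add: induced_def)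

lemma riem_measure_slice:
  shows "riem_measure (induced N (warped_product a lam N) (graph_map (\<lambda>_. c)))
    = density \<mu> (\<lambda>p. ennreal (\<bar>lam c\<bar> ^ DIM('e)))"
proof (rule riem_measure_density)
  let ?M = "warped_product a lam N"
  fix i y assume i: "i \<in> idx N" and y: "y \<in> cimg N i"
  have rep: "local_rep N ?M (graph_map (\<lambda>_. c)) i z = (c, z)" if "z \<in> cimg N i" for z
    using chart_cinv[OF that] by (simp add: local_rep_def graph_map_def)
  have "fd (local_rep N ?M (graph_map (\<lambda>_. c)) i) y = fd (\<lambda>z. (c, z)) y"
    by (rule fd_cong[OF open_cimg[OF i] y rep])
  also have "\<dots> = (\<lambda>v. (0, v))"
    by (rule fd_eq) (intro has_derivative_Pair has_derivative_const has_derivative_ident)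
  finally have "met (induced N ?M (graph_map (\<lambda>_. c))) i y = (\<lambda>v w. (lam c)\<^sup>2 * met N i y v w)"
    by (simp add: induced_def Let_def rep[OF y] met_warped fun_eq_iff)
  moreover have "((lam c)\<^sup>2) ^ DIM('e) = (\<bar>lam c\<bar> ^ DIM('e))\<^sup>2"
    by (metis power2_abs power_mult mult.commute)
  ultimately show "sqrt (gram_det (met (induced N ?M (graph_map (\<lambda>_. c))) i y)) = \<bar>lam c\<bar> ^ DIM('e) * dens i y"
    by (simp add: gram_det_scale real_sqrt_mult dens_def)
qed simp_all

end

context star_graph
begin

lemma riem_measure_graph:
  "riem_measure (induced N (warped_product a lam N) (graph_map u))
    = density \<mu> (\<lambda>p. ennreal (lam (u p) ^ DIM('e) * (W p / lam (u p))))"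
proof (rule riem_measure_density)
  have c: "continuous_on UNIV (\<lambda>p. lam (u p))" by (rule continuous_compose_u[OF continuous_lam])
  have L: "lam (u p) > 0" for p by (rule lam_pos[OF u_gt])
  then have "lam (u p) \<noteq> 0" for p by (simp add: less_imp_neq[symmetric])
  then show "(\<lambda>p. lam (u p) ^ DIM('e) * (W p / lam (u p))) \<in> borel_measurable borel"
    by (intro borel_measurable_continuous_onI continuous_intros c continuous_W) auto
  show "0 \<le> lam (u p) ^ DIM('e) * (W p / lam (u p))" for p
    using L[of p] W_ge(2)[of p] by simp
  fix i y assume i: "i \<in> idx N" and y: "y \<in> cimg N i"
  interpret c: warped_graph_chart N i u "rep i u" lam a by (rule chart_locale[OF i])
  have "gram_det (met (induced N (warped_product a lam N) (graph_map u)) i y)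
     = ((c.L y)\<^sup>2) ^ DIM('e) * (1 + c.q y / (c.L y)\<^sup>2) * gram_det (met N i y)"
    unfolding c.met_induced_graph[OF y] c.q_def c.G_def mult_1
    using gram_det_graph[OF pd_met[OF i y] c.linear_d[OF y], of "(c.L y)\<^sup>2"] c.L_pos[OF y] by simp
  also have "\<dots> = (c.L y ^ DIM('e) * (c.W y / c.L y))\<^sup>2 * gram_det (met N i y)"
    using c.L_pos[OF y] unfolding power_mult_distrib power_divide c.W_sq[OF y]
    by (simp add: field_simps flip: power_mult)
  finally show "sqrt (gram_det (met (induced N (warped_product a lam N) (graph_map u)) i y))
    = lam (rep i u y) ^ DIM('e) * (W (cinv N i y) / lam (rep i u y)) * dens i y"
    using c.L_pos[OF y] c.W_pos[OF y] unfolding chart_quantities[OF i y]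
    by (simp add: real_sqrt_mult dens_def)
qed simp_all

end

locale warped_manifold = closed_manifold N
  for N :: "('i, 'm::t2_space, 'e::euclidean_space) riem" +
  fixes lam :: "real \<Rightarrow> real" and a :: real
  assumes cont_lam: "continuous_on {a..} lam" and lam_pos: "\<And>r. r > a \<Longrightarrow> lam r > 0"
begin

text \<open>
  At \<open>r = a\<close>, where the metric may degenerate, this follows by continuity.
\<close>

lemma lam_nonneg: "r \<ge> a \<Longrightarrow> lam r \<ge> 0"
proof (cases "r = a")
  case True
  have "(lam \<longlongrightarrow> lam a) (at_right a)"
    using cont_lam by (auto simp: continuous_on_def intro: tendsto_within_subset)
  moreover have "\<forall>\<^sub>F x in at_right a. 0 \<le> lam x"
    using lam_pos by (auto simp: eventually_at_right_field intro!: exI[of _ "a + 1"] less_imp_le)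
  ultimately show ?thesis
    unfolding True by (rule tendsto_lowerbound) simp
qed (use lam_pos in \<open>auto intro: less_imp_le\<close>)

text \<open>
  The radial part of the volume density \<open>\<lambda>\<^sup>n\<close>, extended by zero below \<open>a\<close> to make it measurable on the real line.
\<close>

definition radial where "radial r = indicator {a..} r * lam r ^ DIM('e)"

lemma radial_measurable [measurable]: "radial \<in> borel_measurable borel"
proof -
  have "(\<lambda>r. indicator {a..} r *\<^sub>R lam r ^ DIM('e)) \<in> borel_measurable borel"
    by (intro borel_measurable_continuous_on_indicator continuous_intros cont_lam) auto
  then show ?thesis by (simp add: radial_def[abs_def])
qed

lemma radial_nonneg: "radial r \<ge> 0"
  using lam_nonneg[of r] by (auto simp: radial_def indicator_def)

definition "warped_measure = restrict_space (density (lborel \<Otimes>\<^sub>M \<mu>) (\<lambda>(r, p). ennreal (radial r))) ({a..} \<times> UNIV)"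

lemma sets_pair_mu: "sets (lborel \<Otimes>\<^sub>M \<mu>) = sets (borel :: (real \<times> 'm) measure)"
  using sets_borel_real_pair[where 'm = 'm] sets_pair_measure_cong[OF sets_lborel sets_mu] by simp

lemma strip_borel: "{a..} \<times> (UNIV :: 'm set) \<in> sets borel"
proof -
  have "closed ({a..} \<times> (UNIV :: 'm set))" by (intro closed_Times) auto
  then show ?thesis by simp
qed

text \<open>
  The coefficient matrix of the metric is block diagonal, so the density is a product and Fubini's
  theorem reduces the claim to the measure of \<open>N\<close>.
\<close>

lemma riem_measure_warped: "riem_measure (warped_product a lam N) = warped_measure"
proof -
  let ?M = "warped_product a lam N"
  interpret fin: finite_measure \<mu> by (rule finite_mu)
  interpret sf: pair_sigma_finite lborel \<mu> ..
  obtain F where F: "finite F" "F \<subseteq> idx N" "(\<Union>i\<in>F. cdom N i) = UNIV" by (rule finite_cover)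
  have pM: "points ?M = {a..} \<times> UNIV" using points_UNIV by (auto simp: points_def)
  show ?thesis
  proof (rule riem_measure_eqI[of F])
    show "finite F" "F \<subseteq> idx ?M" using F by auto
    show "points ?M = (\<Union>i\<in>F. cdom ?M i)" unfolding pM using F(3) by auto
    show "space warped_measure = points ?M"
      unfolding warped_measure_def pM space_restrict_space by (simp add: space_pair_measure)
    show s: "sets warped_measure = sets (restrict_space borel (points ?M))"
      unfolding warped_measure_def pM by (intro sets_restrict_space_cong) (simp only: sets_density sets_pair_mu)
    show "cdom ?M i \<in> sets (restrict_space borel (points ?M))" if "i \<in> idx ?M" for i
    proof -
      have "{a..} \<times> cdom N i \<in> sets borel"
        unfolding sets_borel_real_pair[symmetric] using open_cdom that by (intro pair_measureI) auto
      then show ?thesis using strip_borel by (auto simp: pM sets_restrict_space_iff)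
    qed
    fix i E assume "i \<in> idx ?M" and E: "E \<in> sets warped_measure" "E \<subseteq> cdom ?M i"
    then have i: "i \<in> idx N" by simp
    have Eb: "E \<in> sets borel" and Es: "E \<subseteq> {a..} \<times> cdom N i"
      using E strip_borel unfolding s pM by (auto simp: sets_restrict_space_iff)
    have im_iff: "(r, y) \<in> chart ?M i ` E \<longleftrightarrow> y \<in> cimg N i \<and> (r, cinv N i y) \<in> E" for r y
    proof
      assume "(r, y) \<in> chart ?M i ` E"
      then obtain p where "(r, p) \<in> E" "y = chart N i p" by auto
      then show "y \<in> cimg N i \<and> (r, cinv N i y) \<in> E" using Es cinv_chart[OF i] chart_in by auto
    next
      assume "y \<in> cimg N i \<and> (r, cinv N i y) \<in> E"
      then show "(r, y) \<in> chart ?M i ` E"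
        using chart_cinv by (intro image_eqI[of _ _ "(r, cinv N i y)"]) auto
    qed
    have Em: "E \<in> sets (lborel \<Otimes>\<^sub>M \<mu>)" using Eb sets_pair_mu by simp
    have Ebb: "E \<in> sets (borel \<Otimes>\<^sub>M borel)" using Eb unfolding sets_borel_real_pair .
    have md: "(\<lambda>(r, p). ennreal (radial r)) \<in> borel_measurable (lborel \<Otimes>\<^sub>M \<mu>)" by measurable
    have "emeasure warped_measure E = emeasure (density (lborel \<Otimes>\<^sub>M \<mu>) (\<lambda>(r, p). ennreal (radial r))) E"
      unfolding warped_measure_def using strip_borel Es sets_pair_mu
      by (intro emeasure_restrict_space) (auto simp: space_pair_measure)
    also have "\<dots> = (\<integral>\<^sup>+z. (case z of (r, p) \<Rightarrow> ennreal (radial r)) * indicator E z \<partial>(lborel \<Otimes>\<^sub>M \<mu>))"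
      using Em by (intro emeasure_density md)
    also have "\<dots> = (\<integral>\<^sup>+r. \<integral>\<^sup>+p. ennreal (radial r) * indicator E (r, p) \<partial>\<mu> \<partial>lborel)"
      using Em md by (subst fin.nn_integral_fst[symmetric]) auto
    also have "\<dots> = (\<integral>\<^sup>+r. \<integral>\<^sup>+y. indicator (chart ?M i ` E) (r, y) * ennreal (radial r * dens i y) \<partial>lborel \<partial>lborel)"
    proof (intro nn_integral_cong)
      fix r :: real
      have m: "(\<lambda>p. ennreal (radial r) * indicator E (r, p)) \<in> borel_measurable borel"
      proof -
        have "{p. (r, p) \<in> E} \<in> sets borel"
          using measurable_sets[OF measurable_Pair1'[of r borel borel] Ebb] by (simp add: vimage_def)
        then have "(indicator {p. (r, p) \<in> E} :: 'm \<Rightarrow> ennreal) \<in> borel_measurable borel"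
          by (rule borel_measurable_indicator)
        moreover have "(\<lambda>p. indicator E (r, p)) = (indicator {p. (r, p) \<in> E} :: 'm \<Rightarrow> ennreal)"
          by (auto simp: indicator_def)
        ultimately have "(\<lambda>p. indicator E (r, p) :: ennreal) \<in> borel_measurable borel"
          by metis
        then show ?thesis by (intro borel_measurable_times_ennreal borel_measurable_const)
      qed
      have "(\<integral>\<^sup>+p. ennreal (radial r) * indicator E (r, p) \<partial>\<mu>)
          = (\<integral>\<^sup>+p. indicator (cdom N i) p * (ennreal (radial r) * indicator E (r, p)) \<partial>\<mu>)"
        using Es by (intro nn_integral_cong) (auto simp: indicator_def)
      also have "\<dots> = (\<integral>\<^sup>+y. indicator (cimg N i) y * (ennreal (dens i y) * (ennreal (radial r) * indicator E (r, cinv N i y))) \<partial>lborel)"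
        by (rule nn_integral_chart[OF i m])
      also have "\<dots> = (\<integral>\<^sup>+y. indicator (chart ?M i ` E) (r, y) * ennreal (radial r * dens i y) \<partial>lborel)"
      proof (intro nn_integral_cong)
        fix y
        show "indicator (cimg N i) y * (ennreal (dens i y) * (ennreal (radial r) * indicator E (r, cinv N i y)))
           = indicator (chart ?M i ` E) (r, y) * ennreal (radial r * dens i y)"
          using dens_pos[OF i, of y] radial_nonneg[of r] im_iff[of r y]
          by (auto simp: indicator_def ennreal_mult less_imp_le mult.commute)
      qed
      finally show "(\<integral>\<^sup>+p. ennreal (radial r) * indicator E (r, p) \<partial>\<mu>)
        = (\<integral>\<^sup>+y. indicator (chart ?M i ` E) (r, y) * ennreal (radial r * dens i y) \<partial>lborel)" .
    qed
    also have "\<dots> = (\<integral>\<^sup>+z. indicator (chart ?M i ` E) z * ennreal (radial (fst z) * (indicator (cimg N i) (snd z) * dens i (snd z))) \<partial>(lborel \<Otimes>\<^sub>M lborel))"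
    proof -
      have im: "chart ?M i ` E = (\<lambda>(r, y). (r, cinvx i y)) -` E \<inter> (UNIV \<times> cimg N i)"
        by (simp only: set_eq_iff split_paired_All im_iff) (auto simp: cinvx_def)
      have "(\<lambda>(r, y). (r, cinvx i y)) \<in> measurable (borel \<Otimes>\<^sub>M borel) (borel \<Otimes>\<^sub>M borel)"
        using cinvx_measurable[OF i] by measurable
      from measurable_sets[OF this Ebb]
      have 1: "chart ?M i ` E \<in> sets (borel \<Otimes>\<^sub>M borel)"
        unfolding im using open_cimg[OF i] by (auto simp: space_pair_measure intro!: sets.Int pair_measureI)
      have 2: "(\<lambda>y. indicator (cimg N i) y * dens i y) \<in> borel_measurable borel"
        by (rule measurable_on_chart[OF i cont_dens[OF i]])
      have 3: "(\<lambda>z. indicator (chart ?M i ` E) z * ennreal (radial (fst z) * (indicator (cimg N i) (snd z) * dens i (snd z))))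
        \<in> borel_measurable (lborel \<Otimes>\<^sub>M lborel)"
        using 1 measurable_compose[OF measurable_snd 2, of borel] by measurable
      show ?thesis
        using im by (subst lborel.nn_integral_fst[OF 3, symmetric]) (intro nn_integral_cong, auto simp: indicator_def)
    qed
    also have "\<dots> = (\<integral>\<^sup>+z\<in>chart ?M i ` E. ennreal (sqrt (gram_det (met ?M i z))) \<partial>lborel)"
      unfolding lborel_prod
    proof (intro nn_integral_cong)
      fix z :: "real \<times> 'e"
      show "indicator (chart ?M i ` E) z * ennreal (radial (fst z) * (indicator (cimg N i) (snd z) * dens i (snd z)))
         = ennreal (sqrt (gram_det (met ?M i z))) * indicator (chart ?M i ` E) z"
      proof (cases "z \<in> chart ?M i ` E")
        case True
        then have z: "fst z \<ge> a" "snd z \<in> cimg N i" using Es chart_in by auto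
        note b = pd_formD(1)[OF pd_met[OF i z(2)]]
        have "gram_det (met ?M i z) = gram_det (\<lambda>v w. (lam (fst z))\<^sup>2 * met N i (snd z) v w)"
          by (rule gram_det_block) (simp_all add: met_warped bilinear_lzero[OF b])
        then have "sqrt (gram_det (met ?M i z)) = radial (fst z) * dens i (snd z)"
          using z(1) lam_nonneg[OF z(1)]
          by (simp add: gram_det_scale real_sqrt_mult dens_def real_sqrt_power radial_def)
        then show ?thesis using z True by simp
      qed simp
    qed
    finally show "emeasure warped_measure E = (\<integral>\<^sup>+z\<in>chart ?M i ` E. ennreal (sqrt (gram_det (met ?M i z))) \<partial>lborel)" .
  qed
qed

lemma nn_integral_warped:
  assumes f: "f \<in> borel_measurable borel" and 0: "\<And>r p. r < a \<Longrightarrow> f (r, p) = 0"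
  shows "(\<integral>\<^sup>+z. f z \<partial>riem_measure (warped_product a lam N))
    = (\<integral>\<^sup>+p. \<integral>\<^sup>+r. ennreal (radial r) * f (r, p) \<partial>lborel \<partial>\<mu>)"
proof -
  interpret fin: finite_measure \<mu> by (rule finite_mu)
  interpret sf: pair_sigma_finite lborel \<mu> ..
  have fm: "f \<in> borel_measurable (lborel \<Otimes>\<^sub>M \<mu>)" using f by (simp add: measurable_cong_sets[OF sets_pair_mu refl])
  have md: "(\<lambda>(r, p). ennreal (radial r)) \<in> borel_measurable (lborel \<Otimes>\<^sub>M \<mu>)" by measurable
  have "(\<integral>\<^sup>+z. f z \<partial>warped_measure)
     = (\<integral>\<^sup>+z. f z * indicator ({a..} \<times> UNIV) z \<partial>density (lborel \<Otimes>\<^sub>M \<mu>) (\<lambda>(r, p). ennreal (radial r)))"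
    unfolding warped_measure_def using strip_borel sets_pair_mu
    by (intro nn_integral_restrict_space) (auto simp: space_pair_measure)
  also have "\<dots> = (\<integral>\<^sup>+z. f z \<partial>density (lborel \<Otimes>\<^sub>M \<mu>) (\<lambda>(r, p). ennreal (radial r)))"
    by (intro nn_integral_cong) (auto simp: indicator_def not_le intro!: 0)
  also have "\<dots> = (\<integral>\<^sup>+z. (case z of (r, p) \<Rightarrow> ennreal (radial r)) * f z \<partial>(lborel \<Otimes>\<^sub>M \<mu>))"
    by (rule nn_integral_density[OF md fm])
  also have "\<dots> = (\<integral>\<^sup>+p. \<integral>\<^sup>+r. ennreal (radial r) * f (r, p) \<partial>lborel \<partial>\<mu>)"
    using fm md by (subst sf.nn_integral_snd[symmetric]) (auto simp: case_prod_unfold)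
  finally show ?thesis unfolding riem_measure_warped .
qed

end

section \<open>The inequality at a point\<close>

text \<open>
  The defect in Young's inequality \<open>s\<^sup>k t\<^sup>n \<le> n / (n + k) t\<^sup>n\<^sup>+\<^sup>k + k / (n + k) s\<^sup>n\<^sup>+\<^sup>k\<close>; it vanishes to second
  order at \<open>t = s\<close>.
\<close>

definition young_gap :: "real \<Rightarrow> real \<Rightarrow> real \<Rightarrow> real \<Rightarrow> real" where
  "young_gap n k s t = n / (n + k) * t powr (n + k) - s powr k * t powr n + k / (n + k) * s powr (n + k)"

lemma young_gap_self: "n + k > 0 \<Longrightarrow> s > 0 \<Longrightarrow> young_gap n k s s = 0"
  by (simp add: young_gap_def powr_add field_simps)

lemma DERIV_young_gap:
  assumes "n > 0" "k > 0" "t > 0"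
  shows "(young_gap n k s has_real_derivative n * t powr (n - 1) * (t powr k - s powr k)) (at t)"
proof -
  have e: "t powr (n + k - 1) = t powr (n - 1) * t powr k"
    by (simp add: powr_add[symmetric] algebra_simps)
  have "((\<lambda>t. n / (n + k) * t powr (n + k) - s powr k * t powr n + k / (n + k) * s powr (n + k)) has_real_derivative
      n / (n + k) * ((n + k) * t powr (n + k - 1)) - s powr k * (n * t powr (n - 1)) + 0) (at t)"
    by (intro DERIV_add DERIV_diff DERIV_cmult has_real_derivative_powr DERIV_const assms(3))
  moreover have "n / (n + k) * ((n + k) * x) = n * x" for x using assms by simp
  ultimately show ?thesis
    unfolding young_gap_def[abs_def] by (simp only: e) (simp add: right_diff_distrib mult_ac)
qed

lemma young_gap_pos:
  assumes "n > 0" "k > 0" "s > 0" "t > 0" "t \<noteq> s"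
  shows "young_gap n k s t > 0"
proof (cases "t < s")
  case True
  have "young_gap n k s t > young_gap n k s s"
  proof (rule DERIV_neg_imp_decreasing_open[OF True])
    show "\<exists>y. (young_gap n k s has_real_derivative y) (at x) \<and> y < 0" if "t < x" "x < s" for x
    proof (intro exI conjI)
      show "(young_gap n k s has_real_derivative n * x powr (n - 1) * (x powr k - s powr k)) (at x)"
        using assms that by (intro DERIV_young_gap) auto
      have "x powr k < s powr k" using assms that by (intro powr_less_mono2) auto
      then show "n * x powr (n - 1) * (x powr k - s powr k) < 0"
        using assms that by (intro mult_pos_neg) auto
    qed
    show "continuous_on {t..s} (young_gap n k s)"
      unfolding young_gap_def[abs_def] using assms by (intro continuous_intros) auto
  qed
  then show ?thesis using assms by (simp add: young_gap_self)
next
  case False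
  then have st: "s < t" using assms by simp
  have "young_gap n k s s < young_gap n k s t"
  proof (rule DERIV_pos_imp_increasing_open[OF st])
    show "\<exists>y. (young_gap n k s has_real_derivative y) (at x) \<and> y > 0" if "s < x" "x < t" for x
    proof (intro exI conjI)
      show "(young_gap n k s has_real_derivative n * x powr (n - 1) * (x powr k - s powr k)) (at x)"
        using assms that by (intro DERIV_young_gap) auto
      have "s powr k < x powr k" using assms that by (intro powr_less_mono2) auto
      then show "0 < n * x powr (n - 1) * (x powr k - s powr k)"
        using assms that by (intro mult_pos_pos) auto
    qed
    show "continuous_on {s..t} (young_gap n k s)"
      unfolding young_gap_def[abs_def] using assms by (intro continuous_intros) auto
  qed
  then show ?thesis using assms by (simp add: young_gap_self)
qed

lemma young_gap_nonneg: "n > 0 \<Longrightarrow> k > 0 \<Longrightarrow> s > 0 \<Longrightarrow> t > 0 \<Longrightarrow> young_gap n k s t \<ge> 0"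
  using young_gap_pos[of n k s t] young_gap_self[of n k s] by (cases "t = s") auto

text \<open>
  The test function: the Young defect below \<open>s\<close> divided by \<open>n\<close>, and zero above \<open>s\<close>. Since the defect
  vanishes to second order at \<open>s\<close>, the cut-off is continuously differentiable.
\<close>

definition cutoff_gap :: "real \<Rightarrow> real \<Rightarrow> real \<Rightarrow> real \<Rightarrow> real" where
  "cutoff_gap n k s t = young_gap n k s (min t s) / n"

definition cutoff_gap' :: "real \<Rightarrow> real \<Rightarrow> real \<Rightarrow> real \<Rightarrow> real" where
  "cutoff_gap' n k s t = t powr (n - 1) * min 0 (t powr k - s powr k)"

lemma DERIV_cutoff_gap:
  assumes "n > 0" "k > 0" "s > 0" "t > 0"
  shows "(cutoff_gap n k s has_real_derivative cutoff_gap' n k s t) (at t)"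
proof -
  have D: "((\<lambda>t. young_gap n k s t / n) has_real_derivative t powr (n - 1) * (t powr k - s powr k)) (at t)"
    using DERIV_cdivide[OF DERIV_young_gap[OF assms(1,2,4), of s], of n] assms by simp
  consider "t < s" | "t > s" | "t = s" by linarith
  then show ?thesis
  proof cases
    case 1
    have e: "cutoff_gap' n k s t = t powr (n - 1) * (t powr k - s powr k)"
      using 1 assms powr_less_mono2[of k t s] by (simp add: cutoff_gap'_def)
    show ?thesis
      unfolding e by (rule has_field_derivative_transform_within_open[OF D, of "{..<s}"])
        (use 1 in \<open>auto simp: cutoff_gap_def\<close>)
  next
    case 2
    have e: "cutoff_gap' n k s t = 0"
      using 2 assms powr_less_mono2[of k s t] by (simp add: cutoff_gap'_def)
    have "((\<lambda>t. young_gap n k s s / n) has_real_derivative 0) (at t)" by simp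
    then show ?thesis
      unfolding e by (rule has_field_derivative_transform_within_open[of _ _ _ "{s<..}"])
        (use 2 in \<open>auto simp: cutoff_gap_def\<close>)
  next
    case 3
    have e: "cutoff_gap' n k s t = 0" using 3 by (simp add: cutoff_gap'_def)
    have D0: "((\<lambda>t. young_gap n k s t / n) has_real_derivative 0) (at s)" using D 3 by simp
    have l: "((\<lambda>t. young_gap n k s s / n) has_real_derivative 0) (at s within {s..})" by simp
    have "(cutoff_gap n k s has_real_derivative 0) (at s within {..s})"
      by (rule has_field_derivative_transform_within[OF has_field_derivative_at_within[OF D0] zero_less_one])
         (auto simp: cutoff_gap_def)
    moreover have "(cutoff_gap n k s has_real_derivative 0) (at s within {s..})"
      by (rule has_field_derivative_transform_within[OF l zero_less_one]) (auto simp: cutoff_gap_def)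
    ultimately have "(cutoff_gap n k s has_real_derivative 0) (at s within ({..s} \<union> {s..}))"
      unfolding has_field_derivative_iff by (simp add: Lim_within_Un)
    moreover have "{..s} \<union> {s..} = UNIV" by auto
    ultimately show ?thesis unfolding e using 3 by simp
  qed
qed

lemma cutoff_gap_nonneg: "n > 0 \<Longrightarrow> k > 0 \<Longrightarrow> s > 0 \<Longrightarrow> t > 0 \<Longrightarrow> cutoff_gap n k s t \<ge> 0"
  by (simp add: cutoff_gap_def young_gap_nonneg)

lemma cutoff_gap_zero:
  assumes "n > 0" "k > 0" "s > 0" "t > 0" "cutoff_gap n k s t = 0"
  shows "t \<ge> s"
proof (rule ccontr)
  assume "\<not> t \<ge> s"
  then have "young_gap n k s (min t s) > 0" using assms by (intro young_gap_pos) auto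
  then show False using assms by (simp add: cutoff_gap_def)
qed

text \<open>
  With \<open>t = \<lambda>\<close>, \<open>V = W / \<lambda>\<close> and \<open>s\<^sup>n = \<bar>\<Sigma>\<bar> / \<bar>N\<bar>\<close>, the integral of this function over \<open>N\<close> is the
  difference of the two sides of the theorem.
\<close>

definition minkowski_gap :: "real \<Rightarrow> real \<Rightarrow> real \<Rightarrow> real \<Rightarrow> real \<Rightarrow> real" where
  "minkowski_gap n k s t V = (t powr k - s powr k) * t powr n * (V - 1) + young_gap n k s t"

text \<open>
  The heart of the proof. For \<open>t < s\<close> put \<open>P = young_gap n k s t\<close> and \<open>g = (s\<^sup>k - t\<^sup>k) t\<^sup>n\<close>. The cut-off is
  \<open>P / n\<close>, and \<open>t\<close> times its derivative is exactly \<open>- g\<close>, so that the two sides differ by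
  \<open>(P + g) (1 - 1 / V) \<ge> 0\<close>. For \<open>t \<ge> s\<close> the left-hand side is zero and the right-hand side is a sum of
  nonnegative terms; without the cut-off the difference would become negative for large \<open>t\<close>.
\<close>

lemma pointwise_inequality:
  assumes n: "n > 0" and k: "k > 0" and s: "s > 0" and t: "t > 0" and V: "V \<ge> 1"
  shows "cutoff_gap' n k s t * t * (V - 1 / V) + n * cutoff_gap n k s t / V \<le> minkowski_gap n k s t V"
proof (cases "t < s")
  case True
  define P where "P = young_gap n k s t"
  define g where "g = (s powr k - t powr k) * t powr n"
  have P: "P \<ge> 0" unfolding P_def using assms by (intro young_gap_nonneg)
  have lt: "t powr k < s powr k" using True assms by (intro powr_less_mono2) auto
  then have g: "g \<ge> 0" unfolding g_def by simp
  have f: "n * cutoff_gap n k s t = P" using True n by (simp add: cutoff_gap_def P_def)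
  have "t powr n = t powr (n - 1) * t" using t by (simp add: powr_diff)
  then have f': "cutoff_gap' n k s t * t = - g"
    using lt by (simp add: cutoff_gap'_def g_def algebra_simps)
  have mg: "minkowski_gap n k s t V = P - g * (V - 1)"
    by (simp add: minkowski_gap_def g_def P_def algebra_simps)
  have "minkowski_gap n k s t V - (- g * (V - 1 / V) + P / V) = (P + g) * (1 - 1 / V)"
    unfolding mg by (simp add: algebra_simps add_divide_distrib)
  also have "\<dots> \<ge> 0" using P g V by (intro mult_nonneg_nonneg) auto
  finally show ?thesis unfolding f f' by simp
next
  case False
  then have le: "s powr k \<le> t powr k" using assms by (intro powr_mono2) auto
  have "n * cutoff_gap n k s t = 0" using False n k s by (simp add: cutoff_gap_def young_gap_self)
  moreover have "cutoff_gap' n k s t = 0" using le by (simp add: cutoff_gap'_def)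
  moreover have "minkowski_gap n k s t V \<ge> 0"
    unfolding minkowski_gap_def using le V young_gap_nonneg[OF n k s t]
    by (intro add_nonneg_nonneg mult_nonneg_nonneg) auto
  ultimately show ?thesis using n by auto
qed

context warped_manifold
begin

text \<open>
  By Fubini's theorem, since \<open>\<lambda>\<^sup>n \<lambda>\<^sup>k\<^sup>-\<^sup>1 \<lambda>'\<close> has the primitive \<open>\<lambda>\<^sup>n\<^sup>+\<^sup>k / (n + k)\<close>.
\<close>

lemma enclosed_integral:
  assumes u: "continuous_on UNIV u" "\<And>p. u p > a" and k: "k > 0"
    and lam': "\<And>r. r > a \<Longrightarrow> (lam has_real_derivative deriv lam r) (at r)" "continuous_on {a<..} (deriv lam)"
      "\<And>r. r > a \<Longrightarrow> deriv lam r > 0"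
  defines "m \<equiv> real DIM('e)"
  shows "(LINT q : enclosed a u | riem_measure (warped_product a lam N). lam (fst q) powr (k - 1) * deriv lam (fst q))
    = (\<integral>p. (lam (u p) powr (m + k) - lam a powr (m + k)) / (m + k) \<partial>\<mu>)"
proof -
  have m: "m > 0" by (simp add: m_def)
  let ?M = "riem_measure (warped_product a lam N)"
  define h where "h r = indicator {a<..} r * (lam r powr (k - 1) * deriv lam r)" for r
  define F where "F q = indicator (enclosed a u) q * h (fst q)" for q :: "real \<times> 'm"
  have lam_cont: "continuous_on {a<..} lam" using cont_lam by (rule continuous_on_subset) auto
  have hm: "h \<in> borel_measurable borel"
  proof -
    have "(\<lambda>r. indicator {a<..} r *\<^sub>R (lam r powr (k - 1) * deriv lam r)) \<in> borel_measurable borel"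
      by (intro borel_measurable_continuous_on_indicator continuous_intros lam_cont lam'(2))
         (use lam_pos in \<open>auto simp: less_imp_neq[symmetric]\<close>)
    then show ?thesis by (simp add: h_def[abs_def])
  qed
  have h0: "h r \<ge> 0" for r using lam'(3)[of r] by (cases "r > a") (simp_all add: h_def)
  have "open {q :: real \<times> 'm. a < fst q \<and> fst q < u (snd q)}"
    by (intro open_Collect_conj open_Collect_less continuous_intros continuous_on_compose2[OF u(1)]) auto
  moreover have "{q :: real \<times> 'm. a < fst q \<and> fst q < u (snd q)} = enclosed a u" by (auto simp: enclosed_def)
  ultimately have em: "enclosed a u \<in> sets borel" by simp
  have fstm: "fst \<in> measurable (borel :: (real \<times> 'm) measure) borel"
    by (intro borel_measurable_continuous_onI continuous_intros)
  have Fm: "F \<in> borel_measurable borel"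
    unfolding F_def[abs_def] using em measurable_compose[OF fstm hm]
    by (intro borel_measurable_times borel_measurable_indicator) auto
  have Fm': "F \<in> borel_measurable ?M"
    unfolding riem_measure_warped warped_measure_def using Fm
    by (intro measurable_restrict_space1) (simp add: measurable_cong_sets[OF sets_pair_mu refl])
  have F0: "F q \<ge> 0" for q using h0 by (simp add: F_def indicator_def)
  define I where "I p = (lam (u p) powr (m + k) - lam a powr (m + k)) / (m + k)" for p
  have inner: "(\<integral>\<^sup>+r. ennreal (radial r) * ennreal (F (r, p)) \<partial>lborel) = ennreal (I p)" and I0: "I p \<ge> 0" for p
  proof -
    have ab: "a \<le> u p" using u(2)[of p] by simp
    have hi: "((\<lambda>r. lam r powr (m + k - 1) * deriv lam r) has_integral
       (lam (u p) powr (m + k) / (m + k) - lam a powr (m + k) / (m + k))) {a..u p}"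
    proof (rule fundamental_theorem_of_calculus_interior[OF ab])
      show "continuous_on {a..u p} (\<lambda>r. lam r powr (m + k) / (m + k))"
        using m k lam_nonneg
        by (intro continuous_intros continuous_on_powr' continuous_on_subset[OF cont_lam]) auto
      fix r assume r: "r \<in> {a<..<u p}"
      show "((\<lambda>r. lam r powr (m + k) / (m + k)) has_vector_derivative lam r powr (m + k - 1) * deriv lam r) (at r)"
        unfolding has_real_derivative_iff_has_vector_derivative[symmetric]
      proof -
        have "((\<lambda>r. lam r powr (m + k)) has_real_derivative (m + k) * lam r powr (m + k - 1) * deriv lam r) (at r)"
          using r by (intro DERIV_chain2[OF has_real_derivative_powr lam'(1)] lam_pos) auto
        from DERIV_cdivide[OF this, of "m + k"]
        show "((\<lambda>r. lam r powr (m + k) / (m + k)) has_real_derivative lam r powr (m + k - 1) * deriv lam r) (at r)"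
          by (rule DERIV_cong) (use m k in simp)
      qed
    qed
    then have hi': "((\<lambda>r. lam r powr (m + k - 1) * deriv lam r) has_integral I p) {a<..<u p}"
      by (simp add: has_integral_Icc_iff_Ioo I_def diff_divide_distrib)
    have nn: "0 \<le> lam r powr (m + k - 1) * deriv lam r" if "r \<in> {a<..<u p}" for r
      using that lam'(3)[of r] by simp
    show "I p \<ge> 0" by (rule has_integral_nonneg[OF hi' nn])
    have "(\<integral>\<^sup>+r. ennreal (radial r) * ennreal (F (r, p)) \<partial>lborel)
        = (\<integral>\<^sup>+r. ennreal (lam r powr (m + k - 1) * deriv lam r) * indicator {a<..<u p} r \<partial>lborel)"
    proof (intro nn_integral_cong)
      fix r
      show "ennreal (radial r) * ennreal (F (r, p)) = ennreal (lam r powr (m + k - 1) * deriv lam r) * indicator {a<..<u p} r"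
      proof (cases "r \<in> {a<..<u p}")
        case True
        then have r: "r > a" "lam r > 0" using lam_pos by auto
        have "lam r ^ DIM('e) * (lam r powr (k - 1) * deriv lam r) = lam r powr (m + k - 1) * deriv lam r"
          using r(2) by (simp add: m_def powr_realpow[symmetric] powr_add[symmetric] algebra_simps flip: mult.assoc)
        then show ?thesis
          using True r lam'(3)[OF r(1)] by (simp add: radial_def F_def h_def enclosed_def ennreal_mult[symmetric])
      qed (auto simp: F_def enclosed_def indicator_def)
    qed
    also have "\<dots> = ennreal (I p)" by (rule nn_integral_has_integral_lebesgue'[OF nn hi'])
    finally show "(\<integral>\<^sup>+r. ennreal (radial r) * ennreal (F (r, p)) \<partial>lborel) = ennreal (I p)" .
  qed
  have Ic: "continuous_on UNIV I"
  proof -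
    have c: "continuous_on UNIV (\<lambda>p. lam (u p))"
      by (rule continuous_on_compose2[OF cont_lam u(1)]) (use u(2) in \<open>auto intro: less_imp_le\<close>)
    have "lam (u p) \<noteq> 0" for p using lam_pos[OF u(2)[of p]] by simp
    then show ?thesis unfolding I_def[abs_def] using m k by (intro continuous_intros c) auto
  qed
  have "(LINT q : enclosed a u | ?M. lam (fst q) powr (k - 1) * deriv lam (fst q)) = (\<integral>q. F q \<partial>?M)"
    unfolding set_lebesgue_integral_def
    by (intro Bochner_Integration.integral_cong refl) (auto simp: F_def h_def enclosed_def indicator_def)
  also have "\<dots> = enn2real (\<integral>\<^sup>+q. ennreal (F q) \<partial>?M)"
    by (rule integral_eq_nn_integral[OF Fm']) (simp add: F0)
  also have "(\<integral>\<^sup>+q. ennreal (F q) \<partial>?M) = (\<integral>\<^sup>+p. \<integral>\<^sup>+r. ennreal (radial r) * ennreal (F (r, p)) \<partial>lborel \<partial>\<mu>)"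
    by (rule nn_integral_warped[OF measurable_compose[OF Fm measurable_ennreal]]) (simp add: F_def enclosed_def)
  also have "enn2real \<dots> = (\<integral>p. I p \<partial>\<mu>)"
    unfolding inner
    by (rule integral_eq_nn_integral[symmetric])
       (use I0 borel_measurable_mu[OF borel_measurable_continuous_onI[OF Ic]] in auto)
  finally show ?thesis unfolding I_def .
qed

end

section \<open>The weighted Minkowski inequality\<close>

context star_graph
begin

text \<open>
  The factor \<open>\<surd>(1 + \<bar>\<nabla>u\<bar>\<^sup>2 / \<lambda>\<^sup>2)\<close> by which the area of the graph exceeds that of the slice through the same point.
\<close>

abbreviation "tilt p \<equiv> W p / lam (u p)"

lemma tilt_ge_1: "tilt p \<ge> 1"
  using W_ge(1)[of p] lam_pos[OF u_gt[of p]] by simp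

lemma continuous_lam_u: "continuous_on UNIV (\<lambda>p. lam (u p))"
  by (rule continuous_compose_u[OF continuous_lam])

lemma lam_u_pos: "lam (u p) > 0" "lam (u p) \<noteq> 0"
  using lam_pos[OF u_gt[of p]] by auto

lemma continuous_tilt: "continuous_on UNIV tilt"
  using lam_u_pos by (intro continuous_intros continuous_W continuous_lam_u) auto

lemma continuous_gap:
  assumes "n > 0" "k > 0" "s > 0"
  shows "continuous_on UNIV (\<lambda>p. minkowski_gap n k s (lam (u p)) (tilt p))"
  unfolding minkowski_gap_def young_gap_def using lam_u_pos assms
  by (intro continuous_intros continuous_lam_u continuous_tilt) auto

text \<open>
  Weak mean convexity is tested with \<open>\<psi> \<circ> u\<close>, where \<open>\<psi> = cutoff_gap \<circ> \<lambda> / \<lambda>'\<close>. The denominator removes the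
  factor \<open>\<lambda>'\<close> from \<open>n \<lambda>'\<close>; its derivative contributes a term with the sign of \<open>- \<lambda>''\<close>, which is dropped.
  If the integral is zero, then \<open>\<psi> \<circ> u = 0\<close> by strict mean convexity, so \<open>\<lambda> \<ge> s\<close> on the graph, and there
  the integrand bounds the Young defect, which vanishes only at \<open>s\<close>.
\<close>

lemma gap_integral:
  assumes k: "k > 0" and s: "s > 0" and H: "mean_convex a lam N u"
    and lam': "\<And>r. r > a \<Longrightarrow> deriv lam r > 0" and lam'': "\<And>r. r > a \<Longrightarrow> deriv (deriv lam) r \<ge> 0"
  defines "n \<equiv> real DIM('e)"
  shows "(\<integral>p. minkowski_gap n k s (lam (u p)) (tilt p) \<partial>\<mu>) \<ge> 0"
    "(\<integral>p. minkowski_gap n k s (lam (u p)) (tilt p) \<partial>\<mu>) = 0 \<Longrightarrow> lam (u p) = s"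
proof -
  have n: "n > 0" by (simp add: n_def)
  define f where "f = cutoff_gap n k s"
  define f' where "f' = cutoff_gap' n k s"
  define \<psi> where "\<psi> r = f (lam r) / deriv lam r" for r
  define \<psi>' where "\<psi>' r = f' (lam r) - f (lam r) * deriv (deriv lam) r / (deriv lam r)\<^sup>2" for r
  define \<eta> where "\<eta> p = \<psi> (u p)" for p
  define Z where "Z p = minkowski_gap n k s (lam (u p)) (tilt p)" for p
  have Df: "(f has_real_derivative f' (lam r)) (at (lam r))" if "r > a" for r
    unfolding f_def f'_def by (rule DERIV_cutoff_gap[OF n k s lam_pos[OF that]])
  have f0: "f (lam r) \<ge> 0" if "r > a" for r
    unfolding f_def by (rule cutoff_gap_nonneg[OF n k s lam_pos[OF that]])
  have Dflam: "((\<lambda>r. f (lam r)) has_real_derivative f' (lam r) * deriv lam r) (at r)" if "r > a" for r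
    by (rule DERIV_chain2[OF Df[OF that] lam_deriv(1)[OF that]])
  have D\<psi>: "(\<psi> has_real_derivative \<psi>' r) (at r)" if r: "r > a" for r
  proof -
    have "(\<psi> has_real_derivative (f' (lam r) * deriv lam r * deriv lam r - f (lam r) * deriv (deriv lam) r)
        / (deriv lam r * deriv lam r)) (at r)"
      unfolding \<psi>_def[abs_def] using lam'[OF r] by (intro DERIV_divide Dflam lam_deriv(3) r) auto
    then show ?thesis
      by (rule DERIV_cong) (use lam'[OF r] in \<open>simp add: \<psi>'_def power2_eq_square field_simps\<close>)
  qed
  have C1: "C1_fun \<eta>"
    unfolding C1_fun_def \<eta>_def
  proof
    fix i assume i: "i \<in> idx N"
    show "C1_on (cimg N i) (\<lambda>y. \<psi> (u (cinv N i y)))"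
    proof (rule C1_on_compose_real[OF C1_funD[OF C1_u i]])
      show "(\<psi> has_real_derivative \<psi>' (rep i u y)) (at (rep i u y))" for y by (rule D\<psi>[OF u_gt])
      have "continuous_on {a<..} (\<lambda>r. f (lam r))"
        using Dflam DERIV_isCont by (intro continuous_at_imp_continuous_on) auto
      moreover have "continuous_on {a<..} (\<lambda>r. f' (lam r))"
        unfolding f'_def cutoff_gap'_def using lam_pos
        by (intro continuous_intros continuous_lam) (auto simp: less_imp_neq[symmetric])
      ultimately have "continuous_on {a<..} \<psi>'"
        unfolding \<psi>'_def[abs_def] using lam'
        by (intro continuous_intros lam_deriv(2,4)) (auto simp: less_imp_neq[symmetric])
      then show "continuous_on (rep i u ` cimg N i) \<psi>'"
        by (rule continuous_on_subset) (use u_gt in auto)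
    qed
  qed
  have nn: "\<eta> p \<ge> 0" for p
    unfolding \<eta>_def \<psi>_def using f0[OF u_gt] lam'[OF u_gt] by (intro divide_nonneg_pos)
  have le: "weak_curvature \<eta> p \<le> Z p" for p
  proof -
    note r = u_gt[of p] and L = lam_u_pos[of p] and W = W_ge(2)[of p]
    have gp: "gradprod \<eta> u p = \<psi>' (u p) * gradprod u u p"
      unfolding \<eta>_def[abs_def] by (rule gradprod_compose[OF C1_u D\<psi>[OF r]])
    have "\<psi>' (u p) \<le> f' (lam (u p))"
      unfolding \<psi>'_def using f0[OF r] lam''[OF r] by simp
    then have "gradprod \<eta> u p \<le> f' (lam (u p)) * gradprod u u p"
      unfolding gp using gradprod_nonneg[OF C1_u] by (rule mult_right_mono)
    moreover have "lam (u p) * deriv lam (u p) * \<eta> p = lam (u p) * f (lam (u p))"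
      using lam'[OF r] by (simp add: \<eta>_def \<psi>_def)
    ultimately have "weak_curvature \<eta> p \<le> (f' (lam (u p)) * gradprod u u p + n * (lam (u p) * f (lam (u p)))) / W p"
      unfolding weak_curvature_def n_def[symmetric] mult.assoc using W by (intro divide_right_mono) auto
    also have "\<dots> = f' (lam (u p)) * lam (u p) * (tilt p - 1 / tilt p) + n * f (lam (u p)) / tilt p"
    proof -
      have "gradprod u u p = (W p)\<^sup>2 - (lam (u p))\<^sup>2" by (simp add: W_sq)
      then show ?thesis using L W by (simp only:) (simp add: field_simps power2_eq_square)
    qed
    also have "\<dots> \<le> Z p"
      unfolding f_def f'_def Z_def by (rule pointwise_inequality[OF n k s L(1) tilt_ge_1])
    finally show ?thesis .
  qed
  have cZ: "continuous_on UNIV Z" unfolding Z_def[abs_def] by (rule continuous_gap[OF n k s])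
  have mono: "(\<integral>p. weak_curvature \<eta> p \<partial>\<mu>) \<le> (\<integral>p. Z p \<partial>\<mu>)"
    by (intro integral_mono integrable_continuous continuous_weak_curvature C1 cZ le)
  note fv = weak_curvature_nonneg[OF C1 nn H]
  show "(\<integral>p. minkowski_gap n k s (lam (u p)) (tilt p) \<partial>\<mu>) \<ge> 0"
    using fv(1) mono unfolding Z_def by linarith
  assume "(\<integral>p. minkowski_gap n k s (lam (u p)) (tilt p) \<partial>\<mu>) = 0"
  then have Z0: "(\<integral>p. Z p \<partial>\<mu>) = 0" by (simp add: Z_def)
  then have e0: "\<eta> q = 0" for q using fv mono by (intro fv(2)) linarith
  have "f (lam (u q)) = 0" for q using e0[of q] lam'[OF u_gt[of q]] by (auto simp: \<eta>_def \<psi>_def)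
  then have ge: "lam (u q) \<ge> s" for q
    unfolding f_def by (rule cutoff_gap_zero[OF n k s lam_u_pos(1)])
  have Zge: "Z q \<ge> young_gap n k s (lam (u q))" for q
  proof -
    have "s powr k \<le> lam (u q) powr k" using ge k s by (intro powr_mono2) auto
    then have "0 \<le> (lam (u q) powr k - s powr k) * lam (u q) powr n * (tilt q - 1)"
      using tilt_ge_1[of q] by (intro mult_nonneg_nonneg) auto
    then show ?thesis by (simp add: Z_def minkowski_gap_def)
  qed
  then have "Z q \<ge> 0" for q
    using young_gap_nonneg[OF n k s lam_u_pos(1)] order_trans by blast
  from continuous_zero[OF cZ this Z0] have "young_gap n k s (lam (u p)) \<le> 0" using Zge[of p] by simp
  then show "lam (u p) = s"
    using young_gap_pos[OF n k s lam_u_pos(1), of p] by force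
qed

end

lemma (in closed_manifold) mu_pos: "measure \<mu> UNIV > 0"
proof (rule ccontr)
  assume "\<not> measure \<mu> UNIV > 0"
  then have "measure \<mu> UNIV = 0" using measure_nonneg[of \<mu> UNIV] by simp
  then have "(\<integral>p. 1 \<partial>\<mu>) = (0::real)" by simp
  then show False using continuous_zero[of "\<lambda>_. 1" undefined] by simp
qed

lemma (in closed_manifold) integral_density_continuous:
  assumes w: "continuous_on UNIV w" "\<And>p. w p \<ge> 0" and f: "continuous_on UNIV f"
  shows "(\<integral>p. f p \<partial>density \<mu> (\<lambda>p. ennreal (w p))) = (\<integral>p. w p * f p \<partial>\<mu>)"
    "measure (density \<mu> (\<lambda>p. ennreal (w p))) UNIV = (\<integral>p. w p \<partial>\<mu>)"
proof -
  have *: "(\<integral>p. f p \<partial>density \<mu> (\<lambda>p. ennreal (w p))) = (\<integral>p. w p * f p \<partial>\<mu>)" if "continuous_on UNIV f" for f :: "'m \<Rightarrow> real"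
    using w that by (intro integral_real_density borel_measurable_mu borel_measurable_continuous_onI) auto
  show "(\<integral>p. f p \<partial>density \<mu> (\<lambda>p. ennreal (w p))) = (\<integral>p. w p * f p \<partial>\<mu>)" by (rule *[OF f])
  show "measure (density \<mu> (\<lambda>p. ennreal (w p))) UNIV = (\<integral>p. w p \<partial>\<mu>)"
    using *[of "\<lambda>_. 1"] by simp
qed

theorem theorem4p3:
  fixes N :: "('i, 'm::t2_space, 'e::euclidean_space) riem"
    and lam :: "real \<Rightarrow> real" and u :: "'m \<Rightarrow> real" and a k C \<alpha> :: real
  assumes "k \<ge> 1"
    and "closed_riemannian_manifold N"
    and "positive_ricci N"
    and "a \<ge> 0"
    and "continuous_on {a..} lam"
    and "smooth_on {a<..} lam"
    and "\<And>r. r > a \<Longrightarrow> lam r > 0"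
    and "C > 0" and "\<alpha> > 0"
    and "\<And>r. r > a \<Longrightarrow> C \<ge> deriv lam r \<and> deriv lam r > 0"
    and "\<And>r. r > a \<Longrightarrow> C \<ge> lam r powr (1 + \<alpha>) * deriv (deriv lam) r
            \<and> lam r powr (1 + \<alpha>) * deriv (deriv lam) r \<ge> 0"
    and "star_shaped a N u"
    and "mean_convex a lam N u"
  shows
    "let n = real DIM('e);
         M = warped_product a lam N;
         \<Sigma> = induced N M (graph_map u);
         \<Gamma> = induced N M (graph_map (\<lambda>_. a));
         lhs = (\<integral>x. lam (fst (graph_map u x)) powr k \<partial>riem_measure \<Sigma>);
         rhs = n / (n + k) * riem_vol N powr (- k / n) * riem_vol \<Sigma> powr ((n + k) / n)
               + k * (LINT q : enclosed a u | riem_measure M. lam (fst q) powr (k - 1) * deriv lam (fst q))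
               + k / (n + k) * lam a powr k * riem_vol \<Gamma>
     in lhs \<ge> rhs \<and> (lhs = rhs \<longleftrightarrow> (\<exists>r. range (graph_map u) = slice r))"
proof -
  interpret star_graph N u lam a
    using assms by unfold_locales auto
  interpret w: warped_manifold N lam a
    using assms by unfold_locales auto
  define n where "n = real DIM('e)"
  define M where "M = warped_product a lam N"
  define \<Sigma> where "\<Sigma> = induced N M (graph_map u)"
  define \<Gamma> where "\<Gamma> = induced N M (graph_map (\<lambda>_. a))"
  define lhs where "lhs = (\<integral>x. lam (fst (graph_map u x)) powr k \<partial>riem_measure \<Sigma>)"
  define rhs where "rhs = n / (n + k) * riem_vol N powr (- k / n) * riem_vol \<Sigma> powr ((n + k) / n)
               + k * (LINT q : enclosed a u | riem_measure M. lam (fst q) powr (k - 1) * deriv lam (fst q))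
               + k / (n + k) * lam a powr k * riem_vol \<Gamma>"
  have n: "n > 0" and k: "k > 0" using assms(1) by (simp_all add: n_def)
  have lam': "deriv lam r > 0" if "r > a" for r using assms(10)[OF that] by simp
  have lam'': "deriv (deriv lam) r \<ge> 0" if "r > a" for r
    using assms(11)[OF that] lam_pos[OF that] by (simp add: zero_le_mult_iff)
  define \<phi> where "\<phi> p = lam (u p)" for p
  have phi: "\<phi> p > 0" "\<phi> p \<noteq> 0" for p unfolding \<phi>_def by (rule lam_u_pos)+
  have cphi: "continuous_on UNIV \<phi>" unfolding \<phi>_def[abs_def] by (rule continuous_lam_u)
  have cpow: "continuous_on UNIV (\<lambda>p. \<phi> p powr c)" for c
    using phi by (intro continuous_intros cphi) auto
  define A where "A = (\<integral>p. \<phi> p powr n * tilt p \<partial>\<mu>)"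
  define vN where "vN = measure \<mu> UNIV"
  have vN: "vN > 0" unfolding vN_def by (rule mu_pos)
  have cA: "continuous_on UNIV (\<lambda>p. \<phi> p powr n * tilt p)" by (intro continuous_intros cpow continuous_tilt)
  have phin: "\<phi> p ^ DIM('e) = \<phi> p powr n" for p using phi(1)[of p] by (simp add: n_def powr_realpow)
  have volN: "riem_vol N = vN" by (simp add: riem_vol_def points_UNIV vN_def)
  have pts: "points (induced N X f) = UNIV" for X :: "('i, real \<times> 'm, real \<times> 'e) riem" and f
    using points_UNIV by (simp add: points_def)
  have mS: "riem_measure \<Sigma> = density \<mu> (\<lambda>p. ennreal (\<phi> p powr n * tilt p))"
    unfolding \<Sigma>_def M_def riem_measure_graph \<phi>_def[symmetric] phin ..
  have wnn: "\<phi> p powr n * tilt p \<ge> 0" for p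
    using tilt_ge_1[of p] by (intro mult_nonneg_nonneg) (auto intro: order_trans[OF zero_le_one])
  have volS: "riem_vol \<Sigma> = A"
    unfolding riem_vol_def mS A_def using integral_density_continuous(2)[OF cA wnn cA]
    by (simp add: \<Sigma>_def pts)
  have lhs: "lhs = (\<integral>p. \<phi> p powr (n + k) * tilt p \<partial>\<mu>)"
  proof -
    have "lhs = (\<integral>p. \<phi> p powr n * tilt p * \<phi> p powr k \<partial>\<mu>)"
      unfolding lhs_def mS graph_map_def fst_conv
      using integral_density_continuous(1)[OF cA wnn cpow[of k]] by (simp add: \<phi>_def)
    then show ?thesis by (simp add: powr_add mult_ac)
  qed
  have la: "lam a \<ge> 0" by (rule w.lam_nonneg) simp
  have volG: "lam a powr k * riem_vol \<Gamma> = lam a powr (n + k) * vN"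
  proof -
    have "riem_measure \<Gamma> = density \<mu> (\<lambda>p. ennreal (\<bar>lam a\<bar> ^ DIM('e)))"
      unfolding \<Gamma>_def M_def by (rule riem_measure_slice)
    then have "riem_vol \<Gamma> = lam a ^ DIM('e) * vN"
      unfolding riem_vol_def using integral_density_continuous(2)[of "\<lambda>_. \<bar>lam a\<bar> ^ DIM('e)" "\<lambda>_. 1"] la
      by (simp add: \<Gamma>_def pts vN_def mult.commute)
    then show ?thesis using la k by (cases "lam a = 0") (simp_all add: powr_add powr_realpow n_def)
  qed
  define B where "B = (\<integral>p. \<phi> p powr (n + k) \<partial>\<mu>)"
  have volM: "(LINT q : enclosed a u | riem_measure M. lam (fst q) powr (k - 1) * deriv lam (fst q))
     = (B - lam a powr (n + k) * vN) / (n + k)"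
  proof -
    have "(LINT q : enclosed a u | riem_measure M. lam (fst q) powr (k - 1) * deriv lam (fst q))
      = (\<integral>p. (\<phi> p powr (n + k) - lam a powr (n + k)) / (n + k) \<partial>\<mu>)"
      unfolding M_def n_def \<phi>_def
      by (rule w.enclosed_integral[OF continuous_u u_gt k lam_deriv(1,2) lam'])
    also have "\<dots> = (B - lam a powr (n + k) * vN) / (n + k)"
      unfolding B_def vN_def
      by (simp add: integrable_continuous[OF cpow] integrable_continuous mult.commute)
    finally show ?thesis .
  qed
  have A: "A \<ge> 0" unfolding A_def using wnn by (intro integral_nonneg_AE) auto
  have A0: "A > 0"
  proof (rule ccontr)
    assume "\<not> A > 0"
    then have "(\<integral>p. \<phi> p powr n * tilt p \<partial>\<mu>) = 0" using A by (simp add: A_def)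
    from continuous_zero[OF cA wnn this, of undefined] show False
      using phi(1)[of undefined] tilt_ge_1[of undefined] by auto
  qed
  \<comment> \<open>a slice on which \<open>\<lambda> = s\<close> has the same area as \<open>\<Sigma>\<close>\<close>
  define s where "s = (A / vN) powr (1 / n)"
  have s: "s > 0" unfolding s_def using A0 vN by simp
  have sn: "s powr n = A / vN" unfolding s_def using A0 vN n by (simp add: powr_powr)
  have key: "lhs - rhs = (\<integral>p. minkowski_gap n k s (\<phi> p) (tilt p) \<partial>\<mu>)"
  proof -
    have gap: "minkowski_gap n k s (\<phi> p) (tilt p) = \<phi> p powr (n + k) * tilt p - s powr k * (\<phi> p powr n * tilt p)
        - k / (n + k) * \<phi> p powr (n + k) + k / (n + k) * s powr (n + k)" for p
    proof -
      define c where "c = k / (n + k)"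
      have nk: "n / (n + k) = 1 - c" using n k by (simp add: c_def field_simps)
      show ?thesis
        unfolding minkowski_gap_def young_gap_def nk c_def[symmetric] powr_add by (simp add: algebra_simps)
    qed
    have lin: "(\<integral>p. f p - c * g p - d * h p + e \<partial>\<mu>) = (\<integral>p. f p \<partial>\<mu>) - c * (\<integral>p. g p \<partial>\<mu>) - d * (\<integral>p. h p \<partial>\<mu>) + e * vN"
      if "integrable \<mu> f" "integrable \<mu> g" "integrable \<mu> h" for f g h :: "'m \<Rightarrow> real" and c d e
      using that by (simp add: vN_def integrable_continuous[OF continuous_on_const] mult.commute)
    have i1: "integrable \<mu> (\<lambda>p. \<phi> p powr (n + k) * tilt p)"
      by (intro integrable_continuous continuous_intros cpow continuous_tilt)
    have "(\<integral>p. minkowski_gap n k s (\<phi> p) (tilt p) \<partial>\<mu>) = lhs - s powr k * A - k / (n + k) * B + k / (n + k) * s powr (n + k) * vN"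
      unfolding gap lhs A_def B_def
      by (rule lin[OF i1 integrable_continuous[OF cA] integrable_continuous[OF cpow]])
    moreover have "s powr k * A = s powr (n + k) * vN"
      using sn vN by (simp add: powr_add)
    moreover have "n / (n + k) * (vN powr (- k / n) * A powr ((n + k) / n)) = (1 - k / (n + k)) * (s powr (n + k) * vN)"
    proof -
      have "s powr (n + k) = (A / vN) powr ((n + k) / n)" unfolding s_def by (simp add: powr_powr)
      also have "\<dots> = A powr ((n + k) / n) / vN powr ((n + k) / n)" using A0 vN by (simp add: powr_divide)
      also have "vN powr ((n + k) / n) = vN * vN powr (k / n)"
        using n vN by (simp add: add_divide_distrib powr_add)
      finally have "s powr (n + k) * vN = vN powr (- k / n) * A powr ((n + k) / n)"
        using vN by (simp add: powr_minus field_simps)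
      moreover have "n / (n + k) = 1 - k / (n + k)" using n k by (simp add: field_simps)
      ultimately show ?thesis by simp
    qed
    moreover have "rhs = n / (n + k) * (vN powr (- k / n) * A powr ((n + k) / n)) + k / (n + k) * B"
    proof -
      have "rhs = n / (n + k) * (vN powr (- k / n) * A powr ((n + k) / n))
         + k * ((B - lam a powr (n + k) * vN) / (n + k)) + k / (n + k) * (lam a powr (n + k) * vN)"
        unfolding rhs_def volN volS volM volG[symmetric] by simp
      also have "k * ((B - lam a powr (n + k) * vN) / (n + k)) = k / (n + k) * B - k / (n + k) * (lam a powr (n + k) * vN)"
        by (simp add: right_diff_distrib diff_divide_distrib)
      finally show ?thesis by simp
    qed
    ultimately show ?thesis by (simp add: algebra_simps)
  qed
  have gi1: "(\<integral>p. minkowski_gap n k s (\<phi> p) (tilt p) \<partial>\<mu>) \<ge> 0"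
    unfolding n_def \<phi>_def by (rule gap_integral(1)[OF k s assms(13) lam' lam''])
  have gi2: "\<phi> p = s" if "(\<integral>p. minkowski_gap n k s (\<phi> p) (tilt p) \<partial>\<mu>) = 0" for p
  proof -
    have "(\<integral>p. minkowski_gap (real DIM('e)) k s (lam (u p)) (tilt p) \<partial>\<mu>) = 0"
      using that unfolding n_def \<phi>_def .
    from gap_integral(2)[OF k s assms(13) lam' lam'' this] show ?thesis unfolding \<phi>_def .
  qed
  have ineq: "lhs \<ge> rhs" using gi1 key by linarith
  have "lhs = rhs \<longleftrightarrow> (\<exists>r. range (graph_map u) = slice r)"
  proof
    assume "lhs = rhs"
    have c: "\<phi> p = s" for p by (rule gi2) (use key \<open>lhs = rhs\<close> in simp)
    have mono: "lam x < lam y" if "a < x" "x < y" for x y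
    proof (rule DERIV_pos_imp_increasing[OF that(2)])
      show "\<exists>d. (lam has_real_derivative d) (at t) \<and> 0 < d" if "x \<le> t" "t \<le> y" for t
        using that \<open>a < x\<close> by (intro exI[of _ "deriv lam t"] conjI lam_deriv(1) lam') auto
    qed
    define r where "r = u undefined"
    have "u p = r" for p
      using mono[OF u_gt, of p "u undefined"] mono[OF u_gt, of undefined "u p"] c[of p] c[of undefined]
      unfolding \<phi>_def r_def by linarith
    then have "range (graph_map u) = slice r"
      by (auto simp: graph_map_def slice_def image_iff)
    then show "\<exists>r. range (graph_map u) = slice r" ..
  next
    assume "\<exists>r. range (graph_map u) = slice r"
    then obtain r where r: "range (graph_map u) = slice r" ..
    have ur: "u p = r" for p
    proof -
      have "graph_map u p \<in> slice r" using r by blast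
      then show ?thesis by (simp add: graph_map_def slice_def)
    qed
    have "gradprod u u p = 0" for p
      unfolding gradprod_def Let_def ur frechet_derivative_const ..
    then have tilt: "tilt p = 1" for p using lam_u_pos[of p] by (simp add: W_def)
    have phir: "\<phi> p = lam r" for p by (simp add: \<phi>_def ur)
    have lr: "lam r > 0" using phi(1) unfolding phir .
    have "A = lam r powr n * vN" unfolding A_def tilt vN_def by (simp add: phir)
    then have "s = lam r" unfolding s_def using vN n lr by (simp add: powr_powr)
    then have "minkowski_gap n k s (\<phi> p) (tilt p) = 0" for p
      using young_gap_self[of n k s] n k s phir[of p] by (simp add: minkowski_gap_def tilt)
    then show "lhs = rhs" using key by simp
  qed
  with ineq have "lhs \<ge> rhs \<and> (lhs = rhs \<longleftrightarrow> (\<exists>r. range (graph_map u) = slice r))"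
    by (rule conjI)
  then show ?thesis
    unfolding Let_def lhs_def rhs_def \<Sigma>_def \<Gamma>_def M_def n_def .
qed

end
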